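(* Let $\kappa\in(0,2]$ and let $\tau_{\mathrm f}(\kappa)=\frac12\left(\frac{\kappa^2}{4}-1\right)^4$. Let $n=n(d)$ with $n,d\to\infty$ and $n/d^2\to\tau\in(0,\infty)$, and for each $d$ let $W_1,\dots,W_n$ be i.i.d. $\mathrm{GOE}(d)$ matrices. Assume that the function $G_d$ defined in the context satisfies $$\lim_{\epsilon\downarrow0}\ \limsup_{d\to\infty}\ \sup_{|q|\le\epsilon}\left|G_d''(q)-G_d''(0)\right|=0 .$$ If $\tau<\tau_{\mathrm f}(\kappa)$, then $$\liminf_{d\to\infty}\frac{1}{d^2}\log\frac{\mathbb{E}[Z_\kappa^2]}{\mathbb{E}[Z_\kappa]^2}>0 .$$
   Context: $\mathrm{GOE}(d)$ is the law of a random real symmetric $d\times d$ matrix $Y$ whose entries $(Y_{ij})_{i\le j}$ are independent with $Y_{ij}\sim\mathcal N(0,(1+\delta_{ij})/d)$. $\|\cdot\|_{\mathrm{op}}$ is the operator (spectral) norm. $Z_\kappa$ is the number of $\varepsilon\in\{\pm1\}^n$ such that $\left\|\sum_{i=1}^n\varepsilon_iW_i\right\|_{\mathrm{op}}\le\kappa\sqrt n$. For $q\in[-1,1]$, $$G_d(q)=\frac1n\log\frac{\mathbb{P}\left[\|W\|_{\mathrm{op}}\le\kappa\ \text{and}\ \|qW+\sqrt{1-q^2}\,Z\|_{\mathrm{op}}\le\kappa\right]}{\mathbb{P}\left[\|W\|_{\mathrm{op}}\le\kappa\right]^2},$$ where $W,Z$ are independent $\mathrm{GOE}(d)$ matrices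 and $n=n(d)$; derivatives of $G_d$ are with respect to $q\in(-1,1)$. *)

theory Defs
  imports "HOL-Probability.Probability"
begin

text \<open>Since the dimension varies, a real \<open>d \<times> d\<close> matrix is represented by the function
  \<open>(i, j) \<mapsto> A (i, j)\<close> on \<open>{..<d} \<times> {..<d}\<close> (zero-based indices).\<close>

type_synonym rmat = "nat \<times> nat \<Rightarrow> real"

definition mat_space :: "nat \<Rightarrow> rmat measure" where
  "mat_space d = (\<Pi>\<^sub>M ij\<in>{..<d} \<times> {..<d}. borel)"

definition op_norm :: "nat \<Rightarrow> rmat \<Rightarrow> real" where
  "op_norm d A =
     (SUP x\<in>{x :: nat \<Rightarrow> real. L2_set x {..<d} \<le> 1}.
        L2_set (\<lambda>i. \<Sum>j<d. A (i, j) * x j) {..<d})"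

text \<open>The entries with \<open>i \<le> j\<close> are drawn independently and reflected along the diagonal. The
  second parameter of \<^const>\<open>normal_density\<close> is the standard deviation.\<close>

definition GOE :: "nat \<Rightarrow> rmat measure" where
  "GOE d =
     distr
       (\<Pi>\<^sub>M (i, j)\<in>{(i, j). i \<le> j \<and> j < d}.
          density lborel (\<lambda>x. ennreal
            (normal_density 0 (sqrt ((1 + (if i = j then 1 else 0)) / real d)) x)))
       (mat_space d)
       (\<lambda>y. \<lambda>(i, j)\<in>{..<d} \<times> {..<d}. y (min i j, max i j))"

definition num_solutions :: "real \<Rightarrow> nat \<Rightarrow> nat \<Rightarrow> (nat \<Rightarrow> rmat) \<Rightarrow> nat" where
  "num_solutions \<kappa> d n W =
     card {\<epsilon> \<in> {..<n} \<rightarrow>\<^sub>E {- 1, 1 :: real}.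
             op_norm d (\<lambda>ij. \<Sum>i<n. \<epsilon> i * W i ij) \<le> \<kappa> * sqrt (real n)}"

text \<open>Meaningful for \<open>q \<in> [-1, 1]\<close> only.\<close>

definition G :: "real \<Rightarrow> nat \<Rightarrow> nat \<Rightarrow> real \<Rightarrow> real" where
  "G \<kappa> d n q =
     1 / real n *
     ln (\<P>((W, Z) in GOE d \<Otimes>\<^sub>M GOE d.
            op_norm d W \<le> \<kappa> \<and>
            op_norm d (\<lambda>ij. q * W ij + sqrt (1 - q\<^sup>2) * Z ij) \<le> \<kappa>)
         / (\<P>(W in GOE d. op_norm d W \<le> \<kappa>))\<^sup>2)"

definition tau_f :: "real \<Rightarrow> real" where
  "tau_f \<kappa> = 1 / 2 * (\<kappa>\<^sup>2 / 4 - 1) ^ 4"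

end

theory Submission
  imports Defs "HOL-Real_Asymp.Real_Asymp"
begin

text \<open>For sign vectors that differ in \<open>l\<close> of the \<open>n\<close> places, put \<open>q = 1 - 2 l / n\<close>. The two
normalised signed sums are then distributed as \<open>(W, q W + sqrt (1 - q^2) Z)\<close> (\<open>pair_sum_prob\<close>),
so that the moment ratio is \<open>2^(-n)\<close> times the sum over \<open>l\<close> of \<open>(n choose l) exp (n G q)\<close>. A
single well chosen term suffices. Its binomial weight costs \<open>n\<close> times the Cramer rate, which is
\<open>q^2 / 2\<close> to second order (\<open>binomial_entropy_bound\<close>), while \<open>G 0 = 0\<close> and \<open>G' 0 = 0\<close>. Hence the
ratio grows exponentially once \<open>G'' 0\<close> stays above \<open>1\<close>: the hypothesis on \<open>G''\<close> keeps the second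
derivative of \<open>G\<close> minus the rate bounded below on a fixed interval \<open>[0, \<epsilon>]\<close>, and \<open>l\<close> is chosen
such that \<open>q\<close> lies in \<open>[\<epsilon> / 2, \<epsilon>]\<close>.

The curvature (\<open>G_taylor\<close>) is computed from the Mehler kernel. Let \<open>N = d (d + 1) / 2\<close>, let \<open>x\<close>
and \<open>v\<close> be the vectors of standardised independent entries of two independent GOE matrices, both
conditioned on operator norm at most \<open>\<kappa>\<close>. Then \<open>n G'' 0 = N - 2 E|x|^2 + E <x, v>^2\<close>, and the
last term is the squared Frobenius norm of the covariance matrix of \<open>x\<close>, hence at least
\<open>(E|x|^2)^2 / N\<close>. So \<open>n G'' 0 \<ge> (N - E|x|^2)^2 / N\<close>, where \<open>|x|^2 = (d / 2) tr W^2\<close>.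

It remains to see that conditioning reduces the second moment, in the form
\<open>N - E|x|^2 \<ge> (d^2 / 2) (1 - \<kappa>^2 / 4)^2\<close> for every \<open>d\<close> (\<open>second_moment_bound\<close>). With
\<open>N \<approx> d^2 / 2\<close> this bounds \<open>G'' 0\<close> below by about \<open>tau_f \<kappa> / \<tau> > 1\<close>. The heuristic proof is a
loop equation. For \<open>z > \<kappa>\<close> the vector field
\<open>X \<mapsto> (\<kappa>^2 - X^2) (z - X)^(-1) = z + X - (z^2 - \<kappa>^2) (z - X)^(-1)\<close> is tangent to the boundary of
the norm ball, so the divergence theorem for the conditioned Gaussian measure has no boundary
term. With \<open>r = tr (z - X)^(-1) / d\<close> it yields
\<open>N - E|x|^2 \<ge> (z^2 - \<kappa>^2) (d^2 / 2) E (r^2 - z r + 1) \<ge> (z^2 - \<kappa>^2) (d^2 / 2) (1 - z^2 / 4)\<close>,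
and \<open>z^2 = (4 + \<kappa>^2) / 2\<close> is optimal.

The proof below needs neither a boundary nor eigenvalues. The indicator of the ball is replaced
by the weight \<open>exp (- \<theta> tr (X / \<kappa>)^(2 p))\<close> with \<open>p = 2^s\<close>, and the resolvent by its powers.
Gaussian integration by parts in every entry gives exact loop equations (\<open>loop_equation\<close>), in
which the boundary term for the field \<open>X^(2 m + 1)\<close> is a multiple of the weighted expectation of
\<open>tr X^(2 p + 2 m)\<close>. The weight suppresses matrices of norm larger than \<open>\<kappa>\<close>, so as \<open>p\<close> grows this
boundary term is at most \<open>\<kappa>^(2 m)\<close> times the one for the field \<open>X\<close> (\<open>loop_inequality\<close>). Summing
the inequalities with the weights \<open>z^(- 2 m - 2)\<close> restores the trace of the resolvent, split
into its even and its odd part, and completing the square (\<open>loop_term_sum_bound\<close>) finishes the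
bound; at the end \<open>\<theta>\<close> tends to \<open>0\<close>.\<close>

section \<open>Powers and traces of symmetric matrices\<close>

definition mat_mul :: "nat \<Rightarrow> rmat \<Rightarrow> rmat \<Rightarrow> rmat" where
  "mat_mul d A B = (\<lambda>(i, j). \<Sum>k<d. A (i, k) * B (k, j))"

text \<open>Matrices are functions on all pairs of natural numbers, of which only the indices below
\<open>d\<close> matter. The zeroth power is the identity without a bound on the indices, so the rules for
products of powers need index bounds.\<close>

primrec mat_pow :: "nat \<Rightarrow> rmat \<Rightarrow> nat \<Rightarrow> rmat" where
  "mat_pow d A 0 = (\<lambda>(i, j). if i = j then 1 else 0)"
| "mat_pow d A (Suc k) = mat_mul d A (mat_pow d A k)"

definition sym_mat :: "rmat \<Rightarrow> bool" where
  "sym_mat A \<longleftrightarrow> (\<forall>i j. A (i, j) = A (j, i))"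

definition mat_trace :: "nat \<Rightarrow> rmat \<Rightarrow> real" where
  "mat_trace d A = (\<Sum>i<d. A (i, i))"

definition mat_vec :: "nat \<Rightarrow> rmat \<Rightarrow> (nat \<Rightarrow> real) \<Rightarrow> nat \<Rightarrow> real" where
  "mat_vec d A x = (\<lambda>i. \<Sum>j<d. A (i, j) * x j)"

abbreviation vnorm :: "nat \<Rightarrow> (nat \<Rightarrow> real) \<Rightarrow> real" where
  "vnorm d x \<equiv> L2_set x {..<d}"

lemma mat_vec_frobenius:
  "vnorm d (mat_vec d A x) \<le> sqrt (\<Sum>i<d. \<Sum>j<d. (A (i, j))\<^sup>2) * vnorm d x"
proof -
  have "(mat_vec d A x i)\<^sup>2 \<le> (\<Sum>j<d. (A (i, j))\<^sup>2) * (\<Sum>j<d. (x j)\<^sup>2)" for i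
  proof -
    have "\<bar>mat_vec d A x i\<bar> \<le> L2_set (\<lambda>j. A (i, j)) {..<d} * vnorm d x"
      unfolding mat_vec_def
      by (rule order_trans[OF sum_abs])
        (simp add: abs_mult, rule L2_set_mult_ineq)
    then have "\<bar>mat_vec d A x i\<bar>\<^sup>2 \<le> (L2_set (\<lambda>j. A (i, j)) {..<d} * vnorm d x)\<^sup>2"
      by (intro power_mono) auto
    also have "\<dots> = (\<Sum>j<d. (A (i, j))\<^sup>2) * (\<Sum>j<d. (x j)\<^sup>2)"
      by (simp add: power_mult_distrib L2_set_def sum_nonneg)
    finally show ?thesis by simp
  qed
  then have "(\<Sum>i<d. (mat_vec d A x i)\<^sup>2) \<le> (\<Sum>i<d. \<Sum>j<d. (A (i, j))\<^sup>2) * (\<Sum>j<d. (x j)\<^sup>2)"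
    by (simp add: sum_distrib_right sum_mono)
  then have "sqrt (\<Sum>i<d. (mat_vec d A x i)\<^sup>2)
      \<le> sqrt ((\<Sum>i<d. \<Sum>j<d. (A (i, j))\<^sup>2) * (\<Sum>j<d. (x j)\<^sup>2))"
    by (rule real_sqrt_le_mono)
  then show ?thesis
    by (simp add: L2_set_def real_sqrt_mult)
qed

lemma op_norm_eq: "op_norm d A = (SUP x\<in>{x. vnorm d x \<le> 1}. vnorm d (mat_vec d A x))"
  by (simp add: op_norm_def mat_vec_def)

lemma op_norm_bdd: "bdd_above ((\<lambda>x. vnorm d (mat_vec d A x)) ` {x. vnorm d x \<le> 1})"
proof (rule bdd_aboveI2)
  fix x :: "nat \<Rightarrow> real" assume "x \<in> {x. vnorm d x \<le> 1}"
  then have "sqrt (\<Sum>i<d. \<Sum>j<d. (A (i, j))\<^sup>2) * vnorm d x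
      \<le> sqrt (\<Sum>i<d. \<Sum>j<d. (A (i, j))\<^sup>2) * 1"
    by (intro mult_left_mono) (auto intro!: sum_nonneg)
  then show "vnorm d (mat_vec d A x) \<le> sqrt (\<Sum>i<d. \<Sum>j<d. (A (i, j))\<^sup>2)"
    using mat_vec_frobenius[of d A x] by simp
qed

lemma op_norm_nonneg: "0 \<le> op_norm d A"
proof -
  have "vnorm d (mat_vec d A (\<lambda>_. 0)) \<le> op_norm d A"
    unfolding op_norm_eq by (rule cSUP_upper[OF _ op_norm_bdd]) (simp add: L2_set_def)
  then show ?thesis
    using L2_set_nonneg[of "mat_vec d A (\<lambda>_. 0)" "{..<d}"] by linarith
qed

lemma vnorm_scale: "vnorm d (\<lambda>i. c * x i) = \<bar>c\<bar> * vnorm d x"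
  by (simp add: L2_set_def power_mult_distrib flip: sum_distrib_left) (simp add: real_sqrt_mult)

lemma mat_vec_scale: "mat_vec d A (\<lambda>i. c * x i) = (\<lambda>i. c * mat_vec d A x i)"
  by (simp add: mat_vec_def sum_distrib_left mult_ac)

text \<open>The supremum in the definition of the operator norm is finite because of the Frobenius
bound, so homogeneity turns it into an inequality for all vectors.\<close>

lemma op_norm_bound: "vnorm d (mat_vec d A x) \<le> op_norm d A * vnorm d x"
proof (cases "vnorm d x = 0")
  case True
  then show ?thesis
    using mat_vec_frobenius[of d A x] by simp
next
  case False
  then have pos: "0 < vnorm d x"
    using L2_set_nonneg[of x "{..<d}"] by linarith
  let ?y = "\<lambda>i. inverse (vnorm d x) * x i"
  have "vnorm d ?y = 1"
    using pos by (simp add: vnorm_scale)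
  then have "vnorm d (mat_vec d A ?y) \<le> op_norm d A"
    unfolding op_norm_eq by (intro cSUP_upper[OF _ op_norm_bdd]) simp
  then show ?thesis
    unfolding mat_vec_scale vnorm_scale using pos by (simp add: field_simps)
qed

lemma op_norm_le:
  assumes "0 \<le> c" "\<And>x. vnorm d (mat_vec d A x) \<le> c * vnorm d x"
  shows "op_norm d A \<le> c"
  unfolding op_norm_eq
proof (rule cSUP_least)
  show "{x. vnorm d x \<le> 1} \<noteq> {}"
    by (auto intro!: exI[of _ "\<lambda>_. 0::real"] simp: L2_set_def)
  fix x assume "x \<in> {x. vnorm d x \<le> 1}"
  then have "c * vnorm d x \<le> c * 1"
    using assms(1) by (intro mult_left_mono) auto
  then show "vnorm d (mat_vec d A x) \<le> c"
    using assms(2)[of x] by simp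
qed

lemma op_norm_cong:
  assumes "\<And>i j. i < d \<Longrightarrow> j < d \<Longrightarrow> A (i, j) = B (i, j)"
  shows "op_norm d A = op_norm d B"
proof -
  have "L2_set (\<lambda>i. \<Sum>j<d. A (i, j) * x j) {..<d} = L2_set (\<lambda>i. \<Sum>j<d. B (i, j) * x j) {..<d}" for x
    using assms by (intro L2_set_cong) auto
  then show ?thesis
    by (simp add: op_norm_def)
qed

lemma op_norm_le_frobenius: "op_norm d A \<le> sqrt (\<Sum>i<d. \<Sum>j<d. (A (i, j))\<^sup>2)"
  by (rule op_norm_le[OF _ mat_vec_frobenius]) (simp add: sum_nonneg)

lemma op_norm_scale: "op_norm d (\<lambda>ij. c * A ij) = \<bar>c\<bar> * op_norm d A"
proof -
  have *: "vnorm d (mat_vec d (\<lambda>ij. c * A ij) x) = \<bar>c\<bar> * vnorm d (mat_vec d A x)" for c A x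
    by (simp add: mat_vec_def mult.assoc vnorm_scale flip: sum_distrib_left)
  have le: "op_norm d (\<lambda>ij. c * A ij) \<le> \<bar>c\<bar> * op_norm d A" for c A
    using op_norm_bound[of d A]
    by (intro op_norm_le) (auto simp: * op_norm_nonneg mult.assoc intro!: mult_left_mono)
  show ?thesis
  proof (cases "c = 0")
    case True
    then show ?thesis
      using le[of c A] op_norm_nonneg[of d "\<lambda>ij. c * A ij"] by simp
  next
    case False
    then have "(\<lambda>ij. inverse c * (c * A ij)) = A"
      by auto
    then have "op_norm d A \<le> \<bar>inverse c\<bar> * op_norm d (\<lambda>ij. c * A ij)"
      using le[of "inverse c" "\<lambda>ij. c * A ij"] by simp
    then show ?thesis
      using False le[of c A] by (intro antisym) (auto simp: field_simps)
  qed
qed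

lemma mat_vec_mul: "mat_vec d (mat_mul d A B) x = mat_vec d A (mat_vec d B x)"
  unfolding mat_vec_def mat_mul_def
  by (auto simp: sum_distrib_left sum_distrib_right mult_ac intro!: ext intro: sum.swap)

lemma mat_pow_add:
  assumes "i < d"
  shows "mat_pow d A (a + b) (i, j) = (\<Sum>k<d. mat_pow d A a (i, k) * mat_pow d A b (k, j))"
  using assms
proof (induction a arbitrary: i)
  case 0
  then show ?case
    by (simp add: if_distrib[of "\<lambda>x. x * _"] cong: if_cong)
next
  case (Suc a)
  have "mat_pow d A (Suc a + b) (i, j) = (\<Sum>l<d. \<Sum>k<d. A (i, l) * mat_pow d A a (l, k) * mat_pow d
      A b (k, j))"
    by (simp add: mat_mul_def Suc.IH sum_distrib_left mult_ac)
  also have "\<dots> = (\<Sum>k<d. \<Sum>l<d. A (i, l) * mat_pow d A a (l, k) * mat_pow d A b (k, j))"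
    by (rule sum.swap)
  finally show ?case
    by (simp add: mat_mul_def sum_distrib_right)
qed

lemma mat_pow_Suc_right:
  assumes "i < d" "j < d"
  shows "mat_pow d A (Suc a) (i, j) = (\<Sum>k<d. mat_pow d A a (i, k) * A (k, j))"
proof -
  have "mat_pow d A 1 (k, j) = A (k, j)" for k
    using assms(2) by (simp add: mat_mul_def if_distrib[of "\<lambda>x. _ * x"] cong: if_cong)
  then show ?thesis
    using mat_pow_add[of i d A a 1 j] assms by simp
qed

lemma mat_pow_sym:
  assumes "sym_mat A" "i < d" "j < d"
  shows "mat_pow d A a (i, j) = mat_pow d A a (j, i)"
  using assms(2,3)
proof (induction a arbitrary: i j)
  case (Suc a)
  have "mat_pow d A (Suc a) (i, j) = (\<Sum>k<d. A (i, k) * mat_pow d A a (k, j))"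
    by (simp add: mat_mul_def)
  also have "\<dots> = (\<Sum>k<d. mat_pow d A a (j, k) * A (k, i))"
    using Suc assms(1) by (intro sum.cong) (auto simp: mult.commute sym_mat_def)
  finally show ?case
    using mat_pow_Suc_right[of j d i A a] Suc by simp
qed auto

lemma mat_vec_pow_add:
  assumes "i < d"
  shows "mat_vec d (mat_pow d A (a + b)) x i = mat_vec d (mat_pow d A a) (mat_vec d (mat_pow d A
      b) x) i"
  unfolding mat_vec_mul[symmetric]
  by (simp add: mat_vec_def mat_pow_add[OF assms] mat_mul_def)

lemma mat_vec_pow_bound:
  "vnorm d (mat_vec d (mat_pow d A k) x) \<le> op_norm d A ^ k * vnorm d x"
proof (induction k)
  case 0
  have "vnorm d (mat_vec d (mat_pow d A 0) x) = vnorm d x"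
    by (intro L2_set_cong) (auto simp: mat_vec_def if_distrib[of "\<lambda>x. x * _"] cong: if_cong)
  then show ?case by simp
next
  case (Suc k)
  have "vnorm d (mat_vec d (mat_pow d A (Suc k)) x)
      \<le> op_norm d A * vnorm d (mat_vec d (mat_pow d A k) x)"
    by (simp add: mat_vec_mul op_norm_bound)
  also have "\<dots> \<le> op_norm d A * (op_norm d A ^ k * vnorm d x)"
    by (intro mult_left_mono Suc.IH op_norm_nonneg)
  finally show ?case by (simp add: mult_ac)
qed

definition unit_vec :: "nat \<Rightarrow> nat \<Rightarrow> real" where
  "unit_vec j = (\<lambda>i. if i = j then 1 else 0)"

lemma mat_vec_unit: "j < d \<Longrightarrow> mat_vec d A (unit_vec j) i = A (i, j)"
  by (simp add: mat_vec_def unit_vec_def if_distrib[of "\<lambda>x. _ * x"] cong: if_cong)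

lemma vnorm_unit: "j < d \<Longrightarrow> vnorm d (unit_vec j) = 1"
  by (simp add: L2_set_def unit_vec_def if_distrib[of "\<lambda>x. x\<^sup>2"] cong: if_cong)

lemma abs_le_vnorm: "i < d \<Longrightarrow> \<bar>x i\<bar> \<le> vnorm d x"
  using member_le_L2_set[of "{..<d}" i "\<lambda>i. \<bar>x i\<bar>"] by (simp add: L2_set_def)

lemma abs_mat_pow_le:
  assumes "i < d" "j < d"
  shows "\<bar>mat_pow d A k (i, j)\<bar> \<le> op_norm d A ^ k"
  using abs_le_vnorm[OF assms(1), of "mat_vec d (mat_pow d A k) (unit_vec j)"]
    mat_vec_pow_bound[of d A k "unit_vec j"] assms
  by (simp add: mat_vec_unit vnorm_unit)

definition pow_trace :: "nat \<Rightarrow> rmat \<Rightarrow> nat \<Rightarrow> real" where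
  "pow_trace d A k = mat_trace d (mat_pow d A k)"

lemma pow_trace_0: "pow_trace d A 0 = d"
  by (simp add: pow_trace_def mat_trace_def)

lemma abs_pow_trace_le: "\<bar>pow_trace d A k\<bar> \<le> d * op_norm d A ^ k"
proof -
  have "\<bar>pow_trace d A k\<bar> \<le> (\<Sum>i<d. \<bar>mat_pow d A k (i, i)\<bar>)"
    unfolding pow_trace_def mat_trace_def by (rule sum_abs)
  also have "\<dots> \<le> (\<Sum>i<d. op_norm d A ^ k)"
    by (intro sum_mono abs_mat_pow_le) auto
  finally show ?thesis by simp
qed

lemma pow_trace_add:
  assumes "sym_mat A"
  shows "pow_trace d A (a + b) = (\<Sum>i<d. \<Sum>j<d. mat_pow d A a (i, j) * mat_pow d A b (i, j))"
  unfolding pow_trace_def mat_trace_def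
proof (rule sum.cong[OF refl])
  fix i assume i: "i \<in> {..<d}"
  have "mat_pow d A b (j, i) = mat_pow d A b (i, j)" if "j < d" for j
    using mat_pow_sym[of A j d i b, OF assms] that i by simp
  then show "mat_pow d A (a + b) (i, i) = (\<Sum>j<d. mat_pow d A a (i, j) * mat_pow d A b (i, j))"
    using i by (simp add: mat_pow_add)
qed

lemma pow_trace_even:
  assumes "sym_mat A"
  shows "pow_trace d A (2 * k) = (\<Sum>i<d. \<Sum>j<d. (mat_pow d A k (i, j))\<^sup>2)"
  using pow_trace_add[of A d k k, OF assms] by (simp add: mult_2 power2_eq_square)

lemma pow_trace_even_nonneg:
  assumes "sym_mat A"
  shows "0 \<le> pow_trace d A (2 * k)"
  by (simp add: pow_trace_even[OF assms] sum_nonneg)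

lemma pow_trace_even_columns:
  assumes "sym_mat A"
  shows "pow_trace d A (2 * k) = (\<Sum>j<d. (vnorm d (mat_vec d (mat_pow d A k) (unit_vec j)))\<^sup>2)"
proof -
  have "(vnorm d (mat_vec d (mat_pow d A k) (unit_vec j)))\<^sup>2 = (\<Sum>i<d. (mat_pow d A k (i, j))\<^sup>2)"
    if "j < d" for j
    using that by (simp add: L2_set_def mat_vec_unit sum_nonneg)
  then show ?thesis
    unfolding pow_trace_even[OF assms] by (subst sum.swap) simp
qed

text \<open>An even power trace is the sum of the squared norms of the columns of a power of \<open>A\<close>, and
multiplying a column by \<open>A^k\<close> costs at most the \<open>k\<close>-th power of the operator norm.\<close>

lemma pow_trace_even_step:
  assumes "sym_mat A"
  shows "pow_trace d A (2 * (p + k)) \<le> op_norm d A ^ (2 * k) * pow_trace d A (2 * p)"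
  unfolding pow_trace_even_columns[OF assms] sum_distrib_left
proof (rule sum_mono)
  fix j assume "j \<in> {..<d}"
  have "vnorm d (mat_vec d (mat_pow d A (p + k)) (unit_vec j))
     = vnorm d (mat_vec d (mat_pow d A k) (mat_vec d (mat_pow d A p) (unit_vec j)))"
    by (intro L2_set_cong) (auto simp: add.commute[of p] mat_vec_pow_add)
  also have "\<dots> \<le> op_norm d A ^ k * vnorm d (mat_vec d (mat_pow d A p) (unit_vec j))"
    by (rule mat_vec_pow_bound)
  finally have "(vnorm d (mat_vec d (mat_pow d A (p + k)) (unit_vec j)))\<^sup>2 \<le>
      (op_norm d A ^ k * vnorm d (mat_vec d (mat_pow d A p) (unit_vec j)))\<^sup>2"
    by (intro power_mono) auto
  then show "(vnorm d (mat_vec d (mat_pow d A (p + k)) (unit_vec j)))\<^sup>2 \<le>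
      op_norm d A ^ (2 * k) * (vnorm d (mat_vec d (mat_pow d A p) (unit_vec j)))\<^sup>2"
    by (simp add: power_mult_distrib power_mult[symmetric] mult.commute)
qed

lemma mat_vec_square_bound:
  assumes "sym_mat A"
  shows "(vnorm d (mat_vec d (mat_pow d A k) x))\<^sup>2 \<le> vnorm d x * vnorm d (mat_vec d (mat_pow d A (2
      * k)) x)"
proof -
  let ?y = "mat_vec d (mat_pow d A k) x"
  have sym: "mat_pow d A k (i, j) = mat_pow d A k (j, i)" if "i < d" "j < d" for i j
    by (rule mat_pow_sym[OF assms that])
  have "(vnorm d ?y)\<^sup>2 = (\<Sum>i<d. (\<Sum>j<d. mat_pow d A k (i, j) * x j) * ?y i)"
    by (simp add: L2_set_def sum_nonneg power2_eq_square) (simp add: mat_vec_def)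
  also have "\<dots> = (\<Sum>j<d. \<Sum>i<d. mat_pow d A k (i, j) * x j * ?y i)"
    by (subst sum.swap) (simp add: sum_distrib_right)
  also have "\<dots> = (\<Sum>j<d. x j * mat_vec d (mat_pow d A k) ?y j)"
    unfolding mat_vec_def[of d _ ?y] sum_distrib_left
    by (intro sum.cong) (auto simp: sym mult_ac)
  also have "\<dots> = (\<Sum>j<d. x j * mat_vec d (mat_pow d A (2 * k)) x j)"
    by (intro sum.cong) (auto simp: mult_2 mat_vec_pow_add)
  also have "\<dots> \<le> (\<Sum>j<d. \<bar>x j\<bar> * \<bar>mat_vec d (mat_pow d A (2 * k)) x j\<bar>)"
    by (intro sum_mono) (metis abs_mult abs_ge_self)
  also have "\<dots> \<le> vnorm d x * vnorm d (mat_vec d (mat_pow d A (2 * k)) x)"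
    by (rule L2_set_mult_ineq)
  finally show ?thesis .
qed

text \<open>The identity \<open>|A^k x|^2 = <x, A^(2 k) x>\<close> turns a bound on \<open>A^(2 k)\<close> into one on \<open>A^k\<close>.
Halving repeatedly leads from the Frobenius bound for \<open>A^(2^s)\<close> to a bound for \<open>A\<close>. This
replaces a spectral decomposition, and it is the reason why the cutoff uses exponents that are
powers of two.\<close>

lemma op_norm_pow_le_pow_trace:
  assumes sym: "sym_mat A"
  shows "op_norm d A ^ (2 * 2 ^ s) \<le> pow_trace d A (2 * 2 ^ s)"
proof -
  \<comment> \<open>Induction on \<open>s\<close> halves the exponent down to \<open>1\<close>.\<close>
  have step: "op_norm d A \<le> c"
    if "0 \<le> c" "\<And>x. vnorm d (mat_vec d (mat_pow d A (2 ^ s)) x) \<le> c ^ 2 ^ s * vnorm d x" for c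
    using that(2)
  proof (induction s)
    case 0
    have "vnorm d (mat_vec d (mat_pow d A 1) x) = vnorm d (mat_vec d A x)" for x
    proof (intro L2_set_cong refl)
      fix i assume "i \<in> {..<d}"
      have "mat_vec d (mat_pow d A 0) x j = x j" if "j < d" for j
        using that by (simp add: mat_vec_def if_distrib[of "\<lambda>x. x * _"] cong: if_cong)
      then show "mat_vec d (mat_pow d A 1) x i = mat_vec d A x i"
        by (simp add: mat_vec_mul del: mat_pow.simps(1)) (simp add: mat_vec_def del: mat_pow.simps(1))
    qed
    then show ?case
      using 0 that(1) by (intro op_norm_le) auto
  next
    case (Suc s)
    show ?case
    proof (rule Suc.IH)
      fix x
      have "(vnorm d (mat_vec d (mat_pow d A (2 ^ s)) x))\<^sup>2 \<le> vnorm d x * vnorm d (mat_vec d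
          (mat_pow d A (2 * 2 ^ s)) x)"
        by (rule mat_vec_square_bound[OF sym])
      also have "\<dots> \<le> vnorm d x * (c ^ (2 * 2 ^ s) * vnorm d x)"
        using Suc.prems[of x] by (intro mult_left_mono) auto
      also have "\<dots> = (c ^ 2 ^ s * vnorm d x)\<^sup>2"
        by (simp add: power2_eq_square mult_2 power_add mult_ac)
      finally show "vnorm d (mat_vec d (mat_pow d A (2 ^ s)) x) \<le> c ^ 2 ^ s * vnorm d x"
        by (rule power2_le_imp_le) (use that(1) in auto)
    qed
  qed
  define F where "F = sqrt (pow_trace d A (2 * 2 ^ s))"
  have F: "vnorm d (mat_vec d (mat_pow d A (2 ^ s)) x) \<le> F * vnorm d x" for x
    unfolding F_def pow_trace_even[OF sym] by (rule mat_vec_frobenius)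
  have F0: "0 \<le> F"
    using pow_trace_even_nonneg[of A d "2 ^ s", OF sym] by (simp add: F_def)
  have root: "root (2 ^ s) F ^ 2 ^ s = F"
    using F0 by (intro real_root_pow_pos2) auto
  have "op_norm d A \<le> root (2 ^ s) F"
  proof (rule step)
    show "0 \<le> root (2 ^ s) F"
      using F0 by (rule real_root_ge_zero)
    show "vnorm d (mat_vec d (mat_pow d A (2 ^ s)) x) \<le> root (2 ^ s) F ^ 2 ^ s * vnorm d x" for x
      unfolding root by (rule F)
  qed
  then have "op_norm d A ^ 2 ^ s \<le> root (2 ^ s) F ^ 2 ^ s"
    by (intro power_mono op_norm_nonneg)
  also have "\<dots> = F"
    by (rule root)
  finally have "(op_norm d A ^ 2 ^ s)\<^sup>2 \<le> F\<^sup>2"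
    by (intro power_mono) (auto simp: op_norm_nonneg)
  then show ?thesis
    using pow_trace_even_nonneg[of A d "2 ^ s", OF sym]
    by (simp add: F_def power_mult[symmetric] mult.commute)
qed

section \<open>Gaussian entries and integration by parts\<close>

definition gauss :: "real \<Rightarrow> real measure" where
  "gauss s = density lborel (\<lambda>x. ennreal (normal_density 0 s x))"

lemma sets_gauss [measurable_cong, simp]: "sets (gauss s) = sets borel"
  by (simp add: gauss_def)

lemma space_gauss [simp]: "space (gauss s) = UNIV"
  by (simp add: gauss_def)

lemma prob_space_gauss: "0 < s \<Longrightarrow> prob_space (gauss s)"
  unfolding gauss_def by (rule prob_space_normal_density)

definition triangle :: "nat \<Rightarrow> (nat \<times> nat) set" where
  "triangle d = {(i, j). i \<le> j \<and> j < d}"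

lemma finite_triangle [simp]: "finite (triangle d)"
  by (rule finite_subset[of _ "{..<d} \<times> {..<d}"]) (auto simp: triangle_def)

definition entry_sd :: "nat \<Rightarrow> nat \<times> nat \<Rightarrow> real" where
  "entry_sd d = (\<lambda>(i, j). sqrt ((1 + (if i = j then 1 else 0)) / real d))"

lemma entry_sd_pos: "1 \<le> d \<Longrightarrow> 0 < entry_sd d t"
  by (auto simp: entry_sd_def split: prod.split)

definition entries :: "nat \<Rightarrow> rmat measure" where
  "entries d = (\<Pi>\<^sub>M t\<in>triangle d. gauss (entry_sd d t))"

definition symm :: "nat \<Rightarrow> rmat \<Rightarrow> rmat" where
  "symm d y = (\<lambda>(i, j)\<in>{..<d} \<times> {..<d}. y (min i j, max i j))"

lemma GOE_eq: "GOE d = distr (entries d) (mat_space d) (symm d)"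
proof -
  have "(\<lambda>(i, j). density lborel (\<lambda>x. ennreal
            (normal_density 0 (sqrt ((1 + (if i = j then 1 else 0)) / real d)) x)))
        = (\<lambda>t. gauss (entry_sd d t))"
    by (auto simp: gauss_def entry_sd_def fun_eq_iff)
  then show ?thesis
    by (simp add: GOE_def entries_def symm_def[abs_def] triangle_def)
qed

lemma space_mat_space: "space (mat_space d) = ({..<d} \<times> {..<d}) \<rightarrow>\<^sub>E UNIV"
  by (simp add: mat_space_def space_PiM)

lemma mat_space_entry [measurable]:
  "i < d \<Longrightarrow> j < d \<Longrightarrow> (\<lambda>A. A (i, j)) \<in> borel_measurable (mat_space d)"
  unfolding mat_space_def by (rule measurable_component_singleton) auto

lemma measurable_into_mat_space:
  assumes "\<And>i j. i < d \<Longrightarrow> j < d \<Longrightarrow> (\<lambda>x. f x (i, j)) \<in> borel_measurable N"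
  shows "(\<lambda>x. \<lambda>ij\<in>{..<d} \<times> {..<d}. f x ij) \<in> N \<rightarrow>\<^sub>M mat_space d"
  unfolding mat_space_def using assms by (intro measurable_restrict) auto

lemma space_entries: "space (entries d) = triangle d \<rightarrow>\<^sub>E UNIV"
  by (simp add: entries_def space_PiM)

lemma entries_component [measurable]:
  "t \<in> triangle d \<Longrightarrow> (\<lambda>y. y t) \<in> borel_measurable (entries d)"
  using measurable_component_singleton[of t "triangle d" "\<lambda>t. gauss (entry_sd d t)"]
  by (simp add: entries_def cong: measurable_cong_sets)

lemma min_max_triangle: "i < d \<Longrightarrow> j < d \<Longrightarrow> (min i j, max i j) \<in> triangle d"
  by (auto simp: triangle_def)

lemma symm_apply: "i < d \<Longrightarrow> j < d \<Longrightarrow> symm d y (i, j) = y (min i j, max i j)"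
  by (simp add: symm_def)

lemma sym_mat_symm: "sym_mat (symm d y)"
  by (auto simp: sym_mat_def symm_def min.commute max.commute)

lemma symm_entry_measurable [measurable]:
  "i < d \<Longrightarrow> j < d \<Longrightarrow> (\<lambda>y. symm d y (i, j)) \<in> borel_measurable (entries d)"
  using entries_component[OF min_max_triangle, of i d j] by (simp add: symm_apply)

lemma symm_measurable [measurable]: "symm d \<in> entries d \<rightarrow>\<^sub>M mat_space d"
proof -
  have "(\<lambda>y. \<lambda>ij\<in>{..<d} \<times> {..<d}. symm d y ij) \<in> entries d \<rightarrow>\<^sub>M mat_space d"
    by (intro measurable_into_mat_space symm_entry_measurable)
  moreover have "(\<lambda>ij\<in>{..<d} \<times> {..<d}. symm d y ij) = symm d y" for y
    by (auto simp: symm_def)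
  ultimately show ?thesis by simp
qed

lemma product_prob_space_gauss:
  assumes "1 \<le> d"
  shows "product_prob_space (\<lambda>t. gauss (entry_sd d t))"
  using prob_space_gauss[OF entry_sd_pos[OF assms]] by (rule product_prob_spaceI)

lemma prob_space_entries: "1 \<le> d \<Longrightarrow> prob_space (entries d)"
  unfolding entries_def using entry_sd_pos prob_space_gauss by (intro prob_space_PiM) auto

lemma sets_GOE [measurable_cong, simp]: "sets (GOE d) = sets (mat_space d)"
  by (simp add: GOE_eq)

lemma space_GOE: "space (GOE d) = space (mat_space d)"
  by (simp add: GOE_eq)

lemma prob_space_GOE: "1 \<le> d \<Longrightarrow> prob_space (GOE d)"
  unfolding GOE_eq by (intro prob_space.prob_space_distr prob_space_entries symm_measurable)

text \<open>Rational test vectors suffice by continuity; as there are countably many of them, the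
operator norm is measurable.\<close>

lemma op_norm_le_iff_rational:
  assumes "0 \<le> c"
  shows "op_norm d A \<le> c \<longleftrightarrow>
    (\<forall>x\<in>{..<d} \<rightarrow>\<^sub>E \<rat>. vnorm d (mat_vec d A x) \<le> c * vnorm d x)"
proof
  assume "op_norm d A \<le> c"
  then show "\<forall>x\<in>{..<d} \<rightarrow>\<^sub>E \<rat>. vnorm d (mat_vec d A x) \<le> c * vnorm d x"
    using order_trans[OF op_norm_bound mult_right_mono[OF _ L2_set_nonneg]] by blast
next
  assume *: "\<forall>x\<in>{..<d} \<rightarrow>\<^sub>E \<rat>. vnorm d (mat_vec d A x) \<le> c * vnorm d x"
  show "op_norm d A \<le> c"
  proof (rule op_norm_le[OF assms])
    fix x :: "nat \<Rightarrow> real"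
    have "\<exists>q\<in>\<rat>. x i < q \<and> q < x i + 1 / Suc m" for i m
      by (intro Rats_dense_in_real) simp
    then obtain q where q: "\<And>i m. q i m \<in> \<rat>" "\<And>i m. x i < q i m" "\<And>i m. q i m < x i + 1 / Suc m"
      by metis
    have lim: "(\<lambda>m. q i m) \<longlonglongrightarrow> x i" for i
    proof (rule tendsto_sandwich[of "\<lambda>_. x i" _ _ "\<lambda>m. x i + 1 / Suc m"])
      show "(\<lambda>m. x i + 1 / real (Suc m)) \<longlonglongrightarrow> x i"
        using tendsto_add[OF tendsto_const LIMSEQ_inverse_real_of_nat, of "x i"]
        by (simp add: inverse_eq_divide)
    qed (use q(2,3) in \<open>auto intro!: always_eventually less_imp_le\<close>)
    let ?x = "\<lambda>m. restrict (\<lambda>i. q i m) {..<d}"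
    have "vnorm d (mat_vec d A (?x m)) \<le> c * vnorm d (?x m)" for m
      using * q(1) by auto
    then have le: "vnorm d (mat_vec d A (\<lambda>i. q i m)) \<le> c * vnorm d (\<lambda>i. q i m)" for m
      by (auto simp: mat_vec_def L2_set_def)
    show "vnorm d (mat_vec d A x) \<le> c * vnorm d x"
    proof (rule LIMSEQ_le)
      show "(\<lambda>m. vnorm d (mat_vec d A (\<lambda>i. q i m))) \<longlonglongrightarrow> vnorm d (mat_vec d A x)"
        unfolding L2_set_def mat_vec_def by (intro tendsto_intros lim)
      show "(\<lambda>m. c * vnorm d (\<lambda>i. q i m)) \<longlonglongrightarrow> c * vnorm d x"
        unfolding L2_set_def by (intro tendsto_intros lim)
    qed (use le in auto)
  qed
qed

lemma op_norm_measurable [measurable]: "op_norm d \<in> borel_measurable (mat_space d)"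
  unfolding borel_measurable_iff_le
proof
  fix c :: real
  show "{A \<in> space (mat_space d). op_norm d A \<le> c} \<in> sets (mat_space d)"
  proof (cases "0 \<le> c")
    case False
    then have empty: "{A \<in> space (mat_space d). op_norm d A \<le> c} = {}"
      using op_norm_nonneg order_trans by blast
    show ?thesis unfolding empty by simp
  next
    case True
    have [measurable]: "(\<lambda>A. vnorm d (mat_vec d A x)) \<in> borel_measurable (mat_space d)" for x
      unfolding L2_set_def mat_vec_def by measurable
    have "countable ({..<d} \<rightarrow>\<^sub>E (\<rat>::real set))"
      by (intro countable_PiE countable_rat) auto
    then show ?thesis
      unfolding op_norm_le_iff_rational[OF True]
      by (intro sets.sets_Collect_countable_All') auto
  qed
qed

lemma nn_integral_GOE:
  assumes "f \<in> borel_measurable (mat_space d)"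
  shows "(\<integral>\<^sup>+A. f A \<partial>GOE d) = (\<integral>\<^sup>+y. f (symm d y) \<partial>entries d)"
  unfolding GOE_eq using assms by (simp add: nn_integral_distr)

lemma mat_pow_measurable [measurable]:
  "i < d \<Longrightarrow> j < d \<Longrightarrow> (\<lambda>A. mat_pow d A k (i, j)) \<in> borel_measurable (mat_space d)"
proof (induction k arbitrary: i j)
  case (Suc k)
  then show ?case
    by (auto simp: mat_mul_def intro!: borel_measurable_sum borel_measurable_times mat_space_entry)
qed simp

lemma pow_trace_measurable [measurable]:
  "(\<lambda>A. pow_trace d A k) \<in> borel_measurable (mat_space d)"
  unfolding pow_trace_def mat_trace_def by (auto intro!: borel_measurable_sum mat_pow_measurable)

lemma normal_density_tendsto_0:
  assumes "0 < s"
  shows "(normal_density 0 s \<longlongrightarrow> 0) at_top" "(normal_density 0 s \<longlongrightarrow> 0) at_bot"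
proof -
  have sq: "filterlim (\<lambda>x::real. x\<^sup>2) at_top at_top" "filterlim (\<lambda>x::real. x\<^sup>2) at_top at_bot"
    by (rule filterlim_pow_at_top filterlim_pow_at_bot_even; simp add: filterlim_ident)+
  have *: "(normal_density 0 s \<longlongrightarrow> 0) F" if "filterlim (\<lambda>x::real. x\<^sup>2) at_top F" for F
  proof -
    have "filterlim (\<lambda>x. 1 / (2 * s\<^sup>2) * x\<^sup>2) at_top F"
      using assms by (intro filterlim_tendsto_pos_mult_at_top[OF tendsto_const _ that]) auto
    then have "filterlim (\<lambda>x. - (1 / (2 * s\<^sup>2) * x\<^sup>2)) at_bot F"
      by (simp add: filterlim_uminus_at_top)
    then have "((\<lambda>x. exp (- (1 / (2 * s\<^sup>2) * x\<^sup>2))) \<longlongrightarrow> 0) F"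
      by (rule filterlim_compose[OF exp_at_bot])
    then have "((\<lambda>x. 1 / sqrt (2 * pi * s\<^sup>2) * exp (- (1 / (2 * s\<^sup>2) * x\<^sup>2))) \<longlongrightarrow> 1 / sqrt (2 * pi *
        s\<^sup>2) * 0) F"
      by (intro tendsto_intros)
    then show ?thesis
      by (simp add: normal_density_def[abs_def])
  qed
  show "(normal_density 0 s \<longlongrightarrow> 0) at_top" "(normal_density 0 s \<longlongrightarrow> 0) at_bot"
    using sq * by auto
qed

text \<open>The derivative of \<open>f\<close> times the Gaussian density integrates to \<open>0\<close>.\<close>

lemma gauss_integration_by_parts:
  fixes f f' :: "real \<Rightarrow> real"
  assumes s: "0 < s"
    and deriv: "\<And>x. (f has_real_derivative f' x) (at x)"
    and cont: "continuous_on UNIV f'"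
    and bd: "\<And>x. \<bar>f x\<bar> \<le> C" "\<And>x. \<bar>f' x\<bar> \<le> C"
  shows "(\<integral>x. x * f x \<partial>gauss s) = s\<^sup>2 * (\<integral>x. f' x \<partial>gauss s)"
proof -
  let ?\<phi> = "normal_density 0 s"
  have contf: "continuous_on UNIV f"
    using deriv by (meson DERIV_isCont continuous_at_imp_continuous_on)
  have [measurable]: "f \<in> borel_measurable borel" "f' \<in> borel_measurable borel"
    using cont contf by (auto intro: borel_measurable_continuous_onI)
  have d\<phi>: "(?\<phi> has_real_derivative - x / s\<^sup>2 * ?\<phi> x) (at x)" for x
    unfolding normal_density_def using s
    by (auto intro!: derivative_eq_intros simp: field_simps power2_eq_square)
  have int1: "integrable lborel (\<lambda>x. ?\<phi> x * f' x)"
  proof (rule Bochner_Integration.integrable_bound)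
    show "integrable lborel (\<lambda>x. C * ?\<phi> x)"
      using s by (intro integrable_mult_right integrable_normal_density)
    have "norm (?\<phi> x * f' x) \<le> norm (C * ?\<phi> x)" for x
      using mult_left_mono[OF bd(2), of "?\<phi> x" x] order_trans[OF abs_ge_zero bd(2)]
      by (simp add: abs_mult mult.commute)
    then show "AE x in lborel. norm (?\<phi> x * f' x) \<le> norm (C * ?\<phi> x)" by simp
  qed simp
  have int2: "integrable lborel (\<lambda>x. ?\<phi> x * (x * f x))"
  proof (rule Bochner_Integration.integrable_bound)
    show "integrable lborel (\<lambda>x. C * (?\<phi> x * (x - 0)^1))"
      using s by (intro integrable_mult_right integrable_normal_moment)
    have "norm (?\<phi> x * (x * f x)) \<le> norm (C * (?\<phi> x * (x - 0)^1))" for x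
      using mult_left_mono[OF bd(1), of "?\<phi> x * \<bar>x\<bar>" x] order_trans[OF abs_ge_zero bd(1)]
      by (simp add: abs_mult mult.commute mult.left_commute)
    then show "AE x in lborel. norm (?\<phi> x * (x * f x)) \<le> norm (C * (?\<phi> x * (x - 0)^1))" by simp
  qed simp
  define h where "h = (\<lambda>x. ?\<phi> x * f' x - (1 / s\<^sup>2) * (?\<phi> x * (x * f x)))"
  have inth: "integrable lborel h"
    unfolding h_def by (intro Bochner_Integration.integrable_diff integrable_mult_right int1 int2)
  have lim: "((\<lambda>x. f x * ?\<phi> x) \<longlongrightarrow> 0) F" if "(?\<phi> \<longlongrightarrow> 0) F" for F
  proof (rule tendsto_0_le[OF that])
    have "norm (f x * ?\<phi> x) \<le> norm (?\<phi> x) * C" for x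
      using mult_left_mono[OF bd(1), of "?\<phi> x" x] by (simp add: abs_mult mult.commute)
    then show "\<forall>\<^sub>F x in F. norm (f x * ?\<phi> x) \<le> norm (?\<phi> x) * C" by simp
  qed
  have "(LBINT x=-\<infinity>..\<infinity>. h x) = 0 - 0"
  proof (rule interval_integral_FTC_integrable[where F = "\<lambda>x. f x * ?\<phi> x"])
    show "((\<lambda>x. f x * ?\<phi> x) has_vector_derivative h x) (at x)" for x
    proof -
      have "((\<lambda>x. f x * ?\<phi> x) has_real_derivative h x) (at x)"
        using s by (auto intro!: derivative_eq_intros deriv d\<phi> simp: h_def field_simps)
      then show ?thesis
        by (simp add: has_real_derivative_iff_has_vector_derivative)
    qed
    show "isCont h x" for x
      using cont contf s unfolding h_def normal_density_def
      by (auto intro!: continuous_intros simp: continuous_on_eq_continuous_at)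
    show "set_integrable lborel (einterval (-\<infinity>) \<infinity>) h"
      using inth by (simp add: set_integrable_def)
    show "(((\<lambda>x. f x * ?\<phi> x) \<circ> real_of_ereal) \<longlongrightarrow> 0) (at_right (-\<infinity>))"
      "(((\<lambda>x. f x * ?\<phi> x) \<circ> real_of_ereal) \<longlongrightarrow> 0) (at_left \<infinity>)"
      using lim normal_density_tendsto_0[OF s]
      by (auto simp: ereal_tendsto_simps1)
  qed simp
  then have "(\<integral>x. h x \<partial>lborel) = 0"
    by (simp add: interval_lebesgue_integral_def set_lebesgue_integral_def)
  then have "(\<integral>x. ?\<phi> x * f' x \<partial>lborel) = (1 / s\<^sup>2) * (\<integral>x. ?\<phi> x * (x * f x) \<partial>lborel)"
    using int1 int2 by (simp add: h_def)
  then have "s\<^sup>2 * (\<integral>x. ?\<phi> x * f' x \<partial>lborel) = (\<integral>x. ?\<phi> x * (x * f x) \<partial>lborel)"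
    using s by simp
  then show ?thesis
    unfolding gauss_def using s by (simp add: integral_density)
qed

text \<open>One entry is integrated while the others are held fixed.\<close>

lemma entries_integration_by_parts:
  fixes F F' :: "rmat \<Rightarrow> real"
  assumes d: "1 \<le> d" and t: "t \<in> triangle d"
    and [measurable]: "F \<in> borel_measurable (entries d)" "F' \<in> borel_measurable (entries d)"
    and deriv: "\<And>y x. y \<in> space (entries d) \<Longrightarrow>
      ((\<lambda>x. F (y(t := x))) has_real_derivative F' (y(t := x))) (at x)"
    and cont: "\<And>y. y \<in> space (entries d) \<Longrightarrow> continuous_on UNIV (\<lambda>x. F' (y(t := x)))"
    and bd: "\<And>y. \<bar>F y\<bar> \<le> C" "\<And>y. \<bar>F' y\<bar> \<le> C" "\<And>y. \<bar>y t * F y\<bar> \<le> C"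
  shows "(\<integral>y. y t * F y \<partial>entries d) = (entry_sd d t)\<^sup>2 * (\<integral>y. F' y \<partial>entries d)"
proof -
  interpret product_prob_space "\<lambda>t. gauss (entry_sd d t)"
    by (rule product_prob_space_gauss[OF d])
  interpret E: prob_space "entries d"
    by (rule prob_space_entries[OF d])
  let ?I = "triangle d - {t}"
  let ?N = "PiM ?I (\<lambda>t. gauss (entry_sd d t))"
  have ins: "insert t ?I = triangle d" using t by auto
  have fub: "(\<integral>y. h y \<partial>entries d) = (\<integral>y. (\<integral>x. h (y(t := x)) \<partial>gauss (entry_sd d t)) \<partial>?N)"
    if "integrable (entries d) h" for h :: "rmat \<Rightarrow> real"
    using product_integral_insert[of ?I t h] that unfolding ins entries_def by simp
  have "(\<integral>y. y t * F y \<partial>entries d)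
      = (\<integral>y. (\<integral>x. x * F (y(t := x)) \<partial>gauss (entry_sd d t)) \<partial>?N)"
    using t bd(3) by (subst fub) (auto intro!: E.integrable_const_bound[of _ C])
  also have "\<dots> = (\<integral>y. (entry_sd d t)\<^sup>2 * (\<integral>x. F' (y(t := x)) \<partial>gauss (entry_sd d t)) \<partial>?N)"
  proof (rule Bochner_Integration.integral_cong[OF refl])
    fix y assume "y \<in> space ?N"
    then have sp: "y(t := x) \<in> space (entries d)" for x
      using t by (auto simp: space_PiM space_entries PiE_iff extensional_def)
    have "((\<lambda>x. F (y(t := x))) has_real_derivative F' (y(t := x))) (at x)" for x
      using deriv[OF sp[of 0], of x] by simp
    moreover have "continuous_on UNIV (\<lambda>x. F' (y(t := x)))"
      using cont[OF sp[of 0]] by simp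
    ultimately show "(\<integral>x. x * F (y(t := x)) \<partial>gauss (entry_sd d t))
        = (entry_sd d t)\<^sup>2 * (\<integral>x. F' (y(t := x)) \<partial>gauss (entry_sd d t))"
      using bd by (intro gauss_integration_by_parts[where C = C] entry_sd_pos[OF d]) auto
  qed
  also have "\<dots> = (entry_sd d t)\<^sup>2 * (\<integral>y. F' y \<partial>entries d)"
    using bd(2) by (subst fub) (auto intro!: E.integrable_const_bound[of _ C])
  finally show ?thesis .
qed

section \<open>Loop equations with a soft spectral cutoff\<close>

text \<open>The Leibniz rule for a product of \<open>k\<close> equal matrix factors.\<close>

lemma mat_pow_has_derivative:
  fixes A :: "real \<Rightarrow> rmat"
  assumes B: "\<And>i j. i < d \<Longrightarrow> j < d \<Longrightarrow> ((\<lambda>s. A s (i, j)) has_real_derivative B (i, j)) (at x)"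
    and "i < d" "j < d"
  shows "((\<lambda>s. mat_pow d (A s) k (i, j)) has_real_derivative
      (\<Sum>l<k. \<Sum>u<d. \<Sum>v<d. mat_pow d (A x) l (i, u) * B (u, v) * mat_pow d (A x) (k - 1 - l) (v,
          j))) (at x)"
  using assms(2,3)
proof (induction k arbitrary: i j)
  case 0
  show ?case by simp
next
  case (Suc k)
  let ?P = "mat_pow d (A x)"
  let ?D = "\<lambda>k i. \<Sum>l<k. \<Sum>u<d. \<Sum>v<d. ?P l (i, u) * B (u, v) * ?P (k - 1 - l) (v, j)"
  have "((\<lambda>s. \<Sum>w<d. A s (i, w) * mat_pow d (A s) k (w, j)) has_real_derivative
      (\<Sum>w<d. B (i, w) * ?P k (w, j) + A x (i, w) * ?D k w)) (at x)"
  proof (intro DERIV_sum)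
    fix w assume "w \<in> {..<d}"
    then have "((\<lambda>s. A s (i, w)) has_real_derivative B (i, w)) (at x)"
      "((\<lambda>s. mat_pow d (A s) k (w, j)) has_real_derivative ?D k w) (at x)"
      using B Suc by auto
    from DERIV_mult[OF this]
    show "((\<lambda>s. A s (i, w) * mat_pow d (A s) k (w, j)) has_real_derivative
      B (i, w) * ?P k (w, j) + A x (i, w) * ?D k w) (at x)"
      by (simp add: mult.commute)
  qed
  moreover have "(\<Sum>w<d. B (i, w) * ?P k (w, j) + A x (i, w) * ?D k w) = ?D (Suc k) i"
  proof -
    have "(\<Sum>w<d. A x (i, w) * ?D k w)
        = (\<Sum>l<k. \<Sum>u<d. \<Sum>v<d. \<Sum>w<d. A x (i, w) * (?P l (w, u) * B (u, v) * ?P (k - 1 - l) (v, j)))"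
      unfolding sum_distrib_left
      by (subst sum.swap, rule sum.cong[OF refl], subst sum.swap, rule sum.cong[OF refl], rule sum.swap)
    also have "\<dots> = (\<Sum>l<k. \<Sum>u<d. \<Sum>v<d. ?P (Suc l) (i, u) * B (u, v) * ?P (k - 1 - l) (v, j))"
      by (simp add: mat_mul_def sum_distrib_left sum_distrib_right mult_ac)
    finally have 1: "(\<Sum>w<d. A x (i, w) * ?D k w)
        = (\<Sum>l<k. \<Sum>u<d. \<Sum>v<d. ?P (Suc l) (i, u) * B (u, v) * ?P (k - 1 - l) (v, j))" .
    have 2: "(\<Sum>u<d. \<Sum>v<d. ?P 0 (i, u) * B (u, v) * ?P k (v, j)) = (\<Sum>w<d. B (i, w) * ?P k (w, j))"
      using Suc.prems
      by (subst sum.swap) (simp add: if_distrib[of "\<lambda>x. x * _"] cong: if_cong)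
    have D: "?D (Suc k) i = (\<Sum>u<d. \<Sum>v<d. ?P 0 (i, u) * B (u, v) * ?P k (v, j)) +
        (\<Sum>l<k. \<Sum>u<d. \<Sum>v<d. ?P (Suc l) (i, u) * B (u, v) * ?P (k - 1 - l) (v, j))"
      by (subst sum.lessThan_Suc_shift) (simp del: mat_pow.simps)
    show ?thesis
      unfolding D 2 sum.distrib 1 ..
  qed
  ultimately show ?case
    by (simp add: mat_mul_def)
qed

text \<open>This is the derivative of the entry \<open>(i, j)\<close> of \<open>A^k\<close> with respect to the independent
entry at \<open>(a, b)\<close>, multiplied by the variance of that entry. An off-diagonal entry occurs at two
places of the symmetric matrix, a diagonal one only once but with twice the variance, so one
formula covers both cases.\<close>

definition entry_deriv :: "nat \<Rightarrow> rmat \<Rightarrow> nat \<Rightarrow> nat \<Rightarrow> nat \<Rightarrow> nat \<Rightarrow> nat \<Rightarrow> real" where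
  "entry_deriv d A a b k i j = 1 / d * (\<Sum>l<k.
     mat_pow d A l (i, a) * mat_pow d A (k - 1 - l) (b, j)
     + mat_pow d A l (i, b) * mat_pow d A (k - 1 - l) (a, j))"

lemma symm_mat_pow_has_derivative:
  assumes d: "1 \<le> d" and ab: "a < d" "b < d" and ij: "i < d" "j < d"
    and t: "t = (min a b, max a b)"
  shows "((\<lambda>x. mat_pow d (symm d (y(t := x))) k (i, j)) has_real_derivative
     entry_deriv d (symm d (y(t := x))) a b k i j / (entry_sd d t)\<^sup>2) (at x)"
proof -
  let ?P = "mat_pow d (symm d (y(t := x)))"
  define B :: rmat where "B = (\<lambda>(u, v). if (min u v, max u v) = t then 1 else 0)"
  have "((\<lambda>x. symm d (y(t := x)) (u, v)) has_real_derivative B (u, v)) (at x)" if "u < d" "v < d"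
      for u v
    using that by (cases "(min u v, max u v) = t") (auto simp: B_def symm_apply intro!:
        derivative_eq_intros)
  note D = mat_pow_has_derivative[of d "\<lambda>x. symm d (y(t := x))" B, OF this ij, of k]
  have sd: "(entry_sd d t)\<^sup>2 = (1 + (if a = b then 1 else 0)) / d"
    using t by (auto simp: entry_sd_def min_def max_def)
  have B: "B (u, v) = 1 / (d * (entry_sd d t)\<^sup>2)
      * ((if u = a then if v = b then 1 else 0 else 0) + (if u = b then if v = a then 1 else 0
          else 0))" for u v
    unfolding sd unfolding B_def t using d by (auto simp: min_def max_def)
  have "(\<Sum>u<d. \<Sum>v<d. ?P l (i, u) * B (u, v) * ?P (k - 1 - l) (v, j))
     = (?P l (i, a) * ?P (k - 1 - l) (b, j) + ?P l (i, b) * ?P (k - 1 - l) (a, j)) / (d *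
         (entry_sd d t)\<^sup>2)" for l
  proof -
    let ?c = "1 / (d * (entry_sd d t)\<^sup>2)"
    have "(\<Sum>u<d. \<Sum>v<d. ?P l (i, u) * B (u, v) * ?P (k - 1 - l) (v, j))
      = (\<Sum>u<d. \<Sum>v<d. (if u = a then if v = b then ?c * (?P l (i, u) * ?P (k - 1 - l) (v, j)) else
          0 else 0)
          + (if u = b then if v = a then ?c * (?P l (i, u) * ?P (k - 1 - l) (v, j)) else 0 else 0))"
      unfolding B by (intro sum.cong refl) auto
    also have "\<dots> = ?c * (?P l (i, a) * ?P (k - 1 - l) (b, j)) + ?c * (?P l (i, b) * ?P (k - 1 - l)
        (a, j))"
    proof -
      have *: "(\<Sum>u<d. \<Sum>v<d. if u = a' then if v = b' then g u v else 0 else 0) = (g a' b' :: real)"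
        if "a' < d" "b' < d" for a' b' g
      proof -
        have "(\<Sum>u<d. \<Sum>v<d. if u = a' then if v = b' then g u v else 0 else 0)
          = (\<Sum>u<d. if u = a' then (\<Sum>v<d. if v = b' then g u v else 0) else 0)"
          by (intro sum.cong) auto
        then show ?thesis
          using that by simp
      qed
      show ?thesis
        unfolding sum.distrib using ab by (simp only: *)
    qed
    finally show ?thesis
      by (simp add: add_divide_distrib)
  qed
  with D show ?thesis
    by (simp add: entry_deriv_def sum_divide_distrib)
qed

lemma symm_pow_trace_has_derivative:
  assumes d: "1 \<le> d" and ab: "a < d" "b < d" and t: "t = (min a b, max a b)"
  shows "((\<lambda>x. pow_trace d (symm d (y(t := x))) k) has_real_derivative
     2 * k / d * mat_pow d (symm d (y(t := x))) (k - 1) (a, b) / (entry_sd d t)\<^sup>2) (at x)"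
proof -
  let ?A = "symm d (y(t := x))"
  let ?P = "mat_pow d ?A"
  have "((\<lambda>x. pow_trace d (symm d (y(t := x))) k) has_real_derivative
      (\<Sum>i<d. entry_deriv d ?A a b k i i / (entry_sd d t)\<^sup>2)) (at x)"
    unfolding pow_trace_def mat_trace_def
    using assms by (intro DERIV_sum symm_mat_pow_has_derivative) auto
  moreover have "(\<Sum>i<d. entry_deriv d ?A a b k i i) = 2 * k / d * ?P (k - 1) (a, b)"
  proof -
    have sym: "?P l (i, j) = ?P l (j, i)" if "i < d" "j < d" for i j l
      by (rule mat_pow_sym[OF sym_mat_symm that])
    have add: "(\<Sum>i<d. ?P l (i, a') * ?P (k - 1 - l) (b', i)) = ?P (k - 1) (b', a')"
      if "l < k" "a' < d" "b' < d" for l a' b'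
    proof -
      have "(\<Sum>i<d. ?P (k - 1 - l) (b', i) * ?P l (i, a')) = ?P (k - 1 - l + l) (b', a')"
        by (rule mat_pow_add[symmetric, OF that(3)])
      then show ?thesis
        using that by (simp add: mult.commute)
    qed
    have "(\<Sum>i<d. entry_deriv d ?A a b k i i)
      = 1 / d * (\<Sum>l<k. (\<Sum>i<d. ?P l (i, a) * ?P (k - 1 - l) (b, i)) + (\<Sum>i<d. ?P l (i, b) * ?P (k -
          1 - l) (a, i)))"
      unfolding entry_deriv_def sum_distrib_left[symmetric]
      by (subst sum.swap) (simp add: sum.distrib)
    also have "\<dots> = 1 / d * (\<Sum>l<k. 2 * ?P (k - 1) (a, b))"
    proof (intro arg_cong2[of _ _ _ _ times] refl sum.cong)
      fix l assume "l \<in> {..<k}"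
      then show "(\<Sum>i<d. ?P l (i, a) * ?P (k - 1 - l) (b, i)) + (\<Sum>i<d. ?P l (i, b) * ?P (k - 1 - l)
          (a, i))
          = 2 * ?P (k - 1) (a, b)"
        using ab sym[of a b "k - 1"] add[of l a b] add[of l b a] by simp
    qed
    finally show ?thesis by simp
  qed
  ultimately show ?thesis
    by (simp add: sum_divide_distrib[symmetric])
qed

text \<open>Functions of at most polynomial growth in the operator norm; against the weight
introduced below they are bounded, which settles all questions of integrability.\<close>

definition poly_bounded :: "nat \<Rightarrow> (rmat \<Rightarrow> real) \<Rightarrow> bool" where
  "poly_bounded d f \<longleftrightarrow> (\<exists>C n. \<forall>A. \<bar>f A\<bar> \<le> C * (1 + op_norm d A) ^ n)"

lemma poly_boundedI: "(\<And>A. \<bar>f A\<bar> \<le> C * (1 + op_norm d A) ^ n) \<Longrightarrow> poly_bounded d f"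
  by (auto simp: poly_bounded_def)

lemma poly_boundedD:
  assumes "poly_bounded d f"
  shows "\<exists>C n. 0 \<le> C \<and> (\<forall>A m. n \<le> m \<longrightarrow> \<bar>f A\<bar> \<le> C * (1 + op_norm d A) ^ m)"
proof -
  obtain C n where *: "\<bar>f A\<bar> \<le> C * (1 + op_norm d A) ^ n" for A
    using assms by (auto simp: poly_bounded_def)
  have "\<bar>f A\<bar> \<le> \<bar>C\<bar> * (1 + op_norm d A) ^ m" if "n \<le> m" for A m
  proof -
    have le: "(1 + op_norm d A) ^ n \<le> (1 + op_norm d A) ^ m"
      using that by (intro power_increasing) (auto simp: op_norm_nonneg)
    have "\<bar>f A\<bar> \<le> C * (1 + op_norm d A) ^ n" by (rule *)
    also have "\<dots> \<le> \<bar>C\<bar> * (1 + op_norm d A) ^ n"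
      by (intro mult_right_mono) (auto simp: op_norm_nonneg)
    also have "\<dots> \<le> \<bar>C\<bar> * (1 + op_norm d A) ^ m"
      using le by (intro mult_left_mono) auto
    finally show ?thesis .
  qed
  then show ?thesis
    by (intro exI[of _ "\<bar>C\<bar>"] exI[of _ n]) auto
qed

lemma poly_bounded_const: "poly_bounded d (\<lambda>_. c)"
  by (rule poly_boundedI[of _ "\<bar>c\<bar>" _ 0]) simp

lemma poly_bounded_add:
  assumes "poly_bounded d f" "poly_bounded d g"
  shows "poly_bounded d (\<lambda>A. f A + g A)"
proof -
  obtain C n where f: "0 \<le> C" "\<And>A m. n \<le> m \<Longrightarrow> \<bar>f A\<bar> \<le> C * (1 + op_norm d A) ^ m"
    using poly_boundedD[OF assms(1)] by blast
  obtain D k where g: "0 \<le> D" "\<And>A m. k \<le> m \<Longrightarrow> \<bar>g A\<bar> \<le> D * (1 + op_norm d A) ^ m"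
    using poly_boundedD[OF assms(2)] by blast
  show ?thesis
  proof (rule poly_boundedI[of _ "C + D" _ "n + k"])
    fix A
    show "\<bar>f A + g A\<bar> \<le> (C + D) * (1 + op_norm d A) ^ (n + k)"
      using f(2)[of "n + k" A] g(2)[of "n + k" A] by (simp add: distrib_right)
  qed
qed

lemma poly_bounded_mult:
  assumes "poly_bounded d f" "poly_bounded d g"
  shows "poly_bounded d (\<lambda>A. f A * g A)"
proof -
  obtain C n where f: "0 \<le> C" "\<And>A m. n \<le> m \<Longrightarrow> \<bar>f A\<bar> \<le> C * (1 + op_norm d A) ^ m"
    using poly_boundedD[OF assms(1)] by blast
  obtain D k where g: "0 \<le> D" "\<And>A m. k \<le> m \<Longrightarrow> \<bar>g A\<bar> \<le> D * (1 + op_norm d A) ^ m"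
    using poly_boundedD[OF assms(2)] by blast
  show ?thesis
  proof (rule poly_boundedI[of _ "C * D" _ "n + k"])
    fix A
    have "\<bar>f A\<bar> * \<bar>g A\<bar> \<le> (C * (1 + op_norm d A) ^ n) * (D * (1 + op_norm d A) ^ k)"
      using f g by (intro mult_mono) (auto simp: op_norm_nonneg)
    then show "\<bar>f A * g A\<bar> \<le> C * D * (1 + op_norm d A) ^ (n + k)"
      by (simp add: abs_mult power_add mult_ac)
  qed
qed

lemma poly_bounded_sum:
  assumes "\<And>i. i \<in> I \<Longrightarrow> poly_bounded d (f i)"
  shows "poly_bounded d (\<lambda>A. \<Sum>i\<in>I. f i A)"
  using assms by (induction I rule: infinite_finite_induct) (auto intro: poly_bounded_add
      poly_bounded_const)

lemma poly_bounded_diff: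
  assumes "poly_bounded d f" "poly_bounded d g"
  shows "poly_bounded d (\<lambda>A. f A - g A)"
  using poly_bounded_add[OF assms(1) poly_bounded_mult[OF poly_bounded_const[of d "-1"] assms(2)]]
      by simp

lemma poly_bounded_mat_pow: "i < d \<Longrightarrow> j < d \<Longrightarrow> poly_bounded d (\<lambda>A. mat_pow d A k (i, j))"
proof (rule poly_boundedI[of _ 1 _ k])
  fix A assume "i < d" "j < d"
  then have "\<bar>mat_pow d A k (i, j)\<bar> \<le> op_norm d A ^ k"
    by (rule abs_mat_pow_le)
  also have "\<dots> \<le> (1 + op_norm d A) ^ k"
    by (intro power_mono) (auto simp: op_norm_nonneg)
  finally show "\<bar>mat_pow d A k (i, j)\<bar> \<le> 1 * (1 + op_norm d A) ^ k" by simp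
qed

lemma poly_bounded_pow_trace: "poly_bounded d (\<lambda>A. pow_trace d A k)"
  unfolding pow_trace_def mat_trace_def by (intro poly_bounded_sum poly_bounded_mat_pow) auto

lemmas poly_bounded_intros = poly_bounded_const poly_bounded_add poly_bounded_diff poly_bounded_mult
  poly_bounded_sum poly_bounded_mat_pow poly_bounded_pow_trace

text \<open>As \<open>s\<close> grows, this tends to \<open>0\<close> outside the closed ball of radius \<open>\<kappa>\<close> and to \<open>1\<close> in the
open ball.\<close>

definition soft_weight :: "nat \<Rightarrow> real \<Rightarrow> real \<Rightarrow> nat \<Rightarrow> rmat \<Rightarrow> real" where
  "soft_weight d \<theta> \<kappa> s A = exp (- (\<theta> * pow_trace d A (2 * 2 ^ s) / \<kappa> ^ (2 * 2 ^ s)))"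

lemma soft_weight_nonneg: "0 \<le> soft_weight d \<theta> \<kappa> s A"
  by (simp add: soft_weight_def)

lemma soft_weight_le_1: "0 \<le> \<theta> \<Longrightarrow> 0 < \<kappa> \<Longrightarrow> sym_mat A \<Longrightarrow> soft_weight d \<theta> \<kappa> s A \<le> 1"
  by (simp add: soft_weight_def pow_trace_even_nonneg)

lemma soft_weight_le:
  assumes "0 \<le> \<theta>" "0 < \<kappa>" "sym_mat A"
  shows "soft_weight d \<theta> \<kappa> s A \<le> exp (- (\<theta> * (op_norm d A / \<kappa>) ^ (2 * 2 ^ s)))"
  using op_norm_pow_le_pow_trace[OF assms(3), of d s] assms
  by (auto simp: soft_weight_def power_divide intro!: divide_right_mono mult_left_mono)

text \<open>From \<open>(1 + c u / n)^n \<le> exp (c u)\<close>.\<close>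

lemma power_times_exp_minus_bounded:
  assumes "0 < (c::real)"
  shows "\<exists>B. \<forall>u\<ge>0. u ^ n * exp (- (c * u)) \<le> B"
proof (cases "n = 0")
  case True
  then show ?thesis using assms by (auto intro!: exI[of _ 1])
next
  case False
  show ?thesis
  proof (intro exI allI impI)
    fix u :: real assume "0 \<le> u"
    have "(c * u / n) ^ n \<le> (1 + c * u / n) ^ n"
      using \<open>0 \<le> u\<close> assms by (intro power_mono) auto
    also have "\<dots> \<le> exp (c * u)"
    proof (rule exp_ge_one_plus_x_over_n_power_n)
      have "0 \<le> c * u" using \<open>0 \<le> u\<close> assms by simp
      then show "- real n \<le> c * u" by linarith
    qed (use False in auto)
    finally have "(c * u / n) ^ n \<le> exp (c * u)" .
    then have "(n / c) ^ n * (c * u / n) ^ n \<le> (n / c) ^ n * exp (c * u)"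
      using assms by (intro mult_left_mono) auto
    then have "u ^ n \<le> (n / c) ^ n * exp (c * u)"
      using assms False by (simp add: power_mult_distrib[symmetric])
    then have "u ^ n * exp (- (c * u)) \<le> (n / c) ^ n * exp (c * u) * exp (- (c * u))"
      by (intro mult_right_mono) auto
    then show "u ^ n * exp (- (c * u)) \<le> (n / c) ^ n"
      by (simp add: mult.assoc flip: exp_add)
  qed
qed

text \<open>The bound is uniform in \<open>s\<close>, so it also serves as a dominating function for the limit.
Outside the ball of radius \<open>\<kappa>\<close> the weight is at most \<open>exp (- \<theta> u)\<close> with \<open>u\<close> the square of the
ratio of the norm to \<open>\<kappa>\<close>, whatever \<open>s\<close> is.\<close>

lemma soft_weight_bounds_poly:
  assumes \<theta>: "0 < \<theta>" and \<kappa>: "0 < \<kappa>" and f: "poly_bounded d f"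
  shows "\<exists>B. \<forall>s A. sym_mat A \<longrightarrow> \<bar>f A * soft_weight d \<theta> \<kappa> s A\<bar> \<le> B"
proof -
  obtain C n where C: "0 \<le> C" "\<And>A m. n \<le> m \<Longrightarrow> \<bar>f A\<bar> \<le> C * (1 + op_norm d A) ^ m"
    using poly_boundedD[OF f] by blast
  obtain B where B: "\<And>u. 0 \<le> u \<Longrightarrow> u ^ n * exp (- (\<theta> * u)) \<le> B"
    using power_times_exp_minus_bounded[OF \<theta>] by blast
  show ?thesis
  proof (intro exI allI impI)
    fix s A assume A: "sym_mat A"
    define \<rho> where "\<rho> = op_norm d A"
    have \<rho>0: "0 \<le> \<rho>" by (simp add: \<rho>_def op_norm_nonneg)
    have B0: "0 \<le> B" using order_trans[OF _ B[of 1]] by simp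
    have w: "soft_weight d \<theta> \<kappa> s A \<le> exp (- (\<theta> * (\<rho> / \<kappa>) ^ (2 * 2 ^ s)))"
      using soft_weight_le[OF _ \<kappa> A, of \<theta> d s] \<theta> by (simp add: \<rho>_def)
    have "(1 + \<rho>) ^ n * soft_weight d \<theta> \<kappa> s A \<le> (1 + \<kappa>) ^ n * (1 + B)"
    proof (cases "\<rho> \<le> \<kappa>")
      case True
      have "(1 + \<rho>) ^ n * soft_weight d \<theta> \<kappa> s A \<le> (1 + \<kappa>) ^ n * 1"
        using True \<rho>0 \<theta> \<kappa> soft_weight_le_1[OF _ \<kappa> A, of \<theta> d s] soft_weight_nonneg
        by (intro mult_mono power_mono) auto
      also have "\<dots> \<le> (1 + \<kappa>) ^ n * (1 + B)"
        using B0 \<kappa> by (intro mult_left_mono) auto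
      finally show ?thesis .
    next
      case False
      define u where "u = (\<rho> / \<kappa>)\<^sup>2"
      have q: "1 \<le> \<rho> / \<kappa>" using False \<kappa> by simp
      have "(1 + \<rho>) ^ n \<le> ((1 + \<kappa>) * u) ^ n"
      proof (rule power_mono)
        have "\<rho> = \<kappa> * (\<rho> / \<kappa>)" using \<kappa> by simp
        also have "\<dots> \<le> \<kappa> * u"
          unfolding u_def power2_eq_square using q \<kappa> by (intro mult_left_mono) (auto intro:
              mult_left_mono[of 1 "\<rho>/\<kappa>" "\<rho>/\<kappa>", simplified])
        finally show "1 + \<rho> \<le> (1 + \<kappa>) * u"
          using one_le_power[OF q, of 2] by (simp add: u_def distrib_right)
      qed (use \<rho>0 in auto)
      moreover have "soft_weight d \<theta> \<kappa> s A \<le> exp (- (\<theta> * u))"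
      proof -
        have "u \<le> (\<rho> / \<kappa>) ^ (2 * 2 ^ s)"
          unfolding u_def using q by (intro power_increasing) auto
        then have "exp (- (\<theta> * (\<rho> / \<kappa>) ^ (2 * 2 ^ s))) \<le> exp (- (\<theta> * u))"
          using \<theta> by simp
        with w show ?thesis by linarith
      qed
      ultimately have "(1 + \<rho>) ^ n * soft_weight d \<theta> \<kappa> s A \<le> ((1 + \<kappa>) * u) ^ n * exp (- (\<theta> * u))"
        using soft_weight_nonneg \<kappa> by (intro mult_mono) (auto simp: u_def)
      also have "\<dots> = (1 + \<kappa>) ^ n * (u ^ n * exp (- (\<theta> * u)))"
        by (simp add: power_mult_distrib)
      also have "\<dots> \<le> (1 + \<kappa>) ^ n * (1 + B)"
        using B[of u] \<kappa> by (intro mult_left_mono) (auto simp: u_def)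
      finally show ?thesis .
    qed
    then have "C * ((1 + \<rho>) ^ n * soft_weight d \<theta> \<kappa> s A) \<le> C * ((1 + \<kappa>) ^ n * (1 + B))"
      using C(1) by (rule mult_left_mono)
    moreover have "\<bar>f A * soft_weight d \<theta> \<kappa> s A\<bar> \<le> C * (1 + \<rho>) ^ n * soft_weight d \<theta> \<kappa> s A"
      using C(2)[of n A] soft_weight_nonneg[of d \<theta> \<kappa> s A]
      by (auto simp: abs_mult \<rho>_def intro!: mult_right_mono)
    ultimately show "\<bar>f A * soft_weight d \<theta> \<kappa> s A\<bar> \<le> C * ((1 + \<kappa>) ^ n * (1 + B))"
      by (simp add: mult.assoc)
  qed
qed

lemma soft_weight_measurable [measurable]: "soft_weight d \<theta> \<kappa> s \<in> borel_measurable (mat_space d)"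
  unfolding soft_weight_def[abs_def] by measurable

lemma integrable_soft_weight:
  assumes "1 \<le> d" "0 < \<theta>" "0 < \<kappa>" "poly_bounded d f" "f \<in> borel_measurable (mat_space d)"
  shows "integrable (entries d) (\<lambda>y. f (symm d y) * soft_weight d \<theta> \<kappa> s (symm d y))"
proof -
  interpret E: prob_space "entries d"
    by (rule prob_space_entries[OF assms(1)])
  obtain B where "\<bar>f A * soft_weight d \<theta> \<kappa> s A\<bar> \<le> B" if "sym_mat A" for A
    using soft_weight_bounds_poly[OF assms(2-4)] by blast
  then show ?thesis
    using assms(5) by (intro E.integrable_const_bound[of _ B]) (auto simp: sym_mat_symm)
qed

lemma entry_deriv_measurable:
  "\<lbrakk>a < d; b < d; i < d; j < d\<rbrakk> \<Longrightarrow> (\<lambda>A. entry_deriv d A a b k i j) \<in> borel_measurable (mat_space d)"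
  unfolding entry_deriv_def
  by (intro borel_measurable_times borel_measurable_sum borel_measurable_add mat_pow_measurable) auto

lemma entry_deriv_poly_bounded:
  "\<lbrakk>a < d; b < d; i < d; j < d\<rbrakk> \<Longrightarrow> poly_bounded d (\<lambda>A. entry_deriv d A a b k i j)"
  unfolding entry_deriv_def by (intro poly_bounded_intros) auto

text \<open>The first term comes from differentiating the matrix power, the second one from the
weight.\<close>

lemma weighted_integration_by_parts:
  fixes s :: nat
  assumes d: "1 \<le> d" and \<theta>: "0 < \<theta>" and \<kappa>: "0 < \<kappa>" and ab: "a < d" "b < d"
  defines "r \<equiv> 2 * 2 ^ s"
  shows "(\<integral>y. symm d y (a, b) * mat_pow d (symm d y) k (a, b) * soft_weight d \<theta> \<kappa> s (symm d y)
      \<partial>entries d)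
    = (\<integral>y. (entry_deriv d (symm d y) a b k a b
        - \<theta> / \<kappa> ^ r * (2 * r / d) * (mat_pow d (symm d y) k (a, b) * mat_pow d (symm d y) (r - 1)
            (a, b)))
        * soft_weight d \<theta> \<kappa> s (symm d y) \<partial>entries d)"
proof -
  define t where "t = (min a b, max a b)"
  have tT: "t \<in> triangle d" unfolding t_def by (rule min_max_triangle[OF ab])
  have sd: "0 < (entry_sd d t)\<^sup>2" using entry_sd_pos[OF d, of t] by simp
  define H where "H = (\<lambda>A. entry_deriv d A a b k a b
        - \<theta> / \<kappa> ^ r * (2 * r / d) * (mat_pow d A k (a, b) * mat_pow d A (r - 1) (a, b)))"
  define F where "F = (\<lambda>y. mat_pow d (symm d y) k (a, b) * soft_weight d \<theta> \<kappa> s (symm d y))"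
  define F' where "F' = (\<lambda>y. H (symm d y) / (entry_sd d t)\<^sup>2 * soft_weight d \<theta> \<kappa> s (symm d y))"
  have H_meas[measurable]: "H \<in> borel_measurable (mat_space d)"
    unfolding H_def using ab
    by (intro borel_measurable_times borel_measurable_diff mat_pow_measurable
        entry_deriv_measurable) auto
  have [measurable]: "(\<lambda>A. mat_pow d A k (a, b)) \<in> borel_measurable (mat_space d)"
    using ab by measurable
  have H_pb: "poly_bounded d (\<lambda>A. H A / (entry_sd d t)\<^sup>2)"
    unfolding H_def divide_inverse[of _ "(entry_sd d t)\<^sup>2"] using ab
    by (intro poly_bounded_intros entry_deriv_poly_bounded) auto
  obtain C1 where C1: "\<And>A. sym_mat A \<Longrightarrow> \<bar>mat_pow d A k (a, b) * soft_weight d \<theta> \<kappa> s A\<bar> \<le> C1"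
    using soft_weight_bounds_poly[OF \<theta> \<kappa> poly_bounded_mat_pow[OF ab]] by blast
  obtain C2 where C2: "\<And>A. sym_mat A \<Longrightarrow> \<bar>H A / (entry_sd d t)\<^sup>2 * soft_weight d \<theta> \<kappa> s A\<bar> \<le> C2"
    using soft_weight_bounds_poly[OF \<theta> \<kappa> H_pb] by blast
  obtain C3 where C3: "\<And>A. sym_mat A \<Longrightarrow>
      \<bar>(mat_pow d A 1 (a, b) * mat_pow d A k (a, b)) * soft_weight d \<theta> \<kappa> s A\<bar> \<le> C3"
    using soft_weight_bounds_poly[OF \<theta> \<kappa> poly_bounded_mult[OF poly_bounded_mat_pow[OF ab]
        poly_bounded_mat_pow[OF ab]]]
    by blast
  have P1: "mat_pow d A 1 (a, b) = A (a, b)" for A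
    using ab by (simp add: mat_mul_def if_distrib[of "\<lambda>x. _ * x"] cong: if_cong)
  have yt: "symm d y (a, b) = y t" for y
    using ab by (simp add: symm_apply t_def)
  let ?C = "max C1 (max C2 C3)"
  have dpow: "((\<lambda>x. mat_pow d (symm d (y(t := x))) n (i, j)) has_real_derivative
     entry_deriv d (symm d (y(t := x))) a b n i j / (entry_sd d t)\<^sup>2) (at x)" if "i < d" "j < d"
         for y x n i j
    by (rule symm_mat_pow_has_derivative[OF d ab that t_def])
  have cpow: "continuous_on UNIV (\<lambda>x. mat_pow d (symm d (y(t := x))) n (i, j))" if "i < d" "j < d"
      for y n i j
    using dpow[OF that] by (meson DERIV_isCont continuous_at_imp_continuous_on)
  have dtr: "((\<lambda>x. pow_trace d (symm d (y(t := x))) n) has_real_derivative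
     2 * n / d * mat_pow d (symm d (y(t := x))) (n - 1) (a, b) / (entry_sd d t)\<^sup>2) (at x)" for y x n
    by (rule symm_pow_trace_has_derivative[OF d ab t_def])
  have ctr: "continuous_on UNIV (\<lambda>x. pow_trace d (symm d (y(t := x))) n)" for y n
    using dtr by (meson DERIV_isCont continuous_at_imp_continuous_on)
  have "(\<integral>y. y t * F y \<partial>entries d) = (entry_sd d t)\<^sup>2 * (\<integral>y. F' y \<partial>entries d)"
  proof (rule entries_integration_by_parts[OF d tT, where C = ?C])
    show "F \<in> borel_measurable (entries d)" "F' \<in> borel_measurable (entries d)"
      unfolding F_def F'_def by measurable
    show "\<bar>F y\<bar> \<le> ?C" "\<bar>F' y\<bar> \<le> ?C" for y
      using C1[OF sym_mat_symm, of d y] C2[OF sym_mat_symm, of d y] by (auto simp: F_def F'_def)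
    show "\<bar>y t * F y\<bar> \<le> ?C" for y
      using C3[OF sym_mat_symm, of d y] unfolding P1 yt by (auto simp: F_def mult.assoc)
  next
    fix y x
    have "((\<lambda>x. soft_weight d \<theta> \<kappa> s (symm d (y(t := x)))) has_real_derivative
        soft_weight d \<theta> \<kappa> s (symm d (y(t := x)))
          * - (\<theta> * (2 * r / d * mat_pow d (symm d (y(t := x))) (r - 1) (a, b) / (entry_sd d t)\<^sup>2) /
              \<kappa> ^ r)) (at x)"
      unfolding soft_weight_def r_def[symmetric]
      using DERIV_fun_exp[OF DERIV_minus[OF DERIV_cdivide[OF DERIV_cmult[OF dtr[of y r x], of \<theta>],
          of "\<kappa> ^ r"]]]
      by simp
    from DERIV_mult[OF dpow[OF ab] this]
    show "((\<lambda>x. F (y(t := x))) has_real_derivative F' (y(t := x))) (at x)"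
      unfolding F_def F'_def H_def
      by (rule DERIV_cong) (use sd \<kappa> d in \<open>simp add: field_simps\<close>)
    show "continuous_on UNIV (\<lambda>x. F' (y(t := x)))"
      unfolding F'_def H_def soft_weight_def entry_deriv_def using ab sd \<kappa>
      by (intro continuous_intros cpow ctr) auto
  qed
  also have "\<dots> = (\<integral>y. (entry_sd d t)\<^sup>2 * F' y \<partial>entries d)"
    by simp
  finally show ?thesis
    unfolding F_def F'_def H_def yt using sd by (simp add: mult.assoc)
qed

lemma integral_double_sum:
  fixes f :: "'i \<Rightarrow> 'j \<Rightarrow> 'a \<Rightarrow> real"
  assumes "\<And>a b. a \<in> S \<Longrightarrow> b \<in> T \<Longrightarrow> integrable M (f a b)"
  shows "(\<integral>y. (\<Sum>a\<in>S. \<Sum>b\<in>T. f a b y) \<partial>M) = (\<Sum>a\<in>S. \<Sum>b\<in>T. \<integral>y. f a b y \<partial>M)"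
  using assms
  by (subst Bochner_Integration.integral_sum)
    (auto intro!: sum.cong Bochner_Integration.integral_sum Bochner_Integration.integrable_sum)

text \<open>Writing \<open>tr A^(k+1)\<close> as the sum of \<open>A(a, b) (A^k)(a, b)\<close> allows integration by parts in
each factor \<open>A(a, b)\<close>. The first two terms on the right make up twice the divergence of the
vector field \<open>A^k\<close>; the last one stands for its flux through the boundary of the ball.\<close>

lemma loop_equation:
  fixes s :: nat
  assumes d: "1 \<le> d" and \<theta>: "0 < \<theta>" and \<kappa>: "0 < \<kappa>"
  defines "r \<equiv> 2 * 2 ^ s"
  defines "t \<equiv> \<lambda>y. pow_trace d (symm d y)" and "w \<equiv> \<lambda>y. soft_weight d \<theta> \<kappa> s (symm d y)"
  shows "(\<integral>y. d * t y (k + 1) * w y \<partial>entries d)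
    = (\<integral>y. ((\<Sum>l<k. t y l * t y (k - 1 - l)) + k * t y (k - 1)
        - \<theta> / \<kappa> ^ r * (2 * r) * t y (k + (r - 1))) * w y \<partial>entries d)"
proof -
  let ?P = "\<lambda>y. mat_pow d (symm d y)"
  have int: "integrable (entries d) (\<lambda>y. f (symm d y) * w y)"
    if "poly_bounded d f" "f \<in> borel_measurable (mat_space d)" for f
    unfolding w_def by (rule integrable_soft_weight[OF d \<theta> \<kappa> that])
  have P1: "?P y 1 (a, b) = symm d y (a, b)" if "b < d" for a b y
    using that by (simp add: mat_mul_def if_distrib[of "\<lambda>x. _ * x"] cong: if_cong)
  have sym: "?P y l (i, j) = ?P y l (j, i)" if "i < d" "j < d" for i j l y
    by (rule mat_pow_sym[OF sym_mat_symm that])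
  let ?h = "\<lambda>a b A. entry_deriv d A a b k a b
        - \<theta> / \<kappa> ^ r * (2 * r / d) * (mat_pow d A k (a, b) * mat_pow d A (r - 1) (a, b))"
  have "(\<integral>y. t y (k + 1) * w y \<partial>entries d)
      = (\<integral>y. (\<Sum>a<d. \<Sum>b<d. symm d y (a, b) * ?P y k (a, b) * w y) \<partial>entries d)"
  proof (intro Bochner_Integration.integral_cong refl)
    fix y
    show "t y (k + 1) * w y = (\<Sum>a<d. \<Sum>b<d. symm d y (a, b) * ?P y k (a, b) * w y)"
      unfolding t_def add.commute[of k 1] pow_trace_add[OF sym_mat_symm]
      by (simp only: sum_distrib_right) (intro sum.cong refl, simp only: lessThan_iff P1)
  qed
  also have "\<dots> = (\<Sum>a<d. \<Sum>b<d. \<integral>y. symm d y (a, b) * ?P y k (a, b) * w y \<partial>entries d)"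
  proof -
    have i: "integrable (entries d) (\<lambda>y. symm d y (a, b) * ?P y k (a, b) * w y)" if "a < d" "b <
        d" for a b
      using int[OF poly_bounded_mult[OF poly_bounded_mat_pow[OF that, of 1]
          poly_bounded_mat_pow[OF that, of k]]
          borel_measurable_times[OF mat_pow_measurable[OF that] mat_pow_measurable[OF that]]]
      unfolding P1[OF that(2)] .
    show ?thesis
      by (rule integral_double_sum) (use i in auto)
  qed
  also have "\<dots> = (\<Sum>a<d. \<Sum>b<d. \<integral>y. ?h a b (symm d y) * w y \<partial>entries d)"
  proof (intro sum.cong refl)
    fix a b assume "a \<in> {..<d}" "b \<in> {..<d}"
    then show "(\<integral>y. symm d y (a, b) * ?P y k (a, b) * w y \<partial>entries d) = (\<integral>y. ?h a b (symm d y) * w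
        y \<partial>entries d)"
      using weighted_integration_by_parts[OF d \<theta> \<kappa>, of a b k s] by (simp add: w_def r_def)
  qed
  also have "\<dots> = (\<integral>y. (\<Sum>a<d. \<Sum>b<d. ?h a b (symm d y) * w y) \<partial>entries d)"
  proof -
    have i: "integrable (entries d) (\<lambda>y. ?h a b (symm d y) * w y)" if "a < d" "b < d" for a b
    proof (rule int)
      show "poly_bounded d (?h a b)"
        using that by (intro poly_bounded_intros entry_deriv_poly_bounded) auto
      show "?h a b \<in> borel_measurable (mat_space d)"
        using that by (intro borel_measurable_times borel_measurable_diff mat_pow_measurable
            entry_deriv_measurable) auto
    qed
    show ?thesis
      by (rule integral_double_sum[symmetric]) (use i in auto)
  qed
  also have "\<dots> = (\<integral>y. 1 / d * (((\<Sum>l<k. t y l * t y (k - 1 - l)) + k * t y (k - 1)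
        - \<theta> / \<kappa> ^ r * (2 * r) * t y (k + (r - 1))) * w y) \<partial>entries d)"
  proof (intro Bochner_Integration.integral_cong refl)
    fix y
    have 1: "(\<Sum>a<d. \<Sum>b<d. ?P y l (a, a) * ?P y m (b, b)) = t y l * t y m" for l m
      by (simp add: t_def pow_trace_def mat_trace_def sum_product)
    have 2: "(\<Sum>a<d. \<Sum>b<d. ?P y l (a, b) * ?P y m (a, b)) = t y (l + m)" for l m
      by (simp add: t_def pow_trace_add[OF sym_mat_symm])
    have rot: "(\<Sum>a<d. \<Sum>b<d. \<Sum>l<k. g a b l) = (\<Sum>l<k. \<Sum>a<d. \<Sum>b<d. g a b l)"
      for g :: "nat \<Rightarrow> nat \<Rightarrow> nat \<Rightarrow> real"
    proof -
      have "(\<Sum>a<d. \<Sum>b<d. \<Sum>l<k. g a b l) = (\<Sum>a<d. \<Sum>l<k. \<Sum>b<d. g a b l)"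
        by (rule sum.cong[OF refl], rule sum.swap)
      also have "\<dots> = (\<Sum>l<k. \<Sum>a<d. \<Sum>b<d. g a b l)"
        by (rule sum.swap)
      finally show ?thesis .
    qed
    have "(\<Sum>a<d. \<Sum>b<d. entry_deriv d (symm d y) a b k a b)
        = 1 / d * (\<Sum>l<k. (\<Sum>a<d. \<Sum>b<d. ?P y l (a, a) * ?P y (k - 1 - l) (b, b))
            + (\<Sum>a<d. \<Sum>b<d. ?P y l (a, b) * ?P y (k - 1 - l) (a, b)))"
      by (simp only: entry_deriv_def sum_distrib_left rot sum.distrib distrib_left)
    also have "\<dots> = 1 / d * ((\<Sum>l<k. t y l * t y (k - 1 - l)) + k * t y (k - 1))"
      unfolding 1 2 by (simp add: sum.distrib)
    finally have e: "(\<Sum>a<d. \<Sum>b<d. entry_deriv d (symm d y) a b k a b)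
        = 1 / d * ((\<Sum>l<k. t y l * t y (k - 1 - l)) + k * t y (k - 1))" .
    have e': "(\<Sum>a<d. \<Sum>b<d. \<theta> / \<kappa> ^ r * (2 * r / d) * (?P y k (a, b) * ?P y (r - 1) (a, b)))
        = \<theta> / \<kappa> ^ r * (2 * r / d) * t y (k + (r - 1))"
      by (simp only: sum_distrib_left[symmetric] 2)
    have "(\<Sum>a<d. \<Sum>b<d. ?h a b (symm d y))
        = 1 / d * ((\<Sum>l<k. t y l * t y (k - 1 - l)) + k * t y (k - 1)
          - \<theta> / \<kappa> ^ r * (2 * r) * t y (k + (r - 1)))"
      by (simp only: sum_subtractf e e') (simp add: right_diff_distrib)
    then show "(\<Sum>a<d. \<Sum>b<d. ?h a b (symm d y) * w y)
        = 1 / d * (((\<Sum>l<k. t y l * t y (k - 1 - l)) + k * t y (k - 1)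
        - \<theta> / \<kappa> ^ r * (2 * r) * t y (k + (r - 1))) * w y)"
      by (simp only: sum_distrib_right[symmetric] mult.assoc)
  qed
  finally have eq: "(\<integral>y. t y (k + 1) * w y \<partial>entries d) = 1 / d * (\<integral>y. (((\<Sum>l<k. t y l * t y (k - 1
      - l)) + k * t y (k - 1)
        - \<theta> / \<kappa> ^ r * (2 * r) * t y (k + (r - 1))) * w y) \<partial>entries d)"
    by simp
  have "(\<integral>y. d * t y (k + 1) * w y \<partial>entries d) = d * (\<integral>y. t y (k + 1) * w y \<partial>entries d)"
    by (simp add: mult.assoc)
  then show ?thesis
    unfolding eq using d by simp
qed

section \<open>The second moment of a conditioned GOE matrix\<close>

text \<open>For a matrix of norm exactly \<open>\<kappa>\<close> the limit lies between \<open>exp (- \<theta> d)\<close> and \<open>exp (- \<theta>)\<close>.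
Keeping \<open>\<theta>\<close> as a parameter that tends to \<open>0\<close> last makes it unnecessary to know that the boundary
of the ball is a null set.\<close>

definition hard_weight :: "nat \<Rightarrow> real \<Rightarrow> real \<Rightarrow> rmat \<Rightarrow> real" where
  "hard_weight d \<theta> \<kappa> A = lim (\<lambda>s. soft_weight d \<theta> \<kappa> s A)"

lemma real_power_doubling_at_top:
  assumes "1 < (q::real)"
  shows "filterlim (\<lambda>s. q ^ (2 * 2 ^ s)) at_top sequentially"
proof (rule filterlim_at_top_mono)
  have "filterlim (\<lambda>n. q ^ n) at_infinity sequentially"
    using assms by (intro filterlim_realpow_sequentially_gt1) auto
  then show "filterlim (\<lambda>n. q ^ n) at_top sequentially"
    by (rule filterlim_at_infinity_imp_filterlim_at_top) (use assms in auto)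
  have "q ^ s \<le> q ^ (2 * 2 ^ s)" for s
  proof (rule power_increasing)
    have "s < 2 ^ s" by (rule less_exp)
    then show "s \<le> 2 * 2 ^ s" by linarith
  qed (use assms in auto)
  then show "\<forall>\<^sub>F s in sequentially. q ^ s \<le> q ^ (2 * 2 ^ s)" by simp
qed

lemma soft_exponent_at_top:
  assumes "0 < \<theta>" "0 < \<kappa>" "sym_mat A" "\<kappa> < op_norm d A"
  shows "filterlim (\<lambda>s. \<theta> * pow_trace d A (2 * 2 ^ s) / \<kappa> ^ (2 * 2 ^ s)) at_top sequentially"
proof (rule filterlim_at_top_mono)
  show "filterlim (\<lambda>s. \<theta> * (op_norm d A / \<kappa>) ^ (2 * 2 ^ s)) at_top sequentially"
    using assms by (intro filterlim_tendsto_pos_mult_at_top[OF tendsto_const]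
        real_power_doubling_at_top) auto
  show "\<forall>\<^sub>F s in sequentially. \<theta> * (op_norm d A / \<kappa>) ^ (2 * 2 ^ s)
      \<le> \<theta> * pow_trace d A (2 * 2 ^ s) / \<kappa> ^ (2 * 2 ^ s)"
    using op_norm_pow_le_pow_trace[OF assms(3), of d] assms
    by (auto simp: power_divide intro!: always_eventually divide_right_mono mult_left_mono)
qed

lemma soft_weight_tendsto_0:
  assumes "0 < \<theta>" "0 < \<kappa>" "sym_mat A" "\<kappa> < op_norm d A"
  shows "(\<lambda>s. soft_weight d \<theta> \<kappa> s A) \<longlonglongrightarrow> 0"
  unfolding soft_weight_def
  by (rule filterlim_compose[OF exp_at_bot])
    (simp only: filterlim_uminus_at_top[symmetric], rule soft_exponent_at_top[OF assms])

text \<open>Inside the ball the exponent decreases with \<open>s\<close>.\<close>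

lemma soft_weight_convergent:
  assumes "0 < \<theta>" "0 < \<kappa>" "sym_mat A"
  shows "convergent (\<lambda>s. soft_weight d \<theta> \<kappa> s A)"
proof (cases "op_norm d A \<le> \<kappa>")
  case False
  then show ?thesis
    using soft_weight_tendsto_0[OF assms, of d] by (auto intro: convergentI)
next
  case True
  let ?X = "\<lambda>s. pow_trace d A (2 * 2 ^ s) / \<kappa> ^ (2 * 2 ^ s)"
  have "decseq ?X"
  proof (rule decseq_SucI)
    fix s
    have "pow_trace d A (2 * 2 ^ Suc s) \<le> op_norm d A ^ (2 * 2 ^ s) * pow_trace d A (2 * 2 ^ s)"
      using pow_trace_even_step[OF assms(3), of d "2 ^ s" "2 ^ s"] by (simp add: mult_2)
    also have "\<dots> \<le> \<kappa> ^ (2 * 2 ^ s) * pow_trace d A (2 * 2 ^ s)"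
      using True by (intro mult_right_mono power_mono pow_trace_even_nonneg assms(3)) (auto simp:
          op_norm_nonneg)
    finally have le: "pow_trace d A (2 * 2 ^ Suc s) \<le> \<kappa> ^ (2 * 2 ^ s) * pow_trace d A (2 * 2 ^ s)" .
    have "\<kappa> ^ (2 * 2 ^ Suc s) = \<kappa> ^ (2 * 2 ^ s) * \<kappa> ^ (2 * 2 ^ s)"
      by (simp add: power_add[symmetric])
    then show "?X (Suc s) \<le> ?X s"
      using le assms(2) by (simp only:) (simp add: field_simps del: power_Suc)
  qed
  moreover have "\<forall>s. 0 \<le> ?X s"
    using assms pow_trace_even_nonneg[OF assms(3)] by auto
  ultimately obtain L where L: "?X \<longlonglongrightarrow> L"
    by (rule decseq_convergent)
  have "(\<lambda>s. exp (- (\<theta> * ?X s))) \<longlonglongrightarrow> exp (- (\<theta> * L))"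
    by (intro tendsto_intros L)
  then show ?thesis
    by (auto simp: soft_weight_def intro: convergentI)
qed

lemma soft_weight_tendsto_hard_weight:
  assumes "0 < \<theta>" "0 < \<kappa>" "sym_mat A"
  shows "(\<lambda>s. soft_weight d \<theta> \<kappa> s A) \<longlonglongrightarrow> hard_weight d \<theta> \<kappa> A"
  using soft_weight_convergent[OF assms] unfolding hard_weight_def by (simp add: convergent_LIMSEQ_iff)

lemma hard_weight_measurable [measurable]: "hard_weight d \<theta> \<kappa> \<in> borel_measurable (mat_space d)"
  unfolding hard_weight_def[abs_def] by measurable

lemma hard_weight_nonneg:
  assumes "0 < \<theta>" "0 < \<kappa>" "sym_mat A"
  shows "0 \<le> hard_weight d \<theta> \<kappa> A"
  by (rule LIMSEQ_le_const[OF soft_weight_tendsto_hard_weight[OF assms]]) (simp add: soft_weight_nonneg)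

lemma hard_weight_le_1:
  assumes "0 < \<theta>" "0 < \<kappa>" "sym_mat A"
  shows "hard_weight d \<theta> \<kappa> A \<le> 1"
  by (rule LIMSEQ_le_const2[OF soft_weight_tendsto_hard_weight[OF assms]])
    (use assms soft_weight_le_1 in \<open>auto intro: less_imp_le\<close>)

lemma hard_weight_outside:
  assumes "0 < \<theta>" "0 < \<kappa>" "sym_mat A" "\<kappa> < op_norm d A"
  shows "hard_weight d \<theta> \<kappa> A = 0"
  using soft_weight_tendsto_0[OF assms] soft_weight_tendsto_hard_weight[OF assms(1-3)]
  by (rule LIMSEQ_unique[symmetric])

lemma hard_weight_inside:
  assumes "0 < \<theta>" "0 < \<kappa>" "sym_mat A" "op_norm d A \<le> \<kappa>"
  shows "exp (- (\<theta> * d)) \<le> hard_weight d \<theta> \<kappa> A"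
proof (rule LIMSEQ_le_const[OF soft_weight_tendsto_hard_weight[OF assms(1-3)]], intro exI allI impI)
  fix s
  have "pow_trace d A (2 * 2 ^ s) \<le> d * op_norm d A ^ (2 * 2 ^ s)"
    using abs_pow_trace_le[of d A "2 * 2 ^ s"] by simp
  also have "\<dots> \<le> d * \<kappa> ^ (2 * 2 ^ s)"
    using assms by (intro mult_left_mono power_mono) (auto simp: op_norm_nonneg)
  finally have "\<theta> * pow_trace d A (2 * 2 ^ s) / \<kappa> ^ (2 * 2 ^ s) \<le> \<theta> * d"
    using assms by (simp add: field_simps)
  then show "exp (- (\<theta> * d)) \<le> soft_weight d \<theta> \<kappa> s A"
    by (simp add: soft_weight_def)
qed

lemma integral_soft_weight_limit:
  assumes d: "1 \<le> d" and \<theta>: "0 < \<theta>" and \<kappa>: "0 < \<kappa>"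
    and f: "poly_bounded d f" and [measurable]: "f \<in> borel_measurable (mat_space d)"
  shows "(\<lambda>s. \<integral>y. f (symm d y) * soft_weight d \<theta> \<kappa> s (symm d y) \<partial>entries d)
    \<longlonglongrightarrow> (\<integral>y. f (symm d y) * hard_weight d \<theta> \<kappa> (symm d y) \<partial>entries d)"
proof -
  interpret E: prob_space "entries d"
    by (rule prob_space_entries[OF d])
  obtain B where B: "\<And>s A. sym_mat A \<Longrightarrow> \<bar>f A * soft_weight d \<theta> \<kappa> s A\<bar> \<le> B"
    using soft_weight_bounds_poly[OF \<theta> \<kappa> f] by blast
  show ?thesis
  proof (rule integral_dominated_convergence[where w = "\<lambda>_. B"])
    show "AE y in entries d. (\<lambda>s. f (symm d y) * soft_weight d \<theta> \<kappa> s (symm d y))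
        \<longlonglongrightarrow> f (symm d y) * hard_weight d \<theta> \<kappa> (symm d y)"
      by (intro AE_I2 tendsto_mult tendsto_const soft_weight_tendsto_hard_weight \<theta> \<kappa> sym_mat_symm)
  qed (use B sym_mat_symm in auto)
qed

text \<open>An upper bound for what a matrix outside the ball contributes to the difference of two
boundary terms, relative to the factor \<open>\<kappa>^(2 m)\<close>.\<close>

definition edge_error :: "nat \<Rightarrow> real \<Rightarrow> real \<Rightarrow> nat \<Rightarrow> nat \<Rightarrow> rmat \<Rightarrow> real" where
  "edge_error d \<theta> \<kappa> m s A =
    (if op_norm d A \<le> \<kappa> then 0
     else let U = \<theta> * pow_trace d A (2 * 2 ^ s) / \<kappa> ^ (2 * 2 ^ s) in U * (U / \<theta>) ^ (2 * m) * exp (- U))"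

lemma edge_error_measurable [measurable]: "edge_error d \<theta> \<kappa> m s \<in> borel_measurable (mat_space d)"
  unfolding edge_error_def[abs_def] Let_def by measurable

lemma edge_error_bounds:
  assumes "0 < \<theta>" "0 < \<kappa>"
  shows "\<exists>B. \<forall>s A. sym_mat A \<longrightarrow> 0 \<le> edge_error d \<theta> \<kappa> m s A \<and> edge_error d \<theta> \<kappa> m s A \<le> B"
proof -
  obtain B :: real where "\<forall>u\<ge>0. u ^ (2 * m + 1) * exp (- (1 * u)) \<le> B"
    using power_times_exp_minus_bounded[OF zero_less_one, of "2 * m + 1"] ..
  then have B: "\<And>u. 0 \<le> u \<Longrightarrow> u ^ (2 * m + 1) * exp (- (1 * u)) \<le> B"
    by simp
  have B0: "0 \<le> B" using B[of 0] by simp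
  show ?thesis
  proof (intro exI allI impI)
    fix s A assume A: "sym_mat A"
    let ?U = "\<theta> * pow_trace d A (2 * 2 ^ s) / \<kappa> ^ (2 * 2 ^ s)"
    have U: "0 \<le> ?U" using assms pow_trace_even_nonneg[OF A, of d "2 ^ s"] by simp
    have "?U * (?U / \<theta>) ^ (2 * m) * exp (- ?U) = inverse \<theta> ^ (2 * m) * (?U ^ (2 * m + 1) * exp (-
        (1 * ?U)))"
      by (simp add: power_mult_distrib divide_inverse)
    also have "\<dots> \<le> inverse \<theta> ^ (2 * m) * B"
      using assms by (intro mult_left_mono B U) auto
    finally have "?U * (?U / \<theta>) ^ (2 * m) * exp (- ?U) \<le> inverse \<theta> ^ (2 * m) * B" .
    moreover have "0 \<le> ?U * (?U / \<theta>) ^ (2 * m) * exp (- ?U)"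
      using divide_nonneg_pos[OF U assms(1)] by (intro mult_nonneg_nonneg zero_le_power U) auto
    moreover have "0 \<le> inverse \<theta> ^ (2 * m) * B"
      using B0 assms by simp
    ultimately show "0 \<le> edge_error d \<theta> \<kappa> m s A \<and> edge_error d \<theta> \<kappa> m s A \<le> inverse \<theta> ^ (2 * m) * B"
      unfolding edge_error_def Let_def by (simp only: split: if_split) simp
  qed
qed

lemma edge_error_tendsto_0:
  assumes "0 < \<theta>" "0 < \<kappa>" "sym_mat A"
  shows "(\<lambda>s. edge_error d \<theta> \<kappa> m s A) \<longlonglongrightarrow> 0"
proof (cases "op_norm d A \<le> \<kappa>")
  case False
  have "((\<lambda>u::real. u ^ (2 * m + 1) / exp u) \<longlongrightarrow> 0) at_top"
    by (rule tendsto_power_div_exp_0)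
  then have "((\<lambda>u::real. inverse \<theta> ^ (2 * m) * (u ^ (2 * m + 1) / exp u)) \<longlongrightarrow> inverse \<theta> ^ (2 * m) *
      0) at_top"
    by (intro tendsto_intros)
  then have "((\<lambda>u::real. u * (u / \<theta>) ^ (2 * m) * exp (- u)) \<longlongrightarrow> 0) at_top"
    by (simp add: exp_minus power_mult_distrib divide_inverse mult_ac)
  from filterlim_compose[OF this soft_exponent_at_top[OF assms, of d]]
  show ?thesis
    using False by (simp add: edge_error_def Let_def)
qed (simp add: edge_error_def)

text \<open>With \<open>q\<close> the ratio of the operator norm to \<open>\<kappa>\<close>, raising the exponent of the trace by
\<open>2 m\<close> costs at most the factor \<open>\<kappa>^(2 m) q^(2 m)\<close>. Only the case \<open>q > 1\<close> produces an error, and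
there Bernoulli's inequality \<open>r (q^(2 m) - 1) \<le> q^(2 m r)\<close> absorbs the large factor \<open>r\<close>, since
\<open>q^r \<le> U / \<theta>\<close>.\<close>

lemma pow_trace_edge_bound:
  fixes s :: nat
  assumes "0 < \<theta>" "0 < \<kappa>" "sym_mat A"
  defines "r \<equiv> 2 * 2 ^ s"
  shows "r * (\<theta> / \<kappa> ^ r) * pow_trace d A (r + 2 * m) * soft_weight d \<theta> \<kappa> s A
    \<le> \<kappa> ^ (2 * m) * (r * (\<theta> / \<kappa> ^ r) * pow_trace d A r * soft_weight d \<theta> \<kappa> s A + edge_error d \<theta> \<kappa>
        m s A)"
proof -
  define U where "U = \<theta> * pow_trace d A r / \<kappa> ^ r"
  define q where "q = op_norm d A / \<kappa>"
  have U: "0 \<le> U" using assms pow_trace_even_nonneg[OF assms(3), of d "2 ^ s"] by (simp add: U_def)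
  have q0: "0 \<le> q" using assms by (simp add: q_def op_norm_nonneg)
  have w: "soft_weight d \<theta> \<kappa> s A = exp (- U)"
    by (simp add: soft_weight_def U_def r_def)
  have step: "pow_trace d A (r + 2 * m) \<le> \<kappa> ^ (2 * m) * q ^ (2 * m) * pow_trace d A r"
    using pow_trace_even_step[OF assms(3), of d "2 ^ s" m] assms(2)
    by (simp add: r_def q_def power_divide distrib_left)
  have "r * (\<theta> / \<kappa> ^ r) * pow_trace d A (r + 2 * m) \<le> r * (\<theta> / \<kappa> ^ r) * (\<kappa> ^ (2 * m) * q ^ (2 * m)
      * pow_trace d A r)"
    using assms by (intro mult_left_mono step) auto
  also have "\<dots> = \<kappa> ^ (2 * m) * (r * U * q ^ (2 * m))"
    by (simp add: U_def)
  finally have "r * (\<theta> / \<kappa> ^ r) * pow_trace d A (r + 2 * m) * exp (- U)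
      \<le> \<kappa> ^ (2 * m) * (r * U * q ^ (2 * m)) * exp (- U)"
    by (intro mult_right_mono) auto
  also have "\<dots> \<le> \<kappa> ^ (2 * m) * (r * U * exp (- U) + edge_error d \<theta> \<kappa> m s A)"
  proof -
    have "r * U * q ^ (2 * m) * exp (- U) \<le> r * U * exp (- U) + edge_error d \<theta> \<kappa> m s A"
    proof (cases "q \<le> 1")
      case True
      then have "op_norm d A \<le> \<kappa>" using assms by (simp add: q_def)
      moreover have "q ^ (2 * m) \<le> 1" using True q0 by (rule power_le_one[rotated])
      then have "r * U * q ^ (2 * m) * exp (- U) \<le> r * U * 1 * exp (- U)"
        using U by (intro mult_left_mono mult_right_mono) auto
      ultimately show ?thesis by (simp add: edge_error_def)
    next
      case False
      then have out: "\<not> op_norm d A \<le> \<kappa>" using assms by (simp add: q_def)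
      have "1 + real r * (q ^ (2 * m) - 1) \<le> (1 + (q ^ (2 * m) - 1)) ^ r"
        using one_le_power[of q "2 * m"] False by (intro Bernoulli_inequality) auto
      then have "real r * (q ^ (2 * m) - 1) \<le> (q ^ (2 * m)) ^ r" by simp
      also have "\<dots> = (q ^ r) ^ (2 * m)" by (simp only: power_mult[symmetric] mult.commute)
      also have "\<dots> \<le> (U / \<theta>) ^ (2 * m)"
      proof (rule power_mono)
        show "q ^ r \<le> U / \<theta>"
          using op_norm_pow_le_pow_trace[OF assms(3), of d s] assms
          by (auto simp: q_def U_def r_def power_divide intro!: divide_right_mono)
      qed (use q0 in auto)
      finally have "U * exp (- U) * (real r * (q ^ (2 * m) - 1)) \<le> U * exp (- U) * (U / \<theta>) ^ (2 * m)"
        using U by (intro mult_left_mono) auto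
      then show ?thesis
        using out by (simp add: edge_error_def Let_def U_def[symmetric] r_def[symmetric] algebra_simps)
    qed
    then show ?thesis
      using assms(2) by (simp add: mult.assoc mult_left_mono)
  qed
  also have "r * U * exp (- U) = r * (\<theta> / \<kappa> ^ r) * pow_trace d A r * exp (- U)"
    by (simp add: U_def)
  finally show ?thesis
    unfolding w .
qed

text \<open>The leading part of the divergence of the field \<open>A^(2 m + 1)\<close>, minus its product with the
gradient of the Gaussian potential; the remaining part of the divergence is a nonnegative
multiple of \<open>tr A^(2 m)\<close>.\<close>

definition loop_term :: "nat \<Rightarrow> nat \<Rightarrow> rmat \<Rightarrow> real" where
  "loop_term d m A = 1 / 2 * (\<Sum>l<2 * m + 1. pow_trace d A l * pow_trace d A (2 * m - l))
     - d / 2 * pow_trace d A (2 * m + 2)"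

lemma loop_term_measurable [measurable]: "loop_term d m \<in> borel_measurable (mat_space d)"
  unfolding loop_term_def[abs_def] by measurable

lemma loop_term_poly_bounded: "poly_bounded d (loop_term d m)"
  unfolding loop_term_def[abs_def] by (intro poly_bounded_intros)

text \<open>For \<open>m = 0\<close> the loop equation identifies the integral on the right with the boundary term
of the field \<open>A\<close>, and the boundary term of \<open>A^(2 m + 1)\<close> is asymptotically at most \<open>\<kappa>^(2 m)\<close>
times as large.\<close>

lemma loop_inequality:
  assumes d: "1 \<le> d" and \<theta>: "0 < \<theta>" and \<kappa>: "0 < \<kappa>"
  shows "(\<integral>y. loop_term d m (symm d y) * hard_weight d \<theta> \<kappa> (symm d y) \<partial>entries d)
    \<le> \<kappa> ^ (2 * m) * (\<integral>y. (loop_term d 0 (symm d y) + d / 2) * hard_weight d \<theta> \<kappa> (symm d y) \<partial>entries d)"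
proof -
  interpret E: prob_space "entries d"
    by (rule prob_space_entries[OF d])
  obtain B where B: "\<And>s A. sym_mat A \<Longrightarrow> 0 \<le> edge_error d \<theta> \<kappa> m s A"
    "\<And>s A. sym_mat A \<Longrightarrow> edge_error d \<theta> \<kappa> m s A \<le> B"
    using edge_error_bounds[OF \<theta> \<kappa>] by blast
  let ?t = "\<lambda>y. pow_trace d (symm d y)"
  let ?w = "\<lambda>s y. soft_weight d \<theta> \<kappa> s (symm d y)"
  let ?err = "\<lambda>s. \<integral>y. edge_error d \<theta> \<kappa> m s (symm d y) \<partial>entries d"
  have int: "integrable (entries d) (\<lambda>y. f (symm d y) * ?w s y)"
    if "poly_bounded d f" "f \<in> borel_measurable (mat_space d)" for f s
    by (rule integrable_soft_weight[OF d \<theta> \<kappa> that])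
  have int_err: "integrable (entries d) (\<lambda>y. edge_error d \<theta> \<kappa> m s (symm d y))" for s
    using B sym_mat_symm by (intro E.integrable_const_bound[of _ B]) auto
  have loop: "(\<integral>y. (loop_term d m (symm d y) + real (2 * m + 1) / 2 * ?t y (2 * m)) * ?w s y \<partial>entries d)
      = (\<integral>y. real (2 * 2 ^ s) * (\<theta> / \<kappa> ^ (2 * 2 ^ s)) * ?t y (2 * 2 ^ s + 2 * m) * ?w s y \<partial>entries
          d)" for s m
  proof -
    define r :: nat where "r = 2 * 2 ^ s"
    have r1: "2 * m + 1 + (r - 1) = r + 2 * m" by (simp add: r_def)
    let ?f = "\<lambda>A. (\<Sum>l<2 * m + 1. pow_trace d A l * pow_trace d A (2 * m + 1 - 1 - l))
        + (2 * m + 1) * pow_trace d A (2 * m + 1 - 1)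
        - \<theta> / \<kappa> ^ r * (2 * r) * pow_trace d A (2 * m + 1 + (r - 1))"
    let ?g = "\<lambda>A. d * pow_trace d A (2 * m + 1 + 1)"
    let ?h = "\<lambda>A. loop_term d m A + real (2 * m + 1) / 2 * pow_trace d A (2 * m)"
    let ?k = "\<lambda>A. r * (\<theta> / \<kappa> ^ r) * pow_trace d A (r + 2 * m)"
    have eq: "(\<integral>y. ?g (symm d y) * ?w s y \<partial>entries d) = (\<integral>y. ?f (symm d y) * ?w s y \<partial>entries d)"
      using loop_equation[OF d \<theta> \<kappa>, of "2 * m + 1" s] unfolding r_def by simp
    have pw: "?h A - ?k A = 1 / 2 * (?f A - ?g A)" for A
      unfolding loop_term_def r1 by (simp add: field_simps)
    have ints: "integrable (entries d) (\<lambda>y. ?f (symm d y) * ?w s y)"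
      "integrable (entries d) (\<lambda>y. ?g (symm d y) * ?w s y)"
      "integrable (entries d) (\<lambda>y. ?h (symm d y) * ?w s y)"
      "integrable (entries d) (\<lambda>y. ?k (symm d y) * ?w s y)"
      by (intro int poly_bounded_intros loop_term_poly_bounded; measurable)+
    have "(\<integral>y. ?h (symm d y) * ?w s y \<partial>entries d) - (\<integral>y. ?k (symm d y) * ?w s y \<partial>entries d)
        = (\<integral>y. (?h (symm d y) - ?k (symm d y)) * ?w s y \<partial>entries d)"
      unfolding left_diff_distrib by (rule Bochner_Integration.integral_diff[symmetric]) (fact ints)+
    also have "\<dots> = 1 / 2 * (\<integral>y. (?f (symm d y) - ?g (symm d y)) * ?w s y \<partial>entries d)"
      unfolding pw by (simp only: mult.assoc integral_mult_right_zero)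
    also have "(\<integral>y. (?f (symm d y) - ?g (symm d y)) * ?w s y \<partial>entries d) = 0"
      unfolding left_diff_distrib[of "?f _"] using eq ints
      by (subst Bochner_Integration.integral_diff) auto
    finally show ?thesis
      unfolding r_def by simp
  qed
  have main: "(\<integral>y. loop_term d m (symm d y) * ?w s y \<partial>entries d)
      \<le> \<kappa> ^ (2 * m) * ((\<integral>y. (loop_term d 0 (symm d y) + d / 2) * ?w s y \<partial>entries d) + ?err s)" for s
  proof -
    define r :: nat where "r = 2 * 2 ^ s"
    have ik: "integrable (entries d) (\<lambda>y. r * (\<theta> / \<kappa> ^ r) * ?t y n * ?w s y)" for n
      by (intro int poly_bounded_intros; measurable)
    have "(\<integral>y. loop_term d m (symm d y) * ?w s y \<partial>entries d)
        \<le> (\<integral>y. (loop_term d m (symm d y) + real (2 * m + 1) / 2 * ?t y (2 * m)) * ?w s y \<partial>entries d)"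
    proof (rule integral_mono)
      show "integrable (entries d) (\<lambda>y. loop_term d m (symm d y) * ?w s y)"
        "integrable (entries d) (\<lambda>y. (loop_term d m (symm d y) + real (2 * m + 1) / 2 * ?t y (2 *
            m)) * ?w s y)"
        by (intro int poly_bounded_intros loop_term_poly_bounded; measurable)+
      show "loop_term d m (symm d y) * ?w s y \<le> (loop_term d m (symm d y) + real (2 * m + 1) / 2 *
          ?t y (2 * m)) * ?w s y" for y
        using pow_trace_even_nonneg[OF sym_mat_symm, of d d y m]
        by (intro mult_right_mono soft_weight_nonneg) auto
    qed
    also have "\<dots> = (\<integral>y. r * (\<theta> / \<kappa> ^ r) * ?t y (r + 2 * m) * ?w s y \<partial>entries d)"
      unfolding loop r_def ..
    also have "\<dots> \<le> (\<integral>y. \<kappa> ^ (2 * m) * (r * (\<theta> / \<kappa> ^ r) * ?t y r * ?w s y + edge_error d \<theta> \<kappa> m s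
        (symm d y)) \<partial>entries d)"
    proof (rule integral_mono[OF ik])
      show "r * (\<theta> / \<kappa> ^ r) * ?t y (r + 2 * m) * ?w s y
        \<le> \<kappa> ^ (2 * m) * (r * (\<theta> / \<kappa> ^ r) * ?t y r * ?w s y + edge_error d \<theta> \<kappa> m s (symm d y))" for y
        using pow_trace_edge_bound[OF \<theta> \<kappa> sym_mat_symm, of s d d y m] by (simp add: r_def)
    qed (intro Bochner_Integration.integrable_add integrable_mult_right ik int_err)
    also have "\<dots> = \<kappa> ^ (2 * m) * ((\<integral>y. r * (\<theta> / \<kappa> ^ r) * ?t y (r + 2 * 0) * ?w s y \<partial>entries d) +
        ?err s)"
      using ik[of r] int_err by simp
    also have "(\<integral>y. r * (\<theta> / \<kappa> ^ r) * ?t y (r + 2 * 0) * ?w s y \<partial>entries d)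
        = (\<integral>y. (loop_term d 0 (symm d y) + d / 2) * ?w s y \<partial>entries d)"
      using loop[of 0 s] unfolding r_def by (simp add: pow_trace_0)
    finally show ?thesis .
  qed
  have err0: "?err \<longlonglongrightarrow> 0"
  proof -
    have "?err \<longlonglongrightarrow> (\<integral>y. 0 \<partial>entries d)"
    proof (rule integral_dominated_convergence[where w = "\<lambda>_. B"])
      show "AE y in entries d. (\<lambda>s. edge_error d \<theta> \<kappa> m s (symm d y)) \<longlonglongrightarrow> 0"
        by (intro AE_I2 edge_error_tendsto_0 \<theta> \<kappa> sym_mat_symm)
    qed (use B sym_mat_symm in auto)
    then show ?thesis by simp
  qed
  have pb: "poly_bounded d (\<lambda>A. loop_term d 0 A + d / 2)"
    by (intro poly_bounded_intros loop_term_poly_bounded)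
  show ?thesis
  proof (rule LIMSEQ_le)
    show "(\<lambda>s. \<integral>y. loop_term d m (symm d y) * ?w s y \<partial>entries d)
      \<longlonglongrightarrow> (\<integral>y. loop_term d m (symm d y) * hard_weight d \<theta> \<kappa> (symm d y) \<partial>entries d)"
      by (rule integral_soft_weight_limit[OF d \<theta> \<kappa> loop_term_poly_bounded]) measurable
    have "(\<lambda>s. \<kappa> ^ (2 * m) * ((\<integral>y. (loop_term d 0 (symm d y) + d / 2) * ?w s y \<partial>entries d) + ?err s))
      \<longlonglongrightarrow> \<kappa> ^ (2 * m) * ((\<integral>y. (loop_term d 0 (symm d y) + d / 2) * hard_weight d \<theta> \<kappa> (symm d y)
          \<partial>entries d) + 0)"
      by (intro tendsto_intros err0 integral_soft_weight_limit[OF d \<theta> \<kappa> pb]) measurable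
    then show "(\<lambda>s. \<kappa> ^ (2 * m) * ((\<integral>y. (loop_term d 0 (symm d y) + d / 2) * ?w s y \<partial>entries d) +
        ?err s))
      \<longlonglongrightarrow> \<kappa> ^ (2 * m) * (\<integral>y. (loop_term d 0 (symm d y) + d / 2) * hard_weight d \<theta> \<kappa> (symm d y)
          \<partial>entries d)"
      by simp
  qed (use main in auto)
qed

lemma sum_even_odd:
  fixes f :: "nat \<Rightarrow> 'b::comm_monoid_add"
  shows "(\<Sum>l<2 * m + 1. f l) = (\<Sum>b\<le>m. f (2 * b)) + (\<Sum>b<m. f (2 * b + 1))"
  by (induction m) (simp_all add: ac_simps)

text \<open>With \<open>E\<close> and \<open>V\<close> the generating functions of the even and the odd power traces, Cauchy
products turn the sum into \<open>\<zeta> (E^2 + \<zeta> V^2) / 2 - d (E - d) / 2\<close>. It is bounded below by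
completing the square in \<open>E\<close>.\<close>

lemma loop_term_sum_bound:
  fixes \<zeta> \<kappa> :: real
  assumes \<kappa>: "0 < \<kappa>" and \<zeta>: "0 < \<zeta>" "\<zeta> * \<kappa>\<^sup>2 < 1" and A: "op_norm d A \<le> \<kappa>"
  shows "\<bar>\<zeta> ^ (m + 1) * loop_term d m A\<bar> \<le> \<zeta> * (real d)\<^sup>2 * (1 + \<kappa>\<^sup>2) * (Suc m * (\<zeta> * \<kappa>\<^sup>2) ^ m)"
    and "\<exists>S. (\<lambda>m. \<zeta> ^ (m + 1) * loop_term d m A) sums S \<and> (real d)\<^sup>2 / 2 * (1 - 1 / (4 * \<zeta>)) \<le> S"
proof -
  let ?t = "pow_trace d A"
  have t: "\<bar>?t k\<bar> \<le> d * \<kappa> ^ k" for k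
    using abs_pow_trace_le[of d A k] power_mono[OF A op_norm_nonneg, of k]
    by (meson mult_left_mono of_nat_0_le_iff order_trans)
  have tt: "\<bar>?t k * ?t l\<bar> \<le> (real d)\<^sup>2 * \<kappa> ^ (k + l)" for k l
  proof -
    have "\<bar>?t k\<bar> * \<bar>?t l\<bar> \<le> (d * \<kappa> ^ k) * (d * \<kappa> ^ l)"
      using \<kappa> by (intro mult_mono t) auto
    then show ?thesis by (simp add: abs_mult power2_eq_square power_add mult_ac)
  qed
  show "\<bar>\<zeta> ^ (m + 1) * loop_term d m A\<bar> \<le> \<zeta> * (real d)\<^sup>2 * (1 + \<kappa>\<^sup>2) * (Suc m * (\<zeta> * \<kappa>\<^sup>2) ^ m)"
  proof -
    have "\<bar>\<Sum>l<2 * m + 1. ?t l * ?t (2 * m - l)\<bar> \<le> (\<Sum>l<2 * m + 1. (real d)\<^sup>2 * \<kappa> ^ (2 * m))"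
      by (rule order_trans[OF sum_abs sum_mono]) (use tt in \<open>auto intro: order_trans[OF tt]\<close>)
    then have 1: "\<bar>\<Sum>l<2 * m + 1. ?t l * ?t (2 * m - l)\<bar> \<le> (2 * m + 1) * ((real d)\<^sup>2 * \<kappa> ^ (2 * m))"
      by simp
    have "\<bar>d / 2 * ?t (2 * m + 2)\<bar> \<le> d / 2 * (d * \<kappa> ^ (2 * m + 2))"
      using t[of "2 * m + 2"] by (simp only: abs_mult) (intro mult_mono, auto)
    then have "\<bar>loop_term d m A\<bar> \<le> 1 / 2 * ((2 * m + 1) * ((real d)\<^sup>2 * \<kappa> ^ (2 * m))) + d / 2 * (d
        * \<kappa> ^ (2 * m + 2))"
      unfolding loop_term_def using 1 by linarith
    also have "\<dots> = (real d)\<^sup>2 * \<kappa> ^ (2 * m) * (real (2 * m + 1) / 2 + \<kappa>\<^sup>2 / 2)"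
      by (simp add: field_simps power2_eq_square)
    also have "\<dots> \<le> (real d)\<^sup>2 * \<kappa> ^ (2 * m) * ((1 + \<kappa>\<^sup>2) * Suc m)"
    proof (intro mult_left_mono)
      have "(1 + \<kappa>\<^sup>2) * Suc m - (real (2 * m + 1) / 2 + \<kappa>\<^sup>2 / 2) = 1 / 2 + \<kappa>\<^sup>2 / 2 + \<kappa>\<^sup>2 * m"
        by (simp add: field_simps)
      also have "0 \<le> \<dots>" by simp
      finally show "real (2 * m + 1) / 2 + \<kappa>\<^sup>2 / 2 \<le> (1 + \<kappa>\<^sup>2) * Suc m" by simp
    qed (use \<kappa> in auto)
    finally have "\<bar>loop_term d m A\<bar> \<le> (real d)\<^sup>2 * \<kappa> ^ (2 * m) * ((1 + \<kappa>\<^sup>2) * Suc m)" .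
    then have "\<zeta> ^ (m + 1) * \<bar>loop_term d m A\<bar> \<le> \<zeta> ^ (m + 1) * ((real d)\<^sup>2 * \<kappa> ^ (2 * m) * ((1 +
        \<kappa>\<^sup>2) * Suc m))"
      using \<zeta> by (intro mult_left_mono) auto
    also have "\<dots> = \<zeta> * (real d)\<^sup>2 * (1 + \<kappa>\<^sup>2) * (Suc m * (\<zeta> * \<kappa>\<^sup>2) ^ m)"
      by (simp add: power_mult_distrib power_mult[symmetric])
    finally show ?thesis
      using \<zeta> by (simp add: abs_mult)
  qed
  define e where "e = (\<lambda>b. ?t (2 * b) * \<zeta> ^ b)"
  define u where "u = (\<lambda>b. ?t (2 * b + 1) * \<zeta> ^ b)"
  have geo: "summable (\<lambda>b. c * (\<zeta> * \<kappa>\<^sup>2) ^ b)" for c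
    using \<zeta> \<kappa> by (intro summable_mult summable_geometric) auto
  have ne: "summable (\<lambda>b. norm (e b))"
  proof (rule summable_comparison_test[OF _ geo[of d]], intro exI allI impI)
    fix b show "norm (norm (e b)) \<le> d * (\<zeta> * \<kappa>\<^sup>2) ^ b"
      using mult_right_mono[OF t[of "2 * b"], of "\<zeta> ^ b"] \<zeta>
      by (simp add: e_def abs_mult power_mult_distrib power_mult[symmetric] mult_ac)
  qed
  have nu: "summable (\<lambda>b. norm (u b))"
  proof (rule summable_comparison_test[OF _ geo[of "d * \<kappa>"]], intro exI allI impI)
    fix b show "norm (norm (u b)) \<le> d * \<kappa> * (\<zeta> * \<kappa>\<^sup>2) ^ b"
      using mult_right_mono[OF t[of "2 * b + 1"], of "\<zeta> ^ b"] \<zeta>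
      by (simp add: u_def abs_mult power_mult_distrib power_mult[symmetric] mult_ac)
  qed
  define E where "E = (\<Sum>b. e b)"
  define V where "V = (\<Sum>b. u b)"
  have sE: "e sums E" using ne by (simp add: E_def summable_norm_cancel summable_sums)
  have s1: "(\<lambda>m. \<Sum>b\<le>m. e b * e (m - b)) sums (E * E)"
    unfolding E_def by (rule Cauchy_product_sums[OF ne ne])
  have s2: "(\<lambda>m. \<Sum>b\<le>m. u b * u (m - b)) sums (V * V)"
    unfolding V_def by (rule Cauchy_product_sums[OF nu nu])
  define c where "c = (\<lambda>m. \<Sum>b<m. ?t (2 * b + 1) * ?t (2 * m - (2 * b + 1)) * \<zeta> ^ m)"
  have "c (Suc m) = \<zeta> * (\<Sum>b\<le>m. u b * u (m - b))" for m
  proof -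
    have "?t (2 * b + 1) * ?t (2 * Suc m - (2 * b + 1)) * \<zeta> ^ Suc m = \<zeta> * (u b * u (m - b))" if "b
        \<le> m" for b
    proof -
      have "2 * Suc m - (2 * b + 1) = 2 * (m - b) + 1" using that by simp
      moreover have "\<zeta> ^ Suc m = \<zeta> * (\<zeta> ^ b * \<zeta> ^ (m - b))" using that by (simp add:
          power_add[symmetric])
      ultimately show ?thesis by (simp only: u_def mult_ac)
    qed
    then show ?thesis
      unfolding c_def sum_distrib_left lessThan_Suc_atMost by (intro sum.cong) auto
  qed
  then have "(\<lambda>m. c (Suc m)) sums (\<zeta> * (V * V))"
    using sums_mult[OF s2, of \<zeta>] by simp
  then have s3: "c sums (\<zeta> * (V * V))"
    by (subst (asm) sums_Suc_iff) (simp add: c_def)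
  have s4: "(\<lambda>m. e (Suc m)) sums (E - d)"
    using sE by (subst sums_Suc_iff) (simp add: e_def pow_trace_0)
  have "\<zeta> ^ (m + 1) * loop_term d m A
      = \<zeta> / 2 * ((\<Sum>b\<le>m. e b * e (m - b)) + c m) - d / 2 * e (Suc m)" for m
  proof -
    have "(\<Sum>b\<le>m. ?t (2 * b) * ?t (2 * m - 2 * b)) * \<zeta> ^ m = (\<Sum>b\<le>m. e b * e (m - b))"
      unfolding sum_distrib_right
    proof (intro sum.cong refl)
      fix b assume "b \<in> {..m}"
      then have "2 * m - 2 * b = 2 * (m - b)" "\<zeta> ^ m = \<zeta> ^ b * \<zeta> ^ (m - b)"
        by (auto simp: power_add[symmetric])
      then show "?t (2 * b) * ?t (2 * m - 2 * b) * \<zeta> ^ m = e b * e (m - b)"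
        by (simp only: e_def mult_ac)
    qed
    moreover have "(\<Sum>b<m. ?t (2 * b + 1) * ?t (2 * m - (2 * b + 1))) * \<zeta> ^ m = c m"
      by (simp only: c_def sum_distrib_right)
    moreover have "\<zeta> ^ (m + 1) * loop_term d m A
       = \<zeta> / 2 * ((\<Sum>b\<le>m. ?t (2 * b) * ?t (2 * m - 2 * b)) * \<zeta> ^ m
           + (\<Sum>b<m. ?t (2 * b + 1) * ?t (2 * m - (2 * b + 1))) * \<zeta> ^ m)
         - d / 2 * (?t (2 * Suc m) * \<zeta> ^ Suc m)"
      unfolding loop_term_def sum_even_odd by (simp add: algebra_simps)
    ultimately show ?thesis
      by (simp only: e_def)
  qed
  moreover have "(\<lambda>m. \<zeta> / 2 * ((\<Sum>b\<le>m. e b * e (m - b)) + c m) - d / 2 * e (Suc m))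
      sums (\<zeta> / 2 * (E * E + \<zeta> * (V * V)) - d / 2 * (E - d))"
    by (intro sums_diff sums_mult sums_add s1 s3 s4)
  moreover have "(real d)\<^sup>2 / 2 * (1 - 1 / (4 * \<zeta>)) \<le> \<zeta> / 2 * (E * E + \<zeta> * (V * V)) - d / 2 * (E - d)"
  proof -
    have "0 \<le> \<zeta> / 2 * (E - d / (2 * \<zeta>))\<^sup>2 + \<zeta> / 2 * (\<zeta> * (V * V))"
      using \<zeta> by simp
    also have "\<dots> = \<zeta> / 2 * (E * E + \<zeta> * (V * V)) - d / 2 * (E - d) - (real d)\<^sup>2 / 2 * (1 - 1 / (4 * \<zeta>))"
      using \<zeta> by (simp add: field_simps power2_eq_square)
    finally show ?thesis by simp
  qed
  ultimately show "\<exists>S. (\<lambda>m. \<zeta> ^ (m + 1) * loop_term d m A) sums S \<and> (real d)\<^sup>2 / 2 * (1 - 1 / (4 *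
      \<zeta>)) \<le> S"
    by auto
qed

text \<open>With \<open>z^2 = 1 / \<zeta>\<close>, summation of the loop inequalities gives the factor
\<open>(z^2 - \<kappa>^2) (1 - z^2 / 4)\<close>, which is largest halfway between \<open>\<kappa>^2\<close> and \<open>4\<close>.\<close>

lemma hard_weight_second_moment:
  assumes d: "1 \<le> d" and \<theta>: "0 < \<theta>" and \<kappa>: "0 < \<kappa>" "\<kappa> < 2"
  shows "0 \<le> (\<integral>y. (loop_term d 0 (symm d y) + d / 2 - (real d)\<^sup>2 / 2 * (1 - \<kappa>\<^sup>2 / 4)\<^sup>2)
      * hard_weight d \<theta> \<kappa> (symm d y) \<partial>entries d)"
proof -
  interpret E: prob_space "entries d"
    by (rule prob_space_entries[OF d])
  \<comment> \<open>\<open>1 / \<zeta>\<close> is the midpoint of \<open>\<kappa>^2\<close> and \<open>4\<close>.\<close>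
  define \<zeta> where "\<zeta> = 2 / (4 + \<kappa>\<^sup>2)"
  have k4: "\<kappa>\<^sup>2 < 4" using power_strict_mono[of \<kappa> 2 2] \<kappa> by simp
  have \<zeta>: "0 < \<zeta>" "\<zeta> * \<kappa>\<^sup>2 < 1"
    using k4 by (auto simp: \<zeta>_def field_simps add_pos_nonneg)
  let ?L = "\<lambda>y. hard_weight d \<theta> \<kappa> (symm d y)"
  let ?E0 = "\<integral>y. (loop_term d 0 (symm d y) + d / 2) * ?L y \<partial>entries d"
  define f where "f = (\<lambda>M y. (\<Sum>m<M. \<zeta> ^ (m + 1) * loop_term d m (symm d y)) * ?L y)"
  define F where "F = (\<lambda>y. if op_norm d (symm d y) \<le> \<kappa> then (\<Sum>m. \<zeta> ^ (m + 1) * loop_term d m (symm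
      d y)) * ?L y else 0)"
  have L: "0 \<le> ?L y" "?L y \<le> 1" for y
    using hard_weight_nonneg hard_weight_le_1 \<theta> \<kappa> sym_mat_symm by auto
  have L0: "?L y = 0" if "\<not> op_norm d (symm d y) \<le> \<kappa>" for y
    using hard_weight_outside[OF \<theta> \<kappa>(1) sym_mat_symm] that by simp
  note lt = loop_term_sum_bound[OF \<kappa>(1) \<zeta>]
  let ?g = "\<lambda>m. \<zeta> * (real d)\<^sup>2 * (1 + \<kappa>\<^sup>2) * (Suc m * (\<zeta> * \<kappa>\<^sup>2) ^ m)"
  have sg: "summable ?g"
  proof (rule summable_mult)
    have "norm (\<zeta> * \<kappa>\<^sup>2) < 1" using \<zeta> by simp
    from geometric_deriv_sums[OF this]
    show "summable (\<lambda>m. Suc m * (\<zeta> * \<kappa>\<^sup>2) ^ m)"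
      by (simp add: sums_iff)
  qed
  have g0: "0 \<le> ?g m" for m using \<zeta> by simp
  have fb: "\<bar>f M y\<bar> \<le> suminf ?g" for M y
  proof (cases "op_norm d (symm d y) \<le> \<kappa>")
    case True
    have "\<bar>\<Sum>m<M. \<zeta> ^ (m + 1) * loop_term d m (symm d y)\<bar> \<le> (\<Sum>m<M. ?g m)"
      by (rule order_trans[OF sum_abs sum_mono]) (rule lt(1)[OF True])
    also have "\<dots> \<le> suminf ?g"
      by (intro sum_le_suminf sg) (use g0 in auto)
    finally have "\<bar>\<Sum>m<M. \<zeta> ^ (m + 1) * loop_term d m (symm d y)\<bar> * ?L y \<le> suminf ?g * 1"
      using L[of y] suminf_nonneg[OF sg g0] by (intro mult_mono) auto
    then show ?thesis
      using L[of y] by (simp add: f_def abs_mult)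
  next
    case False
    then show ?thesis
      using L0[of y] suminf_nonneg[OF sg g0] by (simp add: f_def)
  qed
  have [measurable]: "f M \<in> borel_measurable (entries d)" for M
    unfolding f_def by measurable
  have [measurable]: "F \<in> borel_measurable (entries d)"
    unfolding F_def by measurable
  have fF: "(\<lambda>M. f M y) \<longlonglongrightarrow> F y" for y
  proof (cases "op_norm d (symm d y) \<le> \<kappa>")
    case True
    obtain S where "(\<lambda>m. \<zeta> ^ (m + 1) * loop_term d m (symm d y)) sums S"
      using lt(2)[OF True] by blast
    then have "(\<lambda>m. \<zeta> ^ (m + 1) * loop_term d m (symm d y)) sums (\<Sum>m. \<zeta> ^ (m + 1) * loop_term d m
        (symm d y))"
      by (rule summable_sums[OF sums_summable])
    then show ?thesis
      using True unfolding F_def f_def sums_def by (auto intro: tendsto_mult_right)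
  qed (use L0 in \<open>simp add: F_def f_def\<close>)
  have lim: "(\<lambda>M. \<integral>y. f M y \<partial>entries d) \<longlonglongrightarrow> (\<integral>y. F y \<partial>entries d)"
    by (rule integral_dominated_convergence[where w = "\<lambda>_. suminf ?g"]) (use fb fF in auto)
  have intF: "integrable (entries d) F"
    by (rule integrable_dominated_convergence[where w = "\<lambda>_. suminf ?g" and s = f]) (use fb fF in auto)
  have bl: "\<exists>B. \<forall>y. \<bar>h (symm d y) * ?L y\<bar> \<le> B" if h: "poly_bounded d h" for h
  proof -
    obtain B where B: "\<And>s A. sym_mat A \<Longrightarrow> \<bar>h A * soft_weight d \<theta> \<kappa> s A\<bar> \<le> B"
      using soft_weight_bounds_poly[OF \<theta> \<kappa>(1) h] by blast
    have "\<bar>h (symm d y) * ?L y\<bar> \<le> B" for y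
    proof (rule LIMSEQ_le_const2)
      show "(\<lambda>s. \<bar>h (symm d y) * soft_weight d \<theta> \<kappa> s (symm d y)\<bar>) \<longlonglongrightarrow> \<bar>h (symm d y) * ?L y\<bar>"
        by (intro tendsto_intros soft_weight_tendsto_hard_weight \<theta> \<kappa> sym_mat_symm)
    qed (use B sym_mat_symm in auto)
    then show ?thesis by blast
  qed
  have intL: "integrable (entries d) (\<lambda>y. h (symm d y) * ?L y)"
    if h: "poly_bounded d h" and [measurable]: "h \<in> borel_measurable (mat_space d)" for h
  proof -
    obtain B where "\<And>y. \<bar>h (symm d y) * ?L y\<bar> \<le> B" using bl[OF h] by blast
    then show ?thesis by (intro E.integrable_const_bound[of _ B]) auto
  qed
  have le: "(\<integral>y. f M y \<partial>entries d) \<le> (\<Sum>m<M. \<zeta> * (\<zeta> * \<kappa>\<^sup>2) ^ m) * ?E0" for M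
  proof -
    have "(\<integral>y. f M y \<partial>entries d) = (\<Sum>m<M. \<zeta> ^ (m + 1) * (\<integral>y. loop_term d m (symm d y) * ?L y
        \<partial>entries d))"
      unfolding f_def sum_distrib_right mult.assoc
      by (subst Bochner_Integration.integral_sum)
        (auto intro!: intL loop_term_poly_bounded)
    also have "\<dots> \<le> (\<Sum>m<M. \<zeta> ^ (m + 1) * (\<kappa> ^ (2 * m) * ?E0))"
      using \<zeta> by (intro sum_mono mult_left_mono loop_inequality[OF d \<theta> \<kappa>(1)]) auto
    also have "\<dots> = (\<Sum>m<M. \<zeta> * (\<zeta> * \<kappa>\<^sup>2) ^ m) * ?E0"
      unfolding sum_distrib_right
      by (intro sum.cong refl) (simp add: power_mult_distrib power_mult[symmetric])
    finally show ?thesis .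
  qed
  have geo: "(\<lambda>M. (\<Sum>m<M. \<zeta> * (\<zeta> * \<kappa>\<^sup>2) ^ m) * ?E0) \<longlonglongrightarrow> \<zeta> * (1 / (1 - \<zeta> * \<kappa>\<^sup>2)) * ?E0"
  proof -
    have "norm (\<zeta> * \<kappa>\<^sup>2) < 1" using \<zeta> by simp
    from sums_mult[OF geometric_sums[OF this], of \<zeta>]
    show ?thesis unfolding sums_def by (rule tendsto_mult_right)
  qed
  have "(\<integral>y. F y \<partial>entries d) \<le> \<zeta> * (1 / (1 - \<zeta> * \<kappa>\<^sup>2)) * ?E0"
    by (rule LIMSEQ_le[OF lim geo]) (use le in auto)
  moreover have "(\<integral>y. (real d)\<^sup>2 / 2 * (1 - 1 / (4 * \<zeta>)) * ?L y \<partial>entries d) \<le> (\<integral>y. F y \<partial>entries d)"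
  proof (rule integral_mono[OF _ intF])
    show "integrable (entries d) (\<lambda>y. (real d)\<^sup>2 / 2 * (1 - 1 / (4 * \<zeta>)) * ?L y)"
      by (intro intL poly_bounded_intros) measurable
    show "(real d)\<^sup>2 / 2 * (1 - 1 / (4 * \<zeta>)) * ?L y \<le> F y" for y
    proof (cases "op_norm d (symm d y) \<le> \<kappa>")
      case True
      then obtain S where "(\<lambda>m. \<zeta> ^ (m + 1) * loop_term d m (symm d y)) sums S"
        "(real d)\<^sup>2 / 2 * (1 - 1 / (4 * \<zeta>)) \<le> S"
        using lt(2)[OF True] by blast
      moreover from this(1) have "(\<Sum>m. \<zeta> ^ (m + 1) * loop_term d m (symm d y)) = S"
        by (rule sums_unique[symmetric])
      ultimately show ?thesis
        unfolding F_def using True L(1)[of y] by (simp only: if_True mult_right_mono)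
    qed (use L0 in \<open>simp add: F_def\<close>)
  qed
  ultimately have "(\<integral>y. (real d)\<^sup>2 / 2 * (1 - 1 / (4 * \<zeta>)) * ?L y \<partial>entries d) \<le> \<zeta> * (1 / (1 - \<zeta> *
      \<kappa>\<^sup>2)) * ?E0"
    by linarith
  then have "(real d)\<^sup>2 / 2 * (1 - 1 / (4 * \<zeta>)) * (\<integral>y. ?L y \<partial>entries d) \<le> \<zeta> * (1 / (1 - \<zeta> * \<kappa>\<^sup>2)) * ?E0"
    by simp
  moreover have z1: "\<zeta> * (1 / (1 - \<zeta> * \<kappa>\<^sup>2)) = 2 / (4 - \<kappa>\<^sup>2)"
  proof -
    have "4 + \<kappa>\<^sup>2 \<noteq> 0" using zero_le_power2[of \<kappa>] by linarith
    then have z: "1 - \<zeta> * \<kappa>\<^sup>2 = (4 - \<kappa>\<^sup>2) / (4 + \<kappa>\<^sup>2)" by (simp add: \<zeta>_def field_simps)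
    have "2 / a * (1 / (b / a)) = 2 / b" if "a \<noteq> 0" for a b :: real
      using that by simp
    then show ?thesis
      unfolding z unfolding \<zeta>_def using \<open>4 + \<kappa>\<^sup>2 \<noteq> 0\<close> by blast
  qed
  moreover have z2: "1 - 1 / (4 * \<zeta>) = (4 - \<kappa>\<^sup>2) / 8"
    by (simp add: \<zeta>_def field_simps)
  ultimately have "(real d)\<^sup>2 / 2 * ((4 - \<kappa>\<^sup>2) / 8) * (\<integral>y. ?L y \<partial>entries d) \<le> 2 / (4 - \<kappa>\<^sup>2) * ?E0"
    by (simp only:)
  then have "(4 - \<kappa>\<^sup>2) / 2 * ((real d)\<^sup>2 / 2 * ((4 - \<kappa>\<^sup>2) / 8) * (\<integral>y. ?L y \<partial>entries d))
      \<le> (4 - \<kappa>\<^sup>2) / 2 * (2 / (4 - \<kappa>\<^sup>2) * ?E0)"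
    using k4 by (intro mult_left_mono) auto
  also have "\<dots> = ?E0" using k4 by simp
  finally have "(real d)\<^sup>2 / 2 * (1 - \<kappa>\<^sup>2 / 4)\<^sup>2 * (\<integral>y. ?L y \<partial>entries d) \<le> ?E0"
    by (simp add: power2_eq_square field_simps)
  moreover have "(\<integral>y. (loop_term d 0 (symm d y) + d / 2 - (real d)\<^sup>2 / 2 * (1 - \<kappa>\<^sup>2 / 4)\<^sup>2) * ?L y
      \<partial>entries d)
      = ?E0 - (real d)\<^sup>2 / 2 * (1 - \<kappa>\<^sup>2 / 4)\<^sup>2 * (\<integral>y. ?L y \<partial>entries d)"
  proof -
    have "integrable (entries d) (\<lambda>y. (loop_term d 0 (symm d y) + d / 2) * ?L y)"
      by (intro intL poly_bounded_intros loop_term_poly_bounded) measurable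
    moreover have "integrable (entries d) (\<lambda>y. (real d)\<^sup>2 / 2 * (1 - \<kappa>\<^sup>2 / 4)\<^sup>2 * ?L y)"
      by (intro intL poly_bounded_intros) measurable
    ultimately show ?thesis
      unfolding left_diff_distrib[of "_ + _"] by simp
  qed
  ultimately show ?thesis by simp
qed

lemma second_moment_bound:
  assumes d: "1 \<le> d" and \<kappa>: "0 < \<kappa>" "\<kappa> < 2"
  shows "0 \<le> (\<integral>y. (real d * (real d + 1) / 2 - d / 2 * pow_trace d (symm d y) 2 - (real d)\<^sup>2 / 2 *
      (1 - \<kappa>\<^sup>2 / 4)\<^sup>2)
      * indicator {y. op_norm d (symm d y) \<le> \<kappa>} y \<partial>entries d)"
proof -
  interpret E: prob_space "entries d"
    by (rule prob_space_entries[OF d])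
  let ?h = "\<lambda>A. loop_term d 0 A + d / 2 - (real d)\<^sup>2 / 2 * (1 - \<kappa>\<^sup>2 / 4)\<^sup>2"
  let ?\<theta> = "\<lambda>n. 1 / real (Suc n)"
  have pb: "poly_bounded d ?h"
    by (intro poly_bounded_intros loop_term_poly_bounded)
  have ind: "(\<lambda>n. hard_weight d (?\<theta> n) \<kappa> A) \<longlonglongrightarrow> indicator {A. op_norm d A \<le> \<kappa>} A" if A: "sym_mat A" for A
  proof (cases "op_norm d A \<le> \<kappa>")
    case True
    have "?\<theta> \<longlonglongrightarrow> 0"
      using LIMSEQ_inverse_real_of_nat by (simp add: inverse_eq_divide)
    then have "(\<lambda>n. exp (- (?\<theta> n * d))) \<longlonglongrightarrow> exp (- (0 * real d))"
      by (rule tendsto_exp[OF tendsto_minus[OF tendsto_mult_right]])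
    then have "(\<lambda>n. exp (- (?\<theta> n * d))) \<longlonglongrightarrow> 1" by simp
    then have "(\<lambda>n. hard_weight d (?\<theta> n) \<kappa> A) \<longlonglongrightarrow> 1"
    proof (rule tendsto_sandwich[rotated 2])
      show "\<forall>\<^sub>F n in sequentially. exp (- (?\<theta> n * d)) \<le> hard_weight d (?\<theta> n) \<kappa> A"
        by (intro always_eventually allI hard_weight_inside[OF _ \<kappa>(1) A True]) simp
      show "\<forall>\<^sub>F n in sequentially. hard_weight d (?\<theta> n) \<kappa> A \<le> 1"
        using hard_weight_le_1[OF _ \<kappa>(1) A] by (intro always_eventually) auto
    qed auto
    then show ?thesis using True by simp
  next
    case False
    then have "hard_weight d (?\<theta> n) \<kappa> A = 0" for n
      using hard_weight_outside[OF _ \<kappa>(1) A] by simp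
    then show ?thesis using False by simp
  qed
  obtain C k where C: "0 \<le> C" "\<And>A m. k \<le> m \<Longrightarrow> \<bar>?h A\<bar> \<le> C * (1 + op_norm d A) ^ m"
    using poly_boundedD[OF pb] by blast
  have bd: "\<bar>?h A * hard_weight d (?\<theta> n) \<kappa> A\<bar> \<le> C * (1 + \<kappa>) ^ k" if A: "sym_mat A" for A n
  proof (cases "op_norm d A \<le> \<kappa>")
    case True
    have "\<bar>?h A\<bar> \<le> C * (1 + \<kappa>) ^ k"
      using C(1) True by (intro order_trans[OF C(2)[OF order_refl]] mult_left_mono power_mono)
          (auto simp: op_norm_nonneg)
    moreover have "\<bar>hard_weight d (?\<theta> n) \<kappa> A\<bar> \<le> 1"
      using hard_weight_le_1[OF _ \<kappa>(1) A] hard_weight_nonneg[OF _ \<kappa>(1) A] by auto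
    ultimately have "\<bar>?h A\<bar> * \<bar>hard_weight d (?\<theta> n) \<kappa> A\<bar> \<le> (C * (1 + \<kappa>) ^ k) * 1"
      by (intro mult_mono) auto
    then show ?thesis by (simp add: abs_mult)
  next
    case False
    then have "hard_weight d (?\<theta> n) \<kappa> A = 0"
      using hard_weight_outside[OF _ \<kappa>(1) A] by simp
    then show ?thesis using C(1) \<kappa> by simp
  qed
  have "(\<lambda>n. \<integral>y. ?h (symm d y) * hard_weight d (?\<theta> n) \<kappa> (symm d y) \<partial>entries d)
    \<longlonglongrightarrow> (\<integral>y. ?h (symm d y) * indicator {A. op_norm d A \<le> \<kappa>} (symm d y) \<partial>entries d)"
  proof (rule integral_dominated_convergence[where w = "\<lambda>_. C * (1 + \<kappa>) ^ k"])
    show "(\<lambda>y. ?h (symm d y) * indicator {A. op_norm d A \<le> \<kappa>} (symm d y)) \<in> borel_measurable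
        (entries d)"
      unfolding indicator_def by measurable
    show "AE y in entries d. (\<lambda>n. ?h (symm d y) * hard_weight d (?\<theta> n) \<kappa> (symm d y))
       \<longlonglongrightarrow> ?h (symm d y) * indicator {A. op_norm d A \<le> \<kappa>} (symm d y)"
      by (intro AE_I2 tendsto_mult tendsto_const ind sym_mat_symm)
    show "AE y in entries d. norm (?h (symm d y) * hard_weight d (?\<theta> n) \<kappa> (symm d y)) \<le> C * (1 +
        \<kappa>) ^ k" for n
      using bd[OF sym_mat_symm] by simp
  qed auto
  then have "0 \<le> (\<integral>y. ?h (symm d y) * indicator {A. op_norm d A \<le> \<kappa>} (symm d y) \<partial>entries d)"
    by (rule LIMSEQ_le_const) (use hard_weight_second_moment[OF d _ \<kappa>] in auto)
  also have "\<dots> = (\<integral>y. (real d * (real d + 1) / 2 - d / 2 * pow_trace d (symm d y) 2 - (real d)\<^sup>2 /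
      2 * (1 - \<kappa>\<^sup>2 / 4)\<^sup>2)
      * indicator {y. op_norm d (symm d y) \<le> \<kappa>} y \<partial>entries d)"
    by (intro Bochner_Integration.integral_cong refl)
      (simp add: loop_term_def pow_trace_0 indicator_def field_simps power2_eq_square numeral_2_eq_2)
  finally show ?thesis .
qed

section \<open>The Mehler kernel of a correlated pair\<close>

text \<open>If in every coordinate the image measure of \<open>h\<close> has density \<open>k\<close>, then the image of the
product measure has the product density.\<close>

lemma nn_integral_PiM_transform:
  fixes M :: "'i \<Rightarrow> 'a measure" and k :: "'i \<Rightarrow> 'a \<Rightarrow> ennreal"
  assumes "product_sigma_finite M" and T: "finite T"
    and h: "\<And>t. h t \<in> M t \<rightarrow>\<^sub>M M t" and k: "\<And>t. k t \<in> borel_measurable (M t)"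
    and step: "\<And>t f. f \<in> borel_measurable (M t) \<Longrightarrow>
      (\<integral>\<^sup>+y. f (h t y) \<partial>M t) = (\<integral>\<^sup>+v. f v * k t v \<partial>M t)"
    and F: "F \<in> borel_measurable (PiM T M)"
  shows "(\<integral>\<^sup>+y. F (\<lambda>t\<in>T. h t (y t)) \<partial>PiM T M) = (\<integral>\<^sup>+v. F v * (\<Prod>t\<in>T. k t (v t)) \<partial>PiM T M)"
proof -
  interpret product_sigma_finite M by fact
  note [measurable] = h k
  show ?thesis
    using T F
  proof (induction T arbitrary: F)
    case empty
    have "(\<lambda>t\<in>{}. h t (y t)) = (\<lambda>_. undefined)" for y by auto
    then show ?case
      by (intro nn_integral_cong) (auto simp: space_PiM)
  next
    case (insert i T)
    note [measurable] = insert.prems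
    have upd: "(\<lambda>t\<in>insert i T. h t ((x(i := y)) t)) = (\<lambda>t\<in>T. h t (x t))(i := h i y)" for x y
      using insert.hyps by (auto simp: fun_eq_iff)
    have [measurable]: "(\<lambda>(x, y). F (x(i := y))) \<in> borel_measurable (PiM T M \<Otimes>\<^sub>M M i)"
      using measurable_compose[OF measurable_add_dim insert.prems]
      by (simp add: case_prod_beta)
    have Fx [measurable]: "(\<lambda>y. F (x(i := y))) \<in> borel_measurable (M i)" if "x \<in> space (PiM T M)" for x
      using measurable_Pair2[OF \<open>(\<lambda>(x, y). F (x(i := y))) \<in> _\<close> that] by simp
    define F' where "F' = (\<lambda>x. \<integral>\<^sup>+v. F (x(i := v)) * k i v \<partial>M i)"
    have [measurable]: "F' \<in> borel_measurable (PiM T M)"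
      unfolding F'_def by measurable
    have "(\<integral>\<^sup>+y. F (\<lambda>t\<in>insert i T. h t (y t)) \<partial>PiM (insert i T) M)
        = (\<integral>\<^sup>+x. \<integral>\<^sup>+y. F ((\<lambda>t\<in>T. h t (x t))(i := h i y)) \<partial>M i \<partial>PiM T M)"
      using insert.hyps by (subst product_nn_integral_insert) (simp_all only: upd, auto)
    also have "\<dots> = (\<integral>\<^sup>+x. F' (\<lambda>t\<in>T. h t (x t)) \<partial>PiM T M)"
      unfolding F'_def
    proof (rule nn_integral_cong)
      fix x assume "x \<in> space (PiM T M)"
      moreover have "(\<lambda>x. \<lambda>t\<in>T. h t (x t)) \<in> PiM T M \<rightarrow>\<^sub>M PiM T M"
        by measurable
      ultimately have "(\<lambda>t\<in>T. h t (x t)) \<in> space (PiM T M)"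
        by (metis measurable_space)
      from step[OF Fx[OF this]]
      show "(\<integral>\<^sup>+y. F ((\<lambda>t\<in>T. h t (x t))(i := h i y)) \<partial>M i)
        = (\<integral>\<^sup>+v. F ((\<lambda>t\<in>T. h t (x t))(i := v)) * k i v \<partial>M i)" .
    qed
    also have "\<dots> = (\<integral>\<^sup>+v. F' v * (\<Prod>t\<in>T. k t (v t)) \<partial>PiM T M)"
      by (rule insert.IH) measurable
    also have "\<dots> = (\<integral>\<^sup>+x. \<integral>\<^sup>+v. F (x(i := v)) * (\<Prod>t\<in>insert i T. k t ((x(i := v)) t)) \<partial>M i \<partial>PiM T M)"
      unfolding F'_def
    proof (intro nn_integral_cong)
      fix x assume x: "x \<in> space (PiM T M)"
      have "(\<Prod>t\<in>insert i T. k t ((x(i := v)) t)) = k i v * (\<Prod>t\<in>T. k t (x t))" for v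
      proof -
        have "(\<Prod>t\<in>T. k t ((x(i := v)) t)) = (\<Prod>t\<in>T. k t (x t))"
          using insert.hyps by (intro prod.cong) auto
        then show ?thesis
          using insert.hyps by simp
      qed
      then show "(\<integral>\<^sup>+v. F (x(i := v)) * k i v \<partial>M i) * (\<Prod>t\<in>T. k t (x t))
         = (\<integral>\<^sup>+v. F (x(i := v)) * (\<Prod>t\<in>insert i T. k t ((x(i := v)) t)) \<partial>M i)"
        using Fx[OF x] k by (simp add: nn_integral_multc[symmetric] mult.assoc)
    qed
    also have "\<dots> = (\<integral>\<^sup>+v. F v * (\<Prod>t\<in>insert i T. k t (v t)) \<partial>PiM (insert i T) M)"
      using insert.hyps by (subst product_nn_integral_insert) auto
    finally show ?case .
  qed
qed

text \<open>The density of \<open>q x + sqrt (1 - q^2) Z\<close>, where \<open>Z\<close> is normal with standard deviation \<open>s\<close>,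
relative to the law of \<open>Z\<close>.\<close>

definition mehler :: "real \<Rightarrow> real \<Rightarrow> real \<Rightarrow> real \<Rightarrow> real" where
  "mehler s q x v = 1 / sqrt (1 - q\<^sup>2) * exp (- (q\<^sup>2 * x\<^sup>2 + q\<^sup>2 * v\<^sup>2 - 2 * q * x * v) / (2 * s\<^sup>2 * (1
      - q\<^sup>2)))"

lemma mehler_measurable [measurable]: "mehler s q x \<in> borel_measurable borel"
  unfolding mehler_def[abs_def] by measurable

lemma gauss_nn_integral:
  assumes [measurable]: "f \<in> borel_measurable borel"
  shows "(\<integral>\<^sup>+y. f y \<partial>gauss s) = (\<integral>\<^sup>+y. ennreal (normal_density 0 s y) * f y \<partial>lborel)"
  unfolding gauss_def by (rule nn_integral_density) auto

lemma gauss_mehler: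
  assumes s: "0 < s" and q: "\<bar>q\<bar> < 1" and [measurable]: "f \<in> borel_measurable borel"
  shows "(\<integral>\<^sup>+y. f (q * x + sqrt (1 - q\<^sup>2) * y) \<partial>gauss s) = (\<integral>\<^sup>+v. f v * ennreal (mehler s q x v) \<partial>gauss s)"
proof -
  let ?c = "sqrt (1 - q\<^sup>2)"
  have q2: "q\<^sup>2 < 1" using q by (simp add: abs_square_less_1)
  then have c: "0 < ?c" by simp
  have c2: "?c\<^sup>2 = 1 - q\<^sup>2" using q2 by simp
  have key: "?c * (normal_density 0 s (q * x + ?c * y) * mehler s q x (q * x + ?c * y)) =
      normal_density 0 s y" for y
  proof -
    let ?v = "q * x + ?c * y"
    have "- (?v - 0)\<^sup>2 / (2 * s\<^sup>2) + - (q\<^sup>2 * x\<^sup>2 + q\<^sup>2 * ?v\<^sup>2 - 2 * q * x * ?v) / (2 * s\<^sup>2 * (1 - q\<^sup>2))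
        = - ((1 - q\<^sup>2) * ?v\<^sup>2 + (q\<^sup>2 * x\<^sup>2 + q\<^sup>2 * ?v\<^sup>2 - 2 * q * x * ?v)) / (2 * s\<^sup>2 * (1 - q\<^sup>2))"
      using s q2 by (simp add: field_simps)
    also have "(1 - q\<^sup>2) * ?v\<^sup>2 + (q\<^sup>2 * x\<^sup>2 + q\<^sup>2 * ?v\<^sup>2 - 2 * q * x * ?v) = (?v - q * x)\<^sup>2"
      by (simp add: power2_eq_square algebra_simps)
    also have "\<dots> = (1 - q\<^sup>2) * y\<^sup>2"
      by (simp add: power_mult_distrib c2)
    also have "- ((1 - q\<^sup>2) * y\<^sup>2) / (2 * s\<^sup>2 * (1 - q\<^sup>2)) = - (y - 0)\<^sup>2 / (2 * s\<^sup>2)"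
      using s q2 by (simp add: field_simps)
    finally have e: "exp (- (?v - 0)\<^sup>2 / (2 * s\<^sup>2)) * exp (- (q\<^sup>2 * x\<^sup>2 + q\<^sup>2 * ?v\<^sup>2 - 2 * q * x * ?v) /
        (2 * s\<^sup>2 * (1 - q\<^sup>2)))
        = exp (- (y - 0)\<^sup>2 / (2 * s\<^sup>2))"
      unfolding exp_add[symmetric] by (rule arg_cong)
    have "?c * (normal_density 0 s ?v * mehler s q x ?v) = 1 / sqrt (2 * pi * s\<^sup>2) * (exp (- (?v -
        0)\<^sup>2 / (2 * s\<^sup>2))
        * exp (- (q\<^sup>2 * x\<^sup>2 + q\<^sup>2 * ?v\<^sup>2 - 2 * q * x * ?v) / (2 * s\<^sup>2 * (1 - q\<^sup>2))))"
      unfolding normal_density_def mehler_def using c by (simp only: times_divide_eq_left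
          times_divide_eq_right) (simp add: mult_ac)
    then show ?thesis
      unfolding e normal_density_def .
  qed
  have "(\<integral>\<^sup>+v. f v * ennreal (mehler s q x v) \<partial>gauss s)
      = (\<integral>\<^sup>+v. ennreal (normal_density 0 s v) * (f v * ennreal (mehler s q x v)) \<partial>lborel)"
    by (rule gauss_nn_integral) measurable
  also have "\<dots> = \<bar>?c\<bar> * (\<integral>\<^sup>+y. ennreal (normal_density 0 s (q * x + ?c * y)) * (f (q * x + ?c * y)
      * ennreal (mehler s q x (q * x + ?c * y))) \<partial>lborel)"
    using c by (intro nn_integral_real_affine) auto
  also have "\<dots> = (\<integral>\<^sup>+y. ennreal ?c * (ennreal (normal_density 0 s (q * x + ?c * y)) * (f (q * x +
      ?c * y) * ennreal (mehler s q x (q * x + ?c * y)))) \<partial>lborel)"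
    using c by (subst nn_integral_cmult) auto
  also have "\<dots> = (\<integral>\<^sup>+y. ennreal (normal_density 0 s y) * f (q * x + ?c * y) \<partial>lborel)"
  proof (rule nn_integral_cong)
    fix y
    have "0 \<le> mehler s q x (q * x + ?c * y)" using q2 by (simp add: mehler_def)
    then have "ennreal (normal_density 0 s y) = ennreal ?c * (ennreal (normal_density 0 s (q * x +
        ?c * y)) * ennreal (mehler s q x (q * x + ?c * y)))"
      unfolding key[of y, symmetric] using c by (simp add: ennreal_mult)
    then show "ennreal ?c * (ennreal (normal_density 0 s (q * x + ?c * y)) * (f (q * x + ?c * y) *
        ennreal (mehler s q x (q * x + ?c * y))))
        = ennreal (normal_density 0 s y) * f (q * x + ?c * y)"
      by (simp add: mult_ac)
  qed
  also have "\<dots> = (\<integral>\<^sup>+y. f (q * x + ?c * y) \<partial>gauss s)"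
    by (rule gauss_nn_integral[symmetric]) measurable
  finally show ?thesis ..
qed

lemma gauss_uminus:
  assumes [measurable]: "f \<in> borel_measurable borel"
  shows "(\<integral>\<^sup>+y. f (- y) \<partial>gauss s) = (\<integral>\<^sup>+y. f y \<partial>gauss s)"
proof -
  have "(\<integral>\<^sup>+y. f y \<partial>gauss s) = (\<integral>\<^sup>+y. ennreal (normal_density 0 s y) * f y \<partial>lborel)"
    by (rule gauss_nn_integral) measurable
  also have "\<dots> = \<bar>-1::real\<bar> * (\<integral>\<^sup>+y. ennreal (normal_density 0 s (0 + (-1) * y)) * f (0 + (-1) * y)
      \<partial>lborel)"
    by (intro nn_integral_real_affine) auto
  also have "\<dots> = (\<integral>\<^sup>+y. ennreal (normal_density 0 s y) * f (- y) \<partial>lborel)"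
    by (simp add: normal_density_def)
  also have "\<dots> = (\<integral>\<^sup>+y. f (- y) \<partial>gauss s)"
    by (rule gauss_nn_integral[symmetric]) measurable
  finally show ?thesis ..
qed

lemma product_sigma_finite_gauss:
  assumes "1 \<le> d" shows "product_sigma_finite (\<lambda>t. gauss (entry_sd d t))"
proof -
  interpret product_prob_space "\<lambda>t. gauss (entry_sd d t)"
    by (rule product_prob_space_gauss[OF assms])
  show ?thesis ..
qed

lemma entries_mehler:
  assumes d: "1 \<le> d" and q: "\<bar>q\<bar> < 1" and F: "F \<in> borel_measurable (entries d)"
  shows "(\<integral>\<^sup>+y. F (\<lambda>t\<in>triangle d. q * x t + sqrt (1 - q\<^sup>2) * y t) \<partial>entries d)
    = (\<integral>\<^sup>+v. F v * ennreal (\<Prod>t\<in>triangle d. mehler (entry_sd d t) q (x t) (v t)) \<partial>entries d)"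
proof -
  have "0 \<le> mehler s q x v" for s x v
    using q by (simp add: mehler_def abs_square_le_1)
  then have pe: "ennreal (\<Prod>t\<in>triangle d. mehler (entry_sd d t) q (x t) (v t))
      = (\<Prod>t\<in>triangle d. ennreal (mehler (entry_sd d t) q (x t) (v t)))" for v
    by (simp add: prod_ennreal)
  show ?thesis
    unfolding pe unfolding entries_def
  proof (rule nn_integral_PiM_transform[OF product_sigma_finite_gauss[OF d] finite_triangle])
    show "F \<in> borel_measurable (PiM (triangle d) (\<lambda>t. gauss (entry_sd d t)))"
      using F by (simp add: entries_def)
    show "(\<integral>\<^sup>+y. f (q * x t + sqrt (1 - q\<^sup>2) * y) \<partial>gauss (entry_sd d t))
        = (\<integral>\<^sup>+v. f v * ennreal (mehler (entry_sd d t) q (x t) v) \<partial>gauss (entry_sd d t))"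
      if "f \<in> borel_measurable (gauss (entry_sd d t))" for t f
      using that by (intro gauss_mehler entry_sd_pos[OF d] q) (simp cong: measurable_cong_sets)
  qed (simp_all cong: measurable_cong_sets)
qed

lemma entries_uminus:
  assumes d: "1 \<le> d" and F: "F \<in> borel_measurable (entries d)"
  shows "(\<integral>\<^sup>+y. F (\<lambda>t\<in>triangle d. - y t) \<partial>entries d) = (\<integral>\<^sup>+y. F y \<partial>entries d)"
proof -
  have "(\<integral>\<^sup>+y. F (\<lambda>t\<in>triangle d. - y t) \<partial>entries d) = (\<integral>\<^sup>+y. F y * (\<Prod>t\<in>triangle d. 1) \<partial>entries d)"
    unfolding entries_def
  proof (rule nn_integral_PiM_transform[OF product_sigma_finite_gauss[OF d] finite_triangle])
    show "F \<in> borel_measurable (PiM (triangle d) (\<lambda>t. gauss (entry_sd d t)))"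
      using F by (simp add: entries_def)
    show "(\<integral>\<^sup>+y. f (- y) \<partial>gauss (entry_sd d t)) = (\<integral>\<^sup>+v. f v * 1 \<partial>gauss (entry_sd d t))"
      if "f \<in> borel_measurable (gauss (entry_sd d t))" for t f
      using that by (subst gauss_uminus) (simp_all cong: measurable_cong_sets)
  qed (simp_all cong: measurable_cong_sets)
  then show ?thesis by simp
qed

lemma entries_uminus_distr:
  assumes d: "1 \<le> d"
  shows "distr (entries d) (entries d) (\<lambda>y. \<lambda>t\<in>triangle d. - y t) = entries d"
proof (rule measure_eqI)
  have m: "(\<lambda>y. \<lambda>t\<in>triangle d. - y t) \<in> entries d \<rightarrow>\<^sub>M entries d"
    unfolding entries_def
    by (intro measurable_restrict) (use entries_component in \<open>auto simp: entries_def cong: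
        measurable_cong_sets\<close>)
  fix A assume "A \<in> sets (distr (entries d) (entries d) (\<lambda>y. \<lambda>t\<in>triangle d. - y t))"
  then have A [measurable]: "A \<in> sets (entries d)" by simp
  have "emeasure (distr (entries d) (entries d) (\<lambda>y. \<lambda>t\<in>triangle d. - y t)) A
      = (\<integral>\<^sup>+y. indicator A y \<partial>distr (entries d) (entries d) (\<lambda>y. \<lambda>t\<in>triangle d. - y t))"
    by simp
  also have "\<dots> = (\<integral>\<^sup>+y. indicator A (\<lambda>t\<in>triangle d. - y t) \<partial>entries d)"
    by (rule nn_integral_distr[OF m]) simp
  also have "\<dots> = emeasure (entries d) A"
    by (subst entries_uminus[OF d]) auto
  finally show "emeasure (distr (entries d) (entries d) (\<lambda>y. \<lambda>t\<in>triangle d. - y t)) A = emeasure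
      (entries d) A" .
qed simp

definition unit_norm_sq :: "nat \<Rightarrow> rmat \<Rightarrow> real" where
  "unit_norm_sq d x = (\<Sum>t\<in>triangle d. (x t / entry_sd d t)\<^sup>2)"

definition unit_inner :: "nat \<Rightarrow> rmat \<Rightarrow> rmat \<Rightarrow> real" where
  "unit_inner d x v = (\<Sum>t\<in>triangle d. (x t / entry_sd d t) * (v t / entry_sd d t))"

lemma prod_mehler:
  assumes d: "1 \<le> d" and q: "\<bar>q\<bar> < 1"
  shows "(\<Prod>t\<in>triangle d. mehler (entry_sd d t) q (x t) (v t))
    = (1 / sqrt (1 - q\<^sup>2)) ^ card (triangle d)
      * exp (- (q\<^sup>2 / (2 * (1 - q\<^sup>2))) * (unit_norm_sq d x + unit_norm_sq d v) + q / (1 - q\<^sup>2) *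
          unit_inner d x v)"
proof -
  have q2: "q\<^sup>2 < 1" using q by (simp add: abs_square_less_1)
  have e: "- (q\<^sup>2 * x\<^sup>2 + q\<^sup>2 * v\<^sup>2 - 2 * q * x * v) / (2 * s\<^sup>2 * D)
      = - (q\<^sup>2 / (2 * D)) * ((x / s)\<^sup>2 + (v / s)\<^sup>2) + q / D * ((x / s) * (v / s))"
    if "D \<noteq> 0" "s \<noteq> 0" for D s x v :: real
    using that by (simp add: field_simps power2_eq_square)
  have "mehler (entry_sd d t) q (x t) (v t) = 1 / sqrt (1 - q\<^sup>2)
    * exp (- (q\<^sup>2 / (2 * (1 - q\<^sup>2))) * ((x t / entry_sd d t)\<^sup>2 + (v t / entry_sd d t)\<^sup>2)
       + q / (1 - q\<^sup>2) * ((x t / entry_sd d t) * (v t / entry_sd d t)))" for t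
    unfolding mehler_def using q2 entry_sd_pos[OF d, of t]
    by (subst e) auto
  moreover have "(\<Prod>t\<in>triangle d. a * exp (g t)) = a ^ card (triangle d) * exp (\<Sum>t\<in>triangle d. g t)"
    for a :: real and g
    by (simp add: prod.distrib exp_sum)
  ultimately show ?thesis
    by (simp only: unit_norm_sq_def unit_inner_def sum.distrib sum_distrib_left distrib_left)
qed

definition norm_ball :: "nat \<Rightarrow> real \<Rightarrow> rmat set" where
  "norm_ball d \<kappa> = {y \<in> space (entries d). op_norm d (symm d y) \<le> \<kappa>}"

lemma norm_ball_sets [measurable]: "norm_ball d \<kappa> \<in> sets (entries d)"
  unfolding norm_ball_def by measurable

lemma symm_linear:
  "i < d \<Longrightarrow> j < d \<Longrightarrow>
    symm d (\<lambda>t\<in>triangle d. a * x t + b * y t) (i, j) = a * symm d x (i, j) + b * symm d y (i, j)"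
  by (simp add: symm_apply min_max_triangle)

lemma triangle_map_measurable:
  "(\<lambda>z. \<lambda>t\<in>triangle d. a * fst z t + b * snd z t) \<in> entries d \<Otimes>\<^sub>M entries d \<rightarrow>\<^sub>M entries d"
proof -
  have "(\<lambda>z. fst z t) \<in> borel_measurable (entries d \<Otimes>\<^sub>M entries d)"
    "(\<lambda>z. snd z t) \<in> borel_measurable (entries d \<Otimes>\<^sub>M entries d)" if "t \<in> triangle d" for t
    using that by (auto intro!: measurable_compose[OF measurable_fst entries_component]
        measurable_compose[OF measurable_snd entries_component])
  then have "(\<lambda>z. \<lambda>t\<in>triangle d. a * fst z t + b * snd z t) \<in> entries d \<Otimes>\<^sub>M entries d \<rightarrow>\<^sub>M PiM
      (triangle d) (\<lambda>t. gauss (entry_sd d t))"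
    by (intro measurable_restrict) (auto cong: measurable_cong_sets)
  then show ?thesis by (simp add: entries_def)
qed

definition single_prob :: "real \<Rightarrow> nat \<Rightarrow> real" where
  "single_prob \<kappa> d = \<P>(W in GOE d. op_norm d W \<le> \<kappa>)"

definition pair_prob :: "real \<Rightarrow> nat \<Rightarrow> real \<Rightarrow> real" where
  "pair_prob \<kappa> d q = \<P>((W, Z) in GOE d \<Otimes>\<^sub>M GOE d.
            op_norm d W \<le> \<kappa> \<and>
            op_norm d (\<lambda>ij. q * W ij + sqrt (1 - q\<^sup>2) * Z ij) \<le> \<kappa>)"

lemma single_prob_eq: "single_prob \<kappa> d = measure (entries d) (norm_ball d \<kappa>)"
proof -
  have "single_prob \<kappa> d = measure (entries d) (symm d -` {W \<in> space (mat_space d). op_norm d W \<le>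
      \<kappa>} \<inter> space (entries d))"
    unfolding single_prob_def space_GOE unfolding GOE_eq by (rule measure_distr) measurable
  also have "symm d -` {W \<in> space (mat_space d). op_norm d W \<le> \<kappa>} \<inter> space (entries d) = norm_ball d \<kappa>"
    using measurable_space[OF symm_measurable] by (auto simp: norm_ball_def)
  finally show ?thesis .
qed

lemma op_norm_lin_restrict:
  "op_norm d (\<lambda>ij\<in>{..<d} \<times> {..<d}. f ij) = op_norm d f"
  by (rule op_norm_cong) auto

lemma lin_comb_measurable:
  "(\<lambda>z. \<lambda>ij\<in>{..<d} \<times> {..<d}. a * fst z ij + b * snd z ij) \<in> mat_space d \<Otimes>\<^sub>M mat_space d \<rightarrow>\<^sub>M mat_space d"
  by (intro measurable_into_mat_space borel_measurable_add borel_measurable_times borel_measurable_const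
        measurable_compose[OF measurable_fst mat_space_entry] measurable_compose[OF measurable_snd
            mat_space_entry])

lemma op_norm_lin_measurable [measurable]:
  "(\<lambda>z. op_norm d (\<lambda>ij. a * fst z ij + b * snd z ij)) \<in> borel_measurable (mat_space d \<Otimes>\<^sub>M mat_space d)"
  using measurable_compose[OF lin_comb_measurable op_norm_measurable] by (simp add:
      op_norm_lin_restrict)

lemma sets_pair_GOE: "sets (GOE d \<Otimes>\<^sub>M GOE d) = sets (mat_space d \<Otimes>\<^sub>M mat_space d)"
  by (intro sets_pair_measure_cong sets_GOE)

lemma nn_integral_GOE_pair:
  assumes d: "1 \<le> d" and f: "f \<in> borel_measurable (mat_space d \<Otimes>\<^sub>M mat_space d)"
  shows "(\<integral>\<^sup>+z. f z \<partial>(GOE d \<Otimes>\<^sub>M GOE d)) = (\<integral>\<^sup>+x. \<integral>\<^sup>+y. f (symm d x, symm d y) \<partial>entries d \<partial>entries d)"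
proof -
  interpret G: prob_space "GOE d" by (rule prob_space_GOE[OF d])
  have f1: "f \<in> borel_measurable (GOE d \<Otimes>\<^sub>M GOE d)"
    using f by (simp add: measurable_cong_sets[OF sets_pair_GOE refl])
  have "(\<integral>\<^sup>+z. f z \<partial>(GOE d \<Otimes>\<^sub>M GOE d)) = (\<integral>\<^sup>+W. \<integral>\<^sup>+Z. f (W, Z) \<partial>GOE d \<partial>GOE d)"
    by (rule G.nn_integral_fst[symmetric, OF f1])
  also have "\<dots> = (\<integral>\<^sup>+W. \<integral>\<^sup>+y. f (W, symm d y) \<partial>entries d \<partial>GOE d)"
  proof (intro nn_integral_cong nn_integral_GOE)
    fix W assume "W \<in> space (GOE d)"
    then show "(\<lambda>Z. f (W, Z)) \<in> borel_measurable (mat_space d)"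
      using measurable_Pair2[OF f] by (simp add: space_GOE)
  qed
  also have "\<dots> = (\<integral>\<^sup>+x. \<integral>\<^sup>+y. f (symm d x, symm d y) \<partial>entries d \<partial>entries d)"
  proof (rule nn_integral_GOE)
    interpret E: prob_space "entries d" by (rule prob_space_entries[OF d])
    have "(\<lambda>z. f (fst z, symm d (snd z))) \<in> borel_measurable (mat_space d \<Otimes>\<^sub>M entries d)"
      using f by measurable
    then show "(\<lambda>W. \<integral>\<^sup>+y. f (W, symm d y) \<partial>entries d) \<in> borel_measurable (mat_space d)"
      by (intro E.borel_measurable_nn_integral) (simp add: case_prod_beta)
  qed
  finally show ?thesis .
qed

lemma pair_prob_nn_integral:
  assumes d: "1 \<le> d"
  shows "ennreal (pair_prob \<kappa> d q) = (\<integral>\<^sup>+z. indicator {z. op_norm d (fst z) \<le> \<kappa> \<and>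
            op_norm d (\<lambda>ij. q * fst z ij + sqrt (1 - q\<^sup>2) * snd z ij) \<le> \<kappa>} z \<partial>(GOE d \<Otimes>\<^sub>M GOE d))"
proof -
  interpret G: prob_space "GOE d" by (rule prob_space_GOE[OF d])
  interpret GG: pair_prob_space "GOE d" "GOE d" ..
  let ?S = "{z \<in> space (GOE d \<Otimes>\<^sub>M GOE d). op_norm d (fst z) \<le> \<kappa> \<and>
            op_norm d (\<lambda>ij. q * fst z ij + sqrt (1 - q\<^sup>2) * snd z ij) \<le> \<kappa>}"
  have S: "?S \<in> sets (GOE d \<Otimes>\<^sub>M GOE d)"
    by (measurable; simp add: measurable_cong_sets[OF sets_pair_GOE refl] op_norm_lin_measurable;
        measurable)
  have "ennreal (pair_prob \<kappa> d q) = emeasure (GOE d \<Otimes>\<^sub>M GOE d) ?S"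
    unfolding pair_prob_def GG.emeasure_eq_measure
    by (intro arg_cong[of _ _ ennreal] arg_cong[of _ _ "measure _"]) auto
  also have "\<dots> = (\<integral>\<^sup>+z. indicator ?S z \<partial>(GOE d \<Otimes>\<^sub>M GOE d))"
    using S by simp
  also have "\<dots> = (\<integral>\<^sup>+z. indicator {z. op_norm d (fst z) \<le> \<kappa> \<and>
            op_norm d (\<lambda>ij. q * fst z ij + sqrt (1 - q\<^sup>2) * snd z ij) \<le> \<kappa>} z \<partial>(GOE d \<Otimes>\<^sub>M GOE d))"
    by (intro nn_integral_cong) (auto simp: indicator_def)
  finally show ?thesis .
qed

text \<open>Conditionally on the first matrix, the second one has the Mehler density, so the
probability becomes an integral over the fixed set \<open>norm_ball \<times> norm_ball\<close> on which \<open>q\<close> only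
enters the integrand.\<close>

lemma pair_prob_mehler:
  assumes d: "1 \<le> d" and q: "\<bar>q\<bar> < 1"
  shows "pair_prob \<kappa> d q = (1 / sqrt (1 - q\<^sup>2)) ^ card (triangle d) *
    (\<integral>z. indicator (norm_ball d \<kappa> \<times> norm_ball d \<kappa>) z *
      exp (- (q\<^sup>2 / (2 * (1 - q\<^sup>2))) * (unit_norm_sq d (fst z) + unit_norm_sq d (snd z))
        + q / (1 - q\<^sup>2) * unit_inner d (fst z) (snd z)) \<partial>(entries d \<Otimes>\<^sub>M entries d))"
proof -
  interpret E: prob_space "entries d" by (rule prob_space_entries[OF d])
  let ?K = "norm_ball d \<kappa>"
  let ?S = "{z. op_norm d (fst z) \<le> \<kappa> \<and>
            op_norm d (\<lambda>ij. q * fst z ij + sqrt (1 - q\<^sup>2) * snd z ij) \<le> \<kappa>}"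
  let ?c = "(1 / sqrt (1 - q\<^sup>2)) ^ card (triangle d)"
  let ?e = "\<lambda>z. exp (- (q\<^sup>2 / (2 * (1 - q\<^sup>2))) * (unit_norm_sq d (fst z) + unit_norm_sq d (snd z))
        + q / (1 - q\<^sup>2) * unit_inner d (fst z) (snd z))"
  have q2: "q\<^sup>2 < 1" using q by (simp add: abs_square_less_1)
  have c0: "0 \<le> ?c" using q2 by simp
  have [measurable]: "(\<lambda>z. fst z t) \<in> borel_measurable (entries d \<Otimes>\<^sub>M entries d)"
    "(\<lambda>z. snd z t) \<in> borel_measurable (entries d \<Otimes>\<^sub>M entries d)" if "t \<in> triangle d" for t
    using that by (auto intro!: measurable_compose[OF measurable_fst entries_component]
        measurable_compose[OF measurable_snd entries_component])
  have me [measurable]: "?e \<in> borel_measurable (entries d \<Otimes>\<^sub>M entries d)"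
    unfolding unit_norm_sq_def unit_inner_def by measurable
  have mS: "(\<lambda>z. indicator ?S z :: ennreal) \<in> borel_measurable (mat_space d \<Otimes>\<^sub>M mat_space d)"
    unfolding indicator_def by measurable
  have "ennreal (pair_prob \<kappa> d q) = (\<integral>\<^sup>+x. \<integral>\<^sup>+y. indicator ?S (symm d x, symm d y) \<partial>entries d \<partial>entries d)"
    unfolding pair_prob_nn_integral[OF d] by (rule nn_integral_GOE_pair[OF d mS])
  also have "\<dots> = (\<integral>\<^sup>+x. \<integral>\<^sup>+y. indicator ?K x * indicator ?K (\<lambda>t\<in>triangle d. q * x t + sqrt (1 - q\<^sup>2)
      * y t) \<partial>entries d \<partial>entries d)"
  proof (intro nn_integral_cong)
    fix x y assume x: "x \<in> space (entries d)" and y: "y \<in> space (entries d)"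
    have "op_norm d (\<lambda>ij. q * symm d x ij + sqrt (1 - q\<^sup>2) * symm d y ij)
        = op_norm d (symm d (\<lambda>t\<in>triangle d. q * x t + sqrt (1 - q\<^sup>2) * y t))"
      by (rule op_norm_cong) (simp add: symm_linear)
    moreover have "(\<lambda>t\<in>triangle d. q * x t + sqrt (1 - q\<^sup>2) * y t) \<in> space (entries d)"
      by (auto simp: space_entries)
    ultimately show "indicator ?S (symm d x, symm d y)
        = (indicator ?K x * indicator ?K (\<lambda>t\<in>triangle d. q * x t + sqrt (1 - q\<^sup>2) * y t) :: ennreal)"
      using x by (simp add: indicator_def norm_ball_def)
  qed
  also have "\<dots> = (\<integral>\<^sup>+x. \<integral>\<^sup>+v. indicator ?K x * indicator ?K v * ennreal (?c * ?e (x, v)) \<partial>entries d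
      \<partial>entries d)"
  proof (rule nn_integral_cong)
    fix x
    have "(\<integral>\<^sup>+y. indicator ?K x * indicator ?K (\<lambda>t\<in>triangle d. q * x t + sqrt (1 - q\<^sup>2) * y t) \<partial>entries d)
      = (\<integral>\<^sup>+v. (indicator ?K x * indicator ?K v) * ennreal (\<Prod>t\<in>triangle d. mehler (entry_sd d t) q
          (x t) (v t)) \<partial>entries d)"
      by (rule entries_mehler[OF d q]) measurable
    then show "(\<integral>\<^sup>+y. indicator ?K x * indicator ?K (\<lambda>t\<in>triangle d. q * x t + sqrt (1 - q\<^sup>2) * y t)
        \<partial>entries d)
      = (\<integral>\<^sup>+v. indicator ?K x * indicator ?K v * ennreal (?c * ?e (x, v)) \<partial>entries d)"
      unfolding prod_mehler[OF d q] by simp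
  qed
  also have "\<dots> = (\<integral>\<^sup>+x. \<integral>\<^sup>+v. ennreal (?c * (indicator (?K \<times> ?K) (x, v) * ?e (x, v))) \<partial>entries d
      \<partial>entries d)"
    by (intro nn_integral_cong) (auto simp: indicator_def)
  also have "\<dots> = (\<integral>\<^sup>+z. ennreal (?c * (indicator (?K \<times> ?K) z * ?e z)) \<partial>(entries d \<Otimes>\<^sub>M entries d))"
    by (rule E.nn_integral_fst) measurable
  finally have eq: "ennreal (pair_prob \<kappa> d q) = (\<integral>\<^sup>+z. ennreal (?c * (indicator (?K \<times> ?K) z * ?e
      z)) \<partial>(entries d \<Otimes>\<^sub>M entries d))" .
  have "(\<integral>z. ?c * (indicator (?K \<times> ?K) z * ?e z) \<partial>(entries d \<Otimes>\<^sub>M entries d)) = pair_prob \<kappa> d q"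
  proof (rule integral_eq_nn_integral[THEN trans])
    show "AE z in entries d \<Otimes>\<^sub>M entries d. 0 \<le> ?c * (indicator (?K \<times> ?K) z * ?e z)"
      using c0 by (intro AE_I2 mult_nonneg_nonneg) auto
    show "enn2real (\<integral>\<^sup>+z. ennreal (?c * (indicator (?K \<times> ?K) z * ?e z)) \<partial>(entries d \<Otimes>\<^sub>M entries d))
        = pair_prob \<kappa> d q"
      unfolding eq[symmetric] by (simp add: pair_prob_def)
  qed measurable
  then show ?thesis by simp
qed

lemma G_eq: "G \<kappa> d n q = 1 / real n * ln (pair_prob \<kappa> d q / (single_prob \<kappa> d)\<^sup>2)"
  by (simp add: G_def pair_prob_def single_prob_def)

section \<open>Differentiation under the integral\<close>

text \<open>By the mean value theorem the bound on the derivative dominates the difference quotients.\<close>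

lemma has_real_derivative_integral:
  fixes f f' :: "real \<Rightarrow> 'a \<Rightarrow> real"
  assumes M: "finite_measure M" and q: "q \<in> {a<..<b}"
    and meas: "\<And>q. f q \<in> borel_measurable M" "f' q \<in> borel_measurable M"
    and deriv: "\<And>q \<omega>. q \<in> {a<..<b} \<Longrightarrow> ((\<lambda>q. f q \<omega>) has_real_derivative f' q \<omega>) (at q)"
    and bd: "\<And>q \<omega>. q \<in> {a<..<b} \<Longrightarrow> \<bar>f q \<omega>\<bar> \<le> C" "\<And>q \<omega>. q \<in> {a<..<b} \<Longrightarrow> \<bar>f' q \<omega>\<bar> \<le> C"
  shows "((\<lambda>q. \<integral>\<omega>. f q \<omega> \<partial>M) has_real_derivative (\<integral>\<omega>. f' q \<omega> \<partial>M)) (at q)"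
proof -
  interpret finite_measure M by (rule M)
  let ?S = "{a<..<b}"
  have int: "integrable M (f p)" if "p \<in> ?S" for p
    using bd(1)[OF that] meas by (intro integrable_const_bound[of _ C]) auto
  have quot: "\<bar>(f p \<omega> - f q \<omega>) / (p - q)\<bar> \<le> C" if p: "p \<in> ?S" "p \<noteq> q" for p \<omega>
  proof -
    have "norm (f p \<omega> - f q \<omega>) \<le> C * norm (p - q)"
    proof (rule field_differentiable_bound[of ?S "\<lambda>q. f q \<omega>" "\<lambda>q. f' q \<omega>"])
      show "((\<lambda>q. f q \<omega>) has_field_derivative f' z \<omega>) (at z within ?S)" if "z \<in> ?S" for z
        using deriv[OF that] by (rule has_field_derivative_at_within)
      show "norm (f' z \<omega>) \<le> C" if "z \<in> ?S" for z
        using bd(2)[OF that] by simp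
    qed (use p q in \<open>auto simp: convex_real_interval\<close>)
    then show ?thesis
      using p by (simp add: field_simps)
  qed
  show ?thesis
    unfolding has_field_derivative_iff tendsto_at_iff_sequentially
  proof (intro allI impI)
    fix X assume X: "\<forall>i. X i \<in> UNIV - {q}" "X \<longlonglongrightarrow> q"
    have "\<forall>\<^sub>F i in sequentially. X i \<in> ?S"
      by (rule topological_tendstoD[OF X(2) open_greaterThanLessThan q])
    then obtain N where N: "\<And>i. X (i + N) \<in> ?S"
      by (auto simp: eventually_sequentially) (metis le_add2)
    have ne: "X (i + N) \<noteq> q" for i using X(1) by auto
    have XN: "(\<lambda>i. X (i + N)) \<longlonglongrightarrow> q"
      using X(2) by (rule LIMSEQ_ignore_initial_segment)
    have "(\<lambda>i. \<integral>\<omega>. (f (X (i + N)) \<omega> - f q \<omega>) / (X (i + N) - q) \<partial>M) \<longlonglongrightarrow> (\<integral>\<omega>. f' q \<omega> \<partial>M)"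
    proof (rule integral_dominated_convergence[where w = "\<lambda>_. C"])
      show "AE \<omega> in M. (\<lambda>i. (f (X (i + N)) \<omega> - f q \<omega>) / (X (i + N) - q)) \<longlonglongrightarrow> f' q \<omega>"
      proof (rule AE_I2)
        fix \<omega>
        have "((\<lambda>y. (f y \<omega> - f q \<omega>) / (y - q)) \<longlongrightarrow> f' q \<omega>) (at q)"
          using deriv[OF q, of \<omega>] by (simp add: has_field_derivative_iff)
        moreover have "filterlim (\<lambda>i. X (i + N)) (at q) sequentially"
          using XN ne by (simp add: filterlim_at)
        ultimately show "(\<lambda>i. (f (X (i + N)) \<omega> - f q \<omega>) / (X (i + N) - q)) \<longlonglongrightarrow> f' q \<omega>"
          by (rule filterlim_compose)
      qed
      show "AE \<omega> in M. norm ((f (X (i + N)) \<omega> - f q \<omega>) / (X (i + N) - q)) \<le> C" for i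
        using quot[OF N ne] by simp
    qed (use meas in auto)
    moreover have "(\<integral>\<omega>. (f (X (i + N)) \<omega> - f q \<omega>) / (X (i + N) - q) \<partial>M)
        = ((\<integral>\<omega>. f (X (i + N)) \<omega> \<partial>M) - (\<integral>\<omega>. f q \<omega> \<partial>M)) / (X (i + N) - q)" for i
      using int[OF N] int[OF q] by simp
    ultimately have "(\<lambda>i. ((\<integral>\<omega>. f (X (i + N)) \<omega> \<partial>M) - (\<integral>\<omega>. f q \<omega> \<partial>M)) / (X (i + N) - q)) \<longlonglongrightarrow> (\<integral>\<omega>. f'
        q \<omega> \<partial>M)"
      by (simp only:)
    then show "((\<lambda>y. ((\<integral>\<omega>. f y \<omega> \<partial>M) - (\<integral>\<omega>. f q \<omega> \<partial>M)) / (y - q)) \<circ> X) \<longlonglongrightarrow> (\<integral>\<omega>. f' q \<omega> \<partial>M)"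
      unfolding comp_def by (rule LIMSEQ_offset)
  qed
qed

text \<open>The logarithm of the Mehler kernel is, apart from the normalisation, this coefficient
times \<open>|x|^2 + |v|^2\<close> plus the coefficient \<open>inner_coeff\<close> times \<open><x, v>\<close>. The suffixes \<open>1\<close> and
\<open>2\<close> denote the first two derivatives with respect to \<open>q\<close>.\<close>

definition norm_coeff :: "real \<Rightarrow> real" where "norm_coeff q = - (q\<^sup>2 / (2 * (1 - q\<^sup>2)))"
definition norm_coeff1 :: "real \<Rightarrow> real" where "norm_coeff1 q = - q / (1 - q\<^sup>2)\<^sup>2"
definition norm_coeff2 :: "real \<Rightarrow> real" where "norm_coeff2 q = - (1 + 3 * q\<^sup>2) / (1 - q\<^sup>2) ^ 3"
definition inner_coeff :: "real \<Rightarrow> real" where "inner_coeff q = q / (1 - q\<^sup>2)"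
definition inner_coeff1 :: "real \<Rightarrow> real" where "inner_coeff1 q = (1 + q\<^sup>2) / (1 - q\<^sup>2)\<^sup>2"
definition inner_coeff2 :: "real \<Rightarrow> real" where "inner_coeff2 q = 2 * q * (3 + q\<^sup>2) / (1 - q\<^sup>2) ^ 3"

lemma mehler_coeff_deriv:
  assumes "\<bar>q\<bar> < 1"
  shows "(norm_coeff has_real_derivative norm_coeff1 q) (at q)" "(norm_coeff1 has_real_derivative
      norm_coeff2 q) (at q)"
    "(inner_coeff has_real_derivative inner_coeff1 q) (at q)" "(inner_coeff1 has_real_derivative
        inner_coeff2 q) (at q)"
proof -
  have "q\<^sup>2 < 1" using assms by (simp add: abs_square_less_1)
  then have ne: "1 - q\<^sup>2 \<noteq> 0" by simp
  show "(norm_coeff has_real_derivative norm_coeff1 q) (at q)"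
    unfolding norm_coeff_def[abs_def] norm_coeff1_def
    by (rule derivative_eq_intros refl | (use ne in simp; fail))+
      (use ne in \<open>simp add: divide_simps power2_eq_square, algebra?\<close>)
  show "(inner_coeff has_real_derivative inner_coeff1 q) (at q)"
    unfolding inner_coeff_def[abs_def] inner_coeff1_def
    by (rule derivative_eq_intros refl | (use ne in simp; fail))+
      (use ne in \<open>simp add: field_simps power2_eq_square\<close>)
  show "(norm_coeff1 has_real_derivative norm_coeff2 q) (at q)"
    unfolding norm_coeff1_def[abs_def] norm_coeff2_def
    by (rule derivative_eq_intros refl | (use ne in simp; fail))+
      (use ne in \<open>simp add: divide_simps power2_eq_square power3_eq_cube, algebra?\<close>)
  show "(inner_coeff1 has_real_derivative inner_coeff2 q) (at q)"
    unfolding inner_coeff1_def[abs_def] inner_coeff2_def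
    by (rule derivative_eq_intros refl | (use ne in simp; fail))+
      (use ne in \<open>simp add: divide_simps power2_eq_square power3_eq_cube, algebra?\<close>)
qed

text \<open>Only the existence of a common bound matters.\<close>

lemma mehler_coeff_bounds:
  assumes "q \<in> {-(1/2)<..<1/2}"
  shows "\<bar>norm_coeff q\<bar> \<le> 8" "\<bar>norm_coeff1 q\<bar> \<le> 8" "\<bar>norm_coeff2 q\<bar> \<le> 8" "\<bar>inner_coeff q\<bar> \<le> 8"
      "\<bar>inner_coeff1 q\<bar> \<le> 8" "\<bar>inner_coeff2 q\<bar> \<le> 8"
proof -
  have q: "\<bar>q\<bar> \<le> 1/2" using assms by auto
  then have "\<bar>q\<bar>\<^sup>2 \<le> (1/2)\<^sup>2" by (intro power_mono) auto
  then have q2: "q\<^sup>2 \<le> 1/4" by (simp add: power2_eq_square)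
  have D: "3/4 \<le> 1 - q\<^sup>2" using q2 by simp
  have D2: "(3/4)^2 \<le> (1 - q\<^sup>2)^2" "(3/4)^3 \<le> (1 - q\<^sup>2)^3"
    using D by (intro power_mono; simp)+
  have frac: "\<bar>x / y\<bar> \<le> 8" if "\<bar>x\<bar> \<le> 8 * c" "c \<le> y" "0 < c" for x y c :: real
  proof -
    have "\<bar>x\<bar> \<le> 8 * y" using that by linarith
    then show ?thesis using that by (simp add: abs_divide pos_divide_le_eq)
  qed
  show "\<bar>norm_coeff q\<bar> \<le> 8"
    unfolding norm_coeff_def abs_minus_cancel using q2 D by (intro frac[of _ "3/2"]) auto
  show "\<bar>inner_coeff q\<bar> \<le> 8"
    unfolding inner_coeff_def using q D by (intro frac[of _ "3/4"]) auto
  show "\<bar>norm_coeff1 q\<bar> \<le> 8"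
    unfolding norm_coeff1_def using q D2 by (intro frac[of _ "(3/4)^2"]) (auto simp: power2_eq_square)
  show "\<bar>inner_coeff1 q\<bar> \<le> 8"
    unfolding inner_coeff1_def using q2 D2 by (intro frac[of _ "(3/4)^2"]) (auto simp: power_divide)
  show "\<bar>norm_coeff2 q\<bar> \<le> 8"
    unfolding norm_coeff2_def
  proof (rule frac[OF _ D2(2)])
    show "\<bar>- (1 + 3 * q\<^sup>2)\<bar> \<le> 8 * (3 / 4) ^ 3"
      unfolding abs_minus_cancel using q2 by (simp add: power3_eq_cube)
  qed simp
  have "\<bar>2 * q * (3 + q\<^sup>2)\<bar> \<le> 1 * (13/4)"
    unfolding abs_mult[of _ "3 + q\<^sup>2"] using q q2 by (intro mult_mono) auto
  then show "\<bar>inner_coeff2 q\<bar> \<le> 8"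
    unfolding inner_coeff2_def using D2 by (intro frac[of _ "(3/4)^3"]) (auto simp: power_divide)
qed

lemma exp_integral_derivatives:
  fixes \<alpha> \<beta> :: "'a \<Rightarrow> real"
  assumes M: "finite_measure M" and [measurable]: "\<alpha> \<in> borel_measurable M" "\<beta> \<in> borel_measurable
      M" "K \<in> sets M"
    and R: "0 \<le> R" "\<And>\<omega>. \<omega> \<in> K \<Longrightarrow> \<bar>\<alpha> \<omega>\<bar> \<le> R" "\<And>\<omega>. \<omega> \<in> K \<Longrightarrow> \<bar>\<beta> \<omega>\<bar> \<le> R"
    and q: "q \<in> {-(1/2)<..<1/2}"
  shows "((\<lambda>q. \<integral>\<omega>. indicator K \<omega> * exp (norm_coeff q * \<alpha> \<omega> + inner_coeff q * \<beta> \<omega>) \<partial>M)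
      has_real_derivative
       (\<integral>\<omega>. indicator K \<omega> * ((norm_coeff1 q * \<alpha> \<omega> + inner_coeff1 q * \<beta> \<omega>) * exp (norm_coeff q * \<alpha>
           \<omega> + inner_coeff q * \<beta> \<omega>)) \<partial>M)) (at q)"
    and "((\<lambda>q. \<integral>\<omega>. indicator K \<omega> * ((norm_coeff1 q * \<alpha> \<omega> + inner_coeff1 q * \<beta> \<omega>) * exp (norm_coeff
        q * \<alpha> \<omega> + inner_coeff q * \<beta> \<omega>)) \<partial>M) has_real_derivative
       (\<integral>\<omega>. indicator K \<omega> * ((norm_coeff2 q * \<alpha> \<omega> + inner_coeff2 q * \<beta> \<omega> + (norm_coeff1 q * \<alpha> \<omega> +
           inner_coeff1 q * \<beta> \<omega>)\<^sup>2) * exp (norm_coeff q * \<alpha> \<omega> + inner_coeff q * \<beta> \<omega>)) \<partial>M)) (at q)"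
proof -
  let ?S = "{-(1/2)<..<1/2::real}"
  have lin: "\<bar>a * \<alpha> \<omega> + b * \<beta> \<omega>\<bar> \<le> 16 * R" if "\<bar>a\<bar> \<le> 8" "\<bar>b\<bar> \<le> 8" "\<omega> \<in> K" for a b \<omega>
  proof -
    have "\<bar>a\<bar> * \<bar>\<alpha> \<omega>\<bar> \<le> 8 * R" "\<bar>b\<bar> * \<bar>\<beta> \<omega>\<bar> \<le> 8 * R"
      using that R by (auto intro!: mult_mono)
    then show ?thesis
      using abs_triangle_ineq[of "a * \<alpha> \<omega>" "b * \<beta> \<omega>"] by (simp add: abs_mult)
  qed
  let ?E = "exp (16 * R)"
  have ex: "exp (norm_coeff p * \<alpha> \<omega> + inner_coeff p * \<beta> \<omega>) \<le> ?E" if "p \<in> ?S" "\<omega> \<in> K" for p \<omega>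
    using lin[OF mehler_coeff_bounds(1,4)[OF that(1)] that(2)] by simp
  let ?C = "(1 + 16 * R + (16 * R)\<^sup>2) * ?E"
  have C: "\<bar>indicator K \<omega> * (x * exp (norm_coeff p * \<alpha> \<omega> + inner_coeff p * \<beta> \<omega>))\<bar> \<le> ?C"
    if "p \<in> ?S" "\<omega> \<in> K \<Longrightarrow> \<bar>x\<bar> \<le> 1 + 16 * R + (16 * R)\<^sup>2" for x p \<omega>
  proof (cases "\<omega> \<in> K")
    case True
    have "\<bar>x\<bar> * exp (norm_coeff p * \<alpha> \<omega> + inner_coeff p * \<beta> \<omega>) \<le> ?C"
      using R(1) by (intro mult_mono that ex True) auto
    then show ?thesis using True by (simp add: abs_mult)
  next
    case False
    then show ?thesis using R(1) by simp
  qed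
  have c1: "\<bar>1\<bar> \<le> 1 + 16 * R + (16 * R)\<^sup>2" using R(1) by simp
  have c2: "\<bar>norm_coeff1 p * \<alpha> \<omega> + inner_coeff1 p * \<beta> \<omega>\<bar> \<le> 1 + 16 * R + (16 * R)\<^sup>2" if "p \<in> ?S" "\<omega>
      \<in> K" for p \<omega>
  proof -
    have "\<bar>norm_coeff1 p * \<alpha> \<omega> + inner_coeff1 p * \<beta> \<omega>\<bar> \<le> 16 * R"
      using mehler_coeff_bounds[OF that(1)] that(2) by (intro lin)
    also have "\<dots> \<le> 1 + 16 * R + (16 * R)\<^sup>2" by simp
    finally show ?thesis .
  qed
  have c3: "\<bar>norm_coeff2 p * \<alpha> \<omega> + inner_coeff2 p * \<beta> \<omega> + (norm_coeff1 p * \<alpha> \<omega> + inner_coeff1 p *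
      \<beta> \<omega>)\<^sup>2\<bar> \<le> 1 + 16 * R + (16 * R)\<^sup>2"
    if "p \<in> ?S" "\<omega> \<in> K" for p \<omega>
  proof -
    have "\<bar>norm_coeff1 p * \<alpha> \<omega> + inner_coeff1 p * \<beta> \<omega>\<bar> \<le> 16 * R" "\<bar>norm_coeff2 p * \<alpha> \<omega> +
        inner_coeff2 p * \<beta> \<omega>\<bar> \<le> 16 * R"
      using mehler_coeff_bounds[OF that(1)] that(2) by (intro lin; simp)+
    moreover from this(1) have "\<bar>norm_coeff1 p * \<alpha> \<omega> + inner_coeff1 p * \<beta> \<omega>\<bar>\<^sup>2 \<le> (16 * R)\<^sup>2"
      by (intro power_mono) auto
    ultimately show ?thesis by (simp add: abs_le_iff) (smt (verit) zero_le_power2)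
  qed
  have p1: "\<bar>p\<bar> < 1" if "p \<in> ?S" for p using that by auto
  have dE: "((\<lambda>p. exp (norm_coeff p * \<alpha> \<omega> + inner_coeff p * \<beta> \<omega>)) has_real_derivative
      (norm_coeff1 p * \<alpha> \<omega> + inner_coeff1 p * \<beta> \<omega>) * exp (norm_coeff p * \<alpha> \<omega> + inner_coeff p * \<beta>
          \<omega>)) (at p)" if "p \<in> ?S" for p \<omega>
    by (rule derivative_eq_intros mehler_coeff_deriv[OF p1[OF that]] refl)+ simp
  show "((\<lambda>q. \<integral>\<omega>. indicator K \<omega> * exp (norm_coeff q * \<alpha> \<omega> + inner_coeff q * \<beta> \<omega>) \<partial>M) has_real_derivative
       (\<integral>\<omega>. indicator K \<omega> * ((norm_coeff1 q * \<alpha> \<omega> + inner_coeff1 q * \<beta> \<omega>) * exp (norm_coeff q * \<alpha>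
           \<omega> + inner_coeff q * \<beta> \<omega>)) \<partial>M)) (at q)"
  proof (rule has_real_derivative_integral[OF M q, where C = ?C])
    show "((\<lambda>q. indicator K \<omega> * exp (norm_coeff q * \<alpha> \<omega> + inner_coeff q * \<beta> \<omega>)) has_real_derivative
       indicator K \<omega> * ((norm_coeff1 p * \<alpha> \<omega> + inner_coeff1 p * \<beta> \<omega>) * exp (norm_coeff p * \<alpha> \<omega> +
           inner_coeff p * \<beta> \<omega>))) (at p)"
      if "p \<in> ?S" for p \<omega>
      by (rule DERIV_cmult[OF dE[OF that]])
    show "\<bar>indicator K \<omega> * exp (norm_coeff p * \<alpha> \<omega> + inner_coeff p * \<beta> \<omega>)\<bar> \<le> ?C" if "p \<in> ?S" for p \<omega>
      using C[OF that c1, of \<omega>] by simp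
    show "\<bar>indicator K \<omega> * ((norm_coeff1 p * \<alpha> \<omega> + inner_coeff1 p * \<beta> \<omega>) * exp (norm_coeff p * \<alpha> \<omega>
        + inner_coeff p * \<beta> \<omega>))\<bar> \<le> ?C"
      if "p \<in> ?S" for p \<omega>
      by (rule C[OF that c2[OF that]])
  qed measurable
  show "((\<lambda>q. \<integral>\<omega>. indicator K \<omega> * ((norm_coeff1 q * \<alpha> \<omega> + inner_coeff1 q * \<beta> \<omega>) * exp (norm_coeff
      q * \<alpha> \<omega> + inner_coeff q * \<beta> \<omega>)) \<partial>M) has_real_derivative
       (\<integral>\<omega>. indicator K \<omega> * ((norm_coeff2 q * \<alpha> \<omega> + inner_coeff2 q * \<beta> \<omega> + (norm_coeff1 q * \<alpha> \<omega> +
           inner_coeff1 q * \<beta> \<omega>)\<^sup>2) * exp (norm_coeff q * \<alpha> \<omega> + inner_coeff q * \<beta> \<omega>)) \<partial>M)) (at q)"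
  proof (rule has_real_derivative_integral[OF M q, where C = ?C])
    show "((\<lambda>q. indicator K \<omega> * ((norm_coeff1 q * \<alpha> \<omega> + inner_coeff1 q * \<beta> \<omega>) * exp (norm_coeff q
        * \<alpha> \<omega> + inner_coeff q * \<beta> \<omega>))) has_real_derivative
       indicator K \<omega> * ((norm_coeff2 p * \<alpha> \<omega> + inner_coeff2 p * \<beta> \<omega> + (norm_coeff1 p * \<alpha> \<omega> +
           inner_coeff1 p * \<beta> \<omega>)\<^sup>2) * exp (norm_coeff p * \<alpha> \<omega> + inner_coeff p * \<beta> \<omega>))) (at p)"
      if "p \<in> ?S" for p \<omega>
    proof (rule DERIV_cmult)
      show "((\<lambda>q. (norm_coeff1 q * \<alpha> \<omega> + inner_coeff1 q * \<beta> \<omega>) * exp (norm_coeff q * \<alpha> \<omega> +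
          inner_coeff q * \<beta> \<omega>)) has_real_derivative
       (norm_coeff2 p * \<alpha> \<omega> + inner_coeff2 p * \<beta> \<omega> + (norm_coeff1 p * \<alpha> \<omega> + inner_coeff1 p * \<beta>
           \<omega>)\<^sup>2) * exp (norm_coeff p * \<alpha> \<omega> + inner_coeff p * \<beta> \<omega>)) (at p)"
        by (rule derivative_eq_intros mehler_coeff_deriv[OF p1[OF that]] dE[OF that] refl)+
          (simp add: algebra_simps power2_eq_square)
    qed
    show "\<bar>indicator K \<omega> * ((norm_coeff1 p * \<alpha> \<omega> + inner_coeff1 p * \<beta> \<omega>) * exp (norm_coeff p * \<alpha> \<omega>
        + inner_coeff p * \<beta> \<omega>))\<bar> \<le> ?C"
      if "p \<in> ?S" for p \<omega>
      by (rule C[OF that c2[OF that]])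
    show "\<bar>indicator K \<omega> * ((norm_coeff2 p * \<alpha> \<omega> + inner_coeff2 p * \<beta> \<omega> + (norm_coeff1 p * \<alpha> \<omega> +
        inner_coeff1 p * \<beta> \<omega>)\<^sup>2) * exp (norm_coeff p * \<alpha> \<omega> + inner_coeff p * \<beta> \<omega>))\<bar> \<le> ?C"
      if "p \<in> ?S" for p \<omega>
      by (rule C[OF that c3[OF that]])
  qed measurable
qed

lemma card_triangle: "real (card (triangle d)) = real d * (real d + 1) / 2"
proof -
  have e: "triangle d = (\<Union>j\<in>{..<d}. (\<lambda>i. (i, j)) ` {..j})"
    by (auto simp: triangle_def)
  have "card (triangle d) = (\<Sum>j<d. card ((\<lambda>i. (i, j)) ` {..j}))"
    unfolding e by (rule card_UN_disjoint) auto
  also have "\<dots> = (\<Sum>j<d. Suc j)"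
    by (intro sum.cong refl) (simp add: card_image inj_on_def)
  finally have "real (card (triangle d)) = (\<Sum>j<d. real (Suc j))" by simp
  also have "\<dots> = real d * (real d + 1) / 2"
    by (induction d) (auto simp: field_simps)
  finally show ?thesis .
qed

text \<open>Off-diagonal entries count twice in \<open>tr A^2\<close> and have half the variance of the diagonal
ones.\<close>

lemma unit_norm_sq_eq:
  assumes d: "1 \<le> d"
  shows "unit_norm_sq d x = d / 2 * pow_trace d (symm d x) 2"
proof -
  let ?g = "\<lambda>t. (x t)\<^sup>2"
  let ?h = "\<lambda>(i, j). ?g (min i j, max i j)"
  let ?L = "{(i, j). j < i \<and> i < d}"
  have fL: "finite ?L" by (rule finite_subset[of _ "{..<d} \<times> {..<d}"]) auto
  have P1: "mat_pow d A 1 (a, b) = A (a, b)" if "b < d" for a b A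
    using that by (simp add: mat_mul_def if_distrib[of "\<lambda>x. _ * x"] cong: if_cong)
  have "pow_trace d (symm d x) (2 * 1) = (\<Sum>i<d. \<Sum>j<d. ?h (i, j))"
    unfolding pow_trace_even[OF sym_mat_symm]
    by (intro sum.cong refl) (simp only: lessThan_iff P1 symm_apply prod.case)
  also have "\<dots> = sum ?h ({..<d} \<times> {..<d})"
    by (simp add: sum.cartesian_product)
  also have "{..<d} \<times> {..<d} = triangle d \<union> ?L"
    by (auto simp: triangle_def)
  also have "sum ?h (triangle d \<union> ?L) = sum ?h (triangle d) + sum ?h ?L"
    by (rule sum.union_disjoint[OF finite_triangle fL]) (auto simp: triangle_def)
  also have "sum ?h (triangle d) = sum ?g (triangle d)"
    by (intro sum.cong) (auto simp: triangle_def min_def max_def)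
  also have "sum ?h ?L = sum ?g {t \<in> triangle d. fst t \<noteq> snd t}"
    by (rule sum.reindex_bij_witness[of _ prod.swap prod.swap]) (auto simp: triangle_def min_def
        max_def)
  also have "\<dots> = (\<Sum>t\<in>triangle d. if fst t \<noteq> snd t then ?g t else 0)"
    by (simp add: sum.inter_filter)
  also have "sum ?g (triangle d) + \<dots> = (\<Sum>t\<in>triangle d. ?g t + (if fst t \<noteq> snd t then ?g t else 0))"
    by (simp add: sum.distrib)
  finally have "d / 2 * pow_trace d (symm d x) 2 = (\<Sum>t\<in>triangle d. d / 2 * (?g t + (if fst t \<noteq> snd
      t then ?g t else 0)))"
    by (simp add: sum_distrib_left)
  also have "\<dots> = unit_norm_sq d x"
    unfolding unit_norm_sq_def
    by (intro sum.cong refl) (use d in \<open>auto simp: entry_sd_def power_divide field_simps split: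
        prod.split\<close>)
  finally show ?thesis ..
qed

lemma unit_norm_sq_nonneg: "0 \<le> unit_norm_sq d x"
  by (simp add: unit_norm_sq_def sum_nonneg)

lemma unit_norm_sq_le:
  assumes d: "1 \<le> d" and x: "x \<in> norm_ball d \<kappa>"
  shows "unit_norm_sq d x \<le> (real d)\<^sup>2 * \<kappa>\<^sup>2 / 2"
proof -
  have o: "0 \<le> op_norm d (symm d x)" "op_norm d (symm d x) \<le> \<kappa>"
    using x by (auto simp: norm_ball_def op_norm_nonneg)
  have "pow_trace d (symm d x) 2 \<le> d * op_norm d (symm d x) ^ 2"
    using abs_pow_trace_le[of d "symm d x" 2] by simp
  also have "\<dots> \<le> d * \<kappa>\<^sup>2"
    using o by (intro mult_left_mono power_mono) auto
  finally have "d / 2 * pow_trace d (symm d x) 2 \<le> d / 2 * (d * \<kappa>\<^sup>2)"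
    by (intro mult_left_mono) auto
  then show ?thesis
    unfolding unit_norm_sq_eq[OF d] by (simp add: power2_eq_square)
qed

lemma abs_unit_inner_le: "\<bar>unit_inner d x v\<bar> \<le> (unit_norm_sq d x + unit_norm_sq d v) / 2"
proof -
  have ab: "\<bar>a * b\<bar> \<le> (a\<^sup>2 + b\<^sup>2) / 2" for a b :: real
    using sum_squares_bound[of "\<bar>a\<bar>" "\<bar>b\<bar>"] by (simp add: abs_mult)
  have "\<bar>unit_inner d x v\<bar> \<le> (\<Sum>t\<in>triangle d. ((x t / entry_sd d t)\<^sup>2 + (v t / entry_sd d t)\<^sup>2) / 2)"
    unfolding unit_inner_def by (rule order_trans[OF sum_abs sum_mono]) (rule ab)
  also have "\<dots> = (unit_norm_sq d x + unit_norm_sq d v) / 2"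
    by (simp add: unit_norm_sq_def sum.distrib sum_divide_distrib[symmetric])
  finally show ?thesis .
qed

section \<open>The curvature of the pair exponent at zero\<close>

lemma gauss_interval_pos:
  assumes s: "0 < s" and a: "0 < a"
  shows "0 < emeasure (gauss s) {-a..a}"
proof -
  have "0 < ennreal (normal_density 0 s a) * ennreal (2 * a)"
    using assms by (simp add: ennreal_zero_less_mult_iff normal_density_pos)
  also have "\<dots> = (\<integral>\<^sup>+x. ennreal (normal_density 0 s a) * indicator {-a..a} x \<partial>lborel)"
    using a by (simp add: nn_integral_cmult)
  also have "\<dots> \<le> (\<integral>\<^sup>+x. ennreal (normal_density 0 s x) * indicator {-a..a} x \<partial>lborel)"
  proof (intro nn_integral_mono)
    fix x
    have "normal_density 0 s a \<le> normal_density 0 s x" if "\<bar>x\<bar> \<le> a"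
    proof -
      have "x\<^sup>2 \<le> a\<^sup>2" using that a by (metis abs_le_square_iff abs_of_pos)
      then show ?thesis
        unfolding normal_density_def using s by (intro mult_left_mono) (auto simp: divide_right_mono)
    qed
    then show "ennreal (normal_density 0 s a) * indicator {-a..a} x \<le> ennreal (normal_density 0 s
        x) * indicator {-a..a} x"
      by (auto simp: indicator_def abs_le_iff intro!: ennreal_leI)
  qed
  also have "\<dots> = emeasure (gauss s) {-a..a}"
    unfolding gauss_def by (subst emeasure_density) auto
  finally show ?thesis .
qed

lemma prod_ennreal_pos:
  fixes f :: "'i \<Rightarrow> ennreal"
  assumes "finite T" "\<And>t. t \<in> T \<Longrightarrow> 0 < f t"
  shows "0 < (\<Prod>t\<in>T. f t)"
  using assms by (induction T) (auto simp: ennreal_zero_less_mult_iff)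

text \<open>The ball contains the cube of all matrices with entries of modulus at most \<open>\<kappa> / d\<close>.\<close>

lemma single_prob_pos:
  assumes d: "1 \<le> d" and \<kappa>: "0 < \<kappa>"
  shows "0 < single_prob \<kappa> d"
proof -
  interpret P: product_prob_space "\<lambda>t. gauss (entry_sd d t)"
    by (rule product_prob_space_gauss[OF d])
  interpret E: prob_space "entries d" by (rule prob_space_entries[OF d])
  let ?a = "\<kappa> / d"
  let ?B = "PiE (triangle d) (\<lambda>_. {- ?a..?a})"
  have a: "0 < ?a" using d \<kappa> by simp
  have "0 < (\<Prod>t\<in>triangle d. emeasure (gauss (entry_sd d t)) {- ?a..?a})"
    by (rule prod_ennreal_pos[OF finite_triangle]) (rule gauss_interval_pos[OF entry_sd_pos[OF d] a])
  also have "\<dots> = emeasure (entries d) ?B"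
    unfolding entries_def by (rule P.emeasure_PiM[symmetric]) auto
  also have "\<dots> \<le> emeasure (entries d) (norm_ball d \<kappa>)"
  proof (rule emeasure_mono)
    show "?B \<subseteq> norm_ball d \<kappa>"
    proof
      fix y assume y: "y \<in> ?B"
      have "op_norm d (symm d y) \<le> sqrt (\<Sum>i<d. \<Sum>j<d. (symm d y (i, j))\<^sup>2)"
        by (rule op_norm_le_frobenius)
      also have "\<dots> \<le> sqrt (\<Sum>i<d. \<Sum>j<d. ?a\<^sup>2)"
      proof (intro real_sqrt_le_mono sum_mono)
        fix i j assume "i \<in> {..<d}" "j \<in> {..<d}"
        then have "y (min i j, max i j) \<in> {- ?a..?a}"
          using y min_max_triangle[of i d j] by (auto simp: PiE_iff)
        then have "\<bar>y (min i j, max i j)\<bar> \<le> \<bar>?a\<bar>"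
          unfolding abs_of_pos[OF a] abs_le_iff atLeastAtMost_iff by linarith
        then have "(y (min i j, max i j))\<^sup>2 \<le> ?a\<^sup>2" by (simp only: abs_le_square_iff)
        then show "(symm d y (i, j))\<^sup>2 \<le> ?a\<^sup>2"
          using \<open>i \<in> _\<close> \<open>j \<in> _\<close> by (simp add: symm_apply)
      qed
      also have "(\<Sum>i<d. \<Sum>j<d. ?a\<^sup>2) = \<kappa>\<^sup>2"
        using d by (simp add: power2_eq_square)
      also have "sqrt (\<kappa>\<^sup>2) = \<kappa>" using \<kappa> by simp
      finally show "y \<in> norm_ball d \<kappa>"
        using y by (auto simp: norm_ball_def space_entries PiE_iff)
    qed
  qed measurable
  finally show ?thesis
    unfolding single_prob_eq by (simp add: E.emeasure_eq_measure)
qed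

definition ball_integral :: "nat \<Rightarrow> real \<Rightarrow> (rmat \<Rightarrow> real) \<Rightarrow> real" where
  "ball_integral d \<kappa> f = (\<integral>y. indicator (norm_ball d \<kappa>) y * f y \<partial>entries d)"

lemma integrable_on_ball:
  fixes f :: "rmat \<Rightarrow> real"
  assumes d: "1 \<le> d" and [measurable]: "f \<in> borel_measurable (entries d)"
    and bd: "\<And>y. y \<in> norm_ball d \<kappa> \<Longrightarrow> \<bar>f y\<bar> \<le> C"
  shows "integrable (entries d) (\<lambda>y. indicator (norm_ball d \<kappa>) y * f y)"
proof -
  interpret E: prob_space "entries d" by (rule prob_space_entries[OF d])
  show ?thesis
    using bd by (intro E.integrable_const_bound[of _ "\<bar>C\<bar>"]) (force simp: indicator_def)+
qed

lemma pair_measurable_comp: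
  fixes f :: "rmat \<Rightarrow> real"
  assumes "f \<in> borel_measurable (entries d)"
  shows "(\<lambda>z. f (fst z)) \<in> borel_measurable (entries d \<Otimes>\<^sub>M entries d)"
    "(\<lambda>z. f (snd z)) \<in> borel_measurable (entries d \<Otimes>\<^sub>M entries d)"
  using measurable_compose[OF measurable_fst assms] measurable_compose[OF measurable_snd assms] by auto

lemma integrable_on_ball_pair:
  fixes f :: "rmat \<times> rmat \<Rightarrow> real"
  assumes d: "1 \<le> d" and "f \<in> borel_measurable (entries d \<Otimes>\<^sub>M entries d)"
    and bd: "\<And>z. z \<in> norm_ball d \<kappa> \<times> norm_ball d \<kappa> \<Longrightarrow> \<bar>f z\<bar> \<le> C"
  shows "integrable (entries d \<Otimes>\<^sub>M entries d) (\<lambda>z. indicator (norm_ball d \<kappa> \<times> norm_ball d \<kappa>) z * f z)"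
proof -
  interpret E: prob_space "entries d" by (rule prob_space_entries[OF d])
  interpret EE: pair_prob_space "entries d" "entries d" ..
  note [measurable] = assms(2)
  show ?thesis
    using bd by (intro EE.integrable_const_bound[of _ "\<bar>C\<bar>"]) (force simp: indicator_def)+
qed

lemma ball_integral_pair:
  assumes d: "1 \<le> d" and f: "f \<in> borel_measurable (entries d)" and g: "g \<in> borel_measurable (entries d)"
    and bf: "\<And>y. y \<in> norm_ball d \<kappa> \<Longrightarrow> \<bar>f y\<bar> \<le> C" and bg: "\<And>y. y \<in> norm_ball d \<kappa> \<Longrightarrow> \<bar>g y\<bar> \<le> C"
  shows "(\<integral>z. indicator (norm_ball d \<kappa> \<times> norm_ball d \<kappa>) z * (f (fst z) * g (snd z)) \<partial>(entries d \<Otimes>\<^sub>M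
      entries d))
    = ball_integral d \<kappa> f * ball_integral d \<kappa> g"
    and "integrable (entries d \<Otimes>\<^sub>M entries d) (\<lambda>z. indicator (norm_ball d \<kappa> \<times> norm_ball d \<kappa>) z * (f
        (fst z) * g (snd z)))"
proof -
  interpret E: prob_space "entries d" by (rule prob_space_entries[OF d])
  interpret EE: pair_prob_space "entries d" "entries d" ..
  let ?K = "norm_ball d \<kappa>"
  show int: "integrable (entries d \<Otimes>\<^sub>M entries d) (\<lambda>z. indicator (?K \<times> ?K) z * (f (fst z) * g (snd z)))"
  proof (rule integrable_on_ball_pair[OF d])
    show "(\<lambda>z. f (fst z) * g (snd z)) \<in> borel_measurable (entries d \<Otimes>\<^sub>M entries d)"
      by (intro borel_measurable_times pair_measurable_comp f g)
    show "\<bar>f (fst z) * g (snd z)\<bar> \<le> \<bar>C\<bar> * \<bar>C\<bar>" if "z \<in> ?K \<times> ?K" for z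
      unfolding abs_mult using bf[of "fst z"] bg[of "snd z"] that by (intro mult_mono) auto
  qed
  have "(\<integral>z. indicator (?K \<times> ?K) z * (f (fst z) * g (snd z)) \<partial>(entries d \<Otimes>\<^sub>M entries d))
    = (\<integral>x. \<integral>y. indicator (?K \<times> ?K) (x, y) * (f x * g y) \<partial>entries d \<partial>entries d)"
    using EE.integral_fst'[OF int] by simp
  also have "\<dots> = (\<integral>x. indicator ?K x * f x * ball_integral d \<kappa> g \<partial>entries d)"
  proof (intro Bochner_Integration.integral_cong refl)
    fix x
    have "(\<integral>y. indicator (?K \<times> ?K) (x, y) * (f x * g y) \<partial>entries d)
      = (\<integral>y. (indicator ?K x * f x) * (indicator ?K y * g y) \<partial>entries d)"
      by (intro Bochner_Integration.integral_cong refl) (simp add: indicator_def)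
    then show "(\<integral>y. indicator (?K \<times> ?K) (x, y) * (f x * g y) \<partial>entries d) = indicator ?K x * f x *
        ball_integral d \<kappa> g"
      by (simp add: ball_integral_def)
  qed
  also have "\<dots> = ball_integral d \<kappa> f * ball_integral d \<kappa> g"
    by (simp add: ball_integral_def)
  finally show "(\<integral>z. indicator (?K \<times> ?K) z * (f (fst z) * g (snd z)) \<partial>(entries d \<Otimes>\<^sub>M entries d))
    = ball_integral d \<kappa> f * ball_integral d \<kappa> g" .
qed

lemma ball_integral_1: "ball_integral d \<kappa> (\<lambda>_. 1) = single_prob \<kappa> d"
  unfolding ball_integral_def single_prob_eq by simp

text \<open>Both the Gaussian measure and the ball are invariant under \<open>x \<mapsto> - x\<close>.\<close>

lemma ball_integral_odd:
  assumes d: "1 \<le> d" and t: "t \<in> triangle d"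
  shows "ball_integral d \<kappa> (\<lambda>y. y t / entry_sd d t) = 0"
proof -
  let ?n = "\<lambda>y. \<lambda>t\<in>triangle d. - y t"
  let ?f = "\<lambda>y. indicator (norm_ball d \<kappa>) y * (y t / entry_sd d t) :: real"
  note [measurable] = entries_component[OF t]
  have m: "?n \<in> entries d \<rightarrow>\<^sub>M entries d"
    using measurable_ident_sets[OF refl, of "entries d"] entries_uminus_distr[OF d]
    unfolding entries_def
    by (intro measurable_restrict) (use entries_component in \<open>auto simp: entries_def cong:
        measurable_cong_sets\<close>)
  have "ball_integral d \<kappa> (\<lambda>y. y t / entry_sd d t) = (\<integral>y. ?f y \<partial>distr (entries d) (entries d) ?n)"
    by (simp add: ball_integral_def entries_uminus_distr[OF d])
  also have "\<dots> = (\<integral>y. ?f (?n y) \<partial>entries d)"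
    by (rule integral_distr[OF m]) measurable
  also have "\<dots> = (\<integral>y. - ?f y \<partial>entries d)"
  proof (intro Bochner_Integration.integral_cong refl)
    fix y assume y: "y \<in> space (entries d)"
    have "op_norm d (symm d (?n y)) = op_norm d (\<lambda>ij. -1 * symm d y ij)"
      by (rule op_norm_cong) (simp add: symm_apply min_max_triangle)
    also have "\<dots> = op_norm d (symm d y)"
      unfolding op_norm_scale by simp
    finally have "?n y \<in> norm_ball d \<kappa> \<longleftrightarrow> y \<in> norm_ball d \<kappa>"
      using y by (simp add: norm_ball_def space_entries)
    then show "?f (?n y) = - ?f y"
      using t by (simp add: indicator_def)
  qed
  also have "\<dots> = - ball_integral d \<kappa> (\<lambda>y. y t / entry_sd d t)"
    by (simp add: ball_integral_def)
  finally show ?thesis by simp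
qed

lemma unit_coord_le:
  assumes d: "1 \<le> d" and x: "x \<in> norm_ball d \<kappa>" and t: "t \<in> triangle d"
  shows "\<bar>x t / entry_sd d t\<bar> \<le> 1 + (real d)\<^sup>2 * \<kappa>\<^sup>2"
proof -
  have "(x t / entry_sd d t)\<^sup>2 \<le> unit_norm_sq d x"
    unfolding unit_norm_sq_def by (rule member_le_sum[OF t]) auto
  also have "\<dots> \<le> (real d)\<^sup>2 * \<kappa>\<^sup>2 / 2"
    by (rule unit_norm_sq_le[OF d x])
  also have "\<dots> \<le> (real d)\<^sup>2 * \<kappa>\<^sup>2" by simp
  finally have sq: "\<bar>x t / entry_sd d t\<bar>\<^sup>2 \<le> (real d)\<^sup>2 * \<kappa>\<^sup>2" by (simp only: power2_abs)
  have "2 * \<bar>x t / entry_sd d t\<bar> \<le> \<bar>x t / entry_sd d t\<bar>\<^sup>2 + 1"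
    using sum_squares_bound[of "\<bar>x t / entry_sd d t\<bar>" 1] by simp
  with sq show ?thesis by linarith
qed

lemma unit_norm_sq_measurable [measurable]: "unit_norm_sq d \<in> borel_measurable (entries d)"
  unfolding unit_norm_sq_def[abs_def] by measurable

lemma unit_inner_measurable [measurable]:
  "(\<lambda>z. unit_inner d (fst z) (snd z)) \<in> borel_measurable (entries d \<Otimes>\<^sub>M entries d)"
  unfolding unit_inner_def
  by (intro borel_measurable_sum borel_measurable_times borel_measurable_divide borel_measurable_const
      pair_measurable_comp[OF entries_component])

text \<open>The second moment of the inner product is the sum of the squares of all mixed moments of
two standardised entries. Keeping only the diagonal ones and applying the Cauchy-Schwarz
inequality gives the last claim.\<close>

lemma pair_moments:
  fixes d \<kappa>
  assumes d: "1 \<le> d"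
  defines "K2 \<equiv> norm_ball d \<kappa> \<times> norm_ball d \<kappa>" and "E2 \<equiv> entries d \<Otimes>\<^sub>M entries d"
    and "P \<equiv> single_prob \<kappa> d" and "S \<equiv> ball_integral d \<kappa> (unit_norm_sq d)"
  shows "(\<integral>z. indicator K2 z \<partial>E2) = P\<^sup>2"
    and "(\<integral>z. indicator K2 z * unit_inner d (fst z) (snd z) \<partial>E2) = 0"
    and "(\<integral>z. indicator K2 z * (unit_norm_sq d (fst z) + unit_norm_sq d (snd z)) \<partial>E2) = 2 * P * S"
    and "S\<^sup>2 \<le> card (triangle d) * (\<integral>z. indicator K2 z * (unit_inner d (fst z) (snd z))\<^sup>2 \<partial>E2)"
proof -
  let ?T = "triangle d" and ?R = "1 + (real d)\<^sup>2 * \<kappa>\<^sup>2"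
  let ?u = "\<lambda>t y. y t / entry_sd d t"
  have R: "0 \<le> ?R" by (simp add: add_nonneg_nonneg)
  have u: "\<bar>?u t y\<bar> \<le> ?R" if "t \<in> ?T" "y \<in> norm_ball d \<kappa>" for t y
    by (rule unit_coord_le[OF d that(2,1)])
  have mu: "?u t \<in> borel_measurable (entries d)" if "t \<in> ?T" for t
    using entries_component[OF that] by measurable
  have sq: "\<bar>unit_norm_sq d y\<bar> \<le> ?R" if "y \<in> norm_ball d \<kappa>" for y
    using unit_norm_sq_le[OF d that] unit_norm_sq_nonneg[of d y] zero_le_power2[of "real d * \<kappa>"]
    by (simp add: power_mult_distrib)
  have "(\<integral>z. indicator K2 z * (1 * 1) \<partial>E2) = P * P"
    unfolding K2_def E2_def P_def ball_integral_1[symmetric]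
    by (rule ball_integral_pair(1)[OF d, of "\<lambda>_. 1" "\<lambda>_. 1" \<kappa> 1]) auto
  then show "(\<integral>z. indicator K2 z \<partial>E2) = P\<^sup>2" by (simp add: power2_eq_square)
  have bp: "(\<integral>z. indicator K2 z * (?u t (fst z) * ?u t (snd z)) \<partial>E2) = 0"
    "integrable E2 (\<lambda>z. indicator K2 z * (?u t (fst z) * ?u t (snd z)))" if "t \<in> ?T" for t
  proof -
    note bp = ball_integral_pair[OF d mu[OF that] mu[OF that], where \<kappa> = \<kappa> and C = ?R]
    show "(\<integral>z. indicator K2 z * (?u t (fst z) * ?u t (snd z)) \<partial>E2) = 0"
      unfolding K2_def E2_def
      by (rule trans[OF bp(1)]) (use u[OF that] ball_integral_odd[OF d that, of \<kappa>] in simp_all)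
    show "integrable E2 (\<lambda>z. indicator K2 z * (?u t (fst z) * ?u t (snd z)))"
      unfolding K2_def E2_def by (rule bp(2); rule u[OF that])
  qed
  show "(\<integral>z. indicator K2 z * unit_inner d (fst z) (snd z) \<partial>E2) = 0"
    unfolding unit_inner_def sum_distrib_left
    by (subst Bochner_Integration.integral_sum) (auto simp: bp simp del: times_divide_eq_right
        times_divide_eq_left)
  have s1: "(\<integral>z. indicator K2 z * (unit_norm_sq d (fst z) * 1) \<partial>E2) = S * P"
    "integrable E2 (\<lambda>z. indicator K2 z * (unit_norm_sq d (fst z) * 1))"
    unfolding K2_def E2_def P_def S_def ball_integral_1[symmetric]
    by (rule ball_integral_pair[OF d, of "unit_norm_sq d" "\<lambda>_. 1" \<kappa> ?R]; use sq R in simp)+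
  have s2: "(\<integral>z. indicator K2 z * (1 * unit_norm_sq d (snd z)) \<partial>E2) = P * S"
    "integrable E2 (\<lambda>z. indicator K2 z * (1 * unit_norm_sq d (snd z)))"
    unfolding K2_def E2_def P_def S_def ball_integral_1[symmetric]
    by (rule ball_integral_pair[OF d, of "\<lambda>_. 1" "unit_norm_sq d" \<kappa> ?R]; use sq R in simp)+
  show "(\<integral>z. indicator K2 z * (unit_norm_sq d (fst z) + unit_norm_sq d (snd z)) \<partial>E2) = 2 * P * S"
    using s1 s2 by (simp add: distrib_left)
  let ?b = "\<lambda>s t. ball_integral d \<kappa> (\<lambda>y. ?u s y * ?u t y)"
  have st: "(\<integral>z. indicator K2 z * ((?u s (fst z) * ?u t (fst z)) * (?u s (snd z) * ?u t (snd z)))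
      \<partial>E2) = (?b s t)\<^sup>2"
    "integrable E2 (\<lambda>z. indicator K2 z * ((?u s (fst z) * ?u t (fst z)) * (?u s (snd z) * ?u t
        (snd z))))"
    if "s \<in> ?T" "t \<in> ?T" for s t
  proof -
    have m: "(\<lambda>y. ?u s y * ?u t y) \<in> borel_measurable (entries d)"
      by (intro borel_measurable_times mu that)
    have b: "\<bar>?u s y * ?u t y\<bar> \<le> ?R * ?R" if "y \<in> norm_ball d \<kappa>" for y
      unfolding abs_mult[of "?u s y"] using R \<open>s \<in> ?T\<close> \<open>t \<in> ?T\<close> that by (intro mult_mono u) auto
    note bp = ball_integral_pair[OF d m m, where \<kappa> = \<kappa> and C = "?R * ?R"]
    show "(\<integral>z. indicator K2 z * ((?u s (fst z) * ?u t (fst z)) * (?u s (snd z) * ?u t (snd z)))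
        \<partial>E2) = (?b s t)\<^sup>2"
      unfolding K2_def E2_def power2_eq_square by (rule bp(1); rule b)
    show "integrable E2 (\<lambda>z. indicator K2 z * ((?u s (fst z) * ?u t (fst z)) * (?u s (snd z) * ?u
        t (snd z))))"
      unfolding K2_def E2_def by (rule bp(2); rule b)
  qed
  have "(\<integral>z. indicator K2 z * (unit_inner d (fst z) (snd z))\<^sup>2 \<partial>E2)
      = (\<integral>z. (\<Sum>s\<in>?T. \<Sum>t\<in>?T. indicator K2 z * ((?u s (fst z) * ?u t (fst z)) * (?u s (snd z) * ?u t
          (snd z)))) \<partial>E2)"
  proof (intro Bochner_Integration.integral_cong refl)
    fix z
    have "(unit_inner d (fst z) (snd z))\<^sup>2
        = (\<Sum>s\<in>?T. \<Sum>t\<in>?T. (?u s (fst z) * ?u t (fst z)) * (?u s (snd z) * ?u t (snd z)))"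
      unfolding unit_inner_def power2_eq_square sum_product by (intro sum.cong refl) (simp only:
          mult_ac)
    then show "indicator K2 z * (unit_inner d (fst z) (snd z))\<^sup>2
        = (\<Sum>s\<in>?T. \<Sum>t\<in>?T. indicator K2 z * ((?u s (fst z) * ?u t (fst z)) * (?u s (snd z) * ?u t
            (snd z))))"
      by (simp only: sum_distrib_left)
  qed
  also have "\<dots> = (\<Sum>s\<in>?T. \<Sum>t\<in>?T. (?b s t)\<^sup>2)"
    by (subst integral_double_sum) (rule st(2), assumption+, intro sum.cong refl, rule st(1))
  finally have in2: "(\<integral>z. indicator K2 z * (unit_inner d (fst z) (snd z))\<^sup>2 \<partial>E2) = (\<Sum>s\<in>?T. \<Sum>t\<in>?T.
      (?b s t)\<^sup>2)" .
  have "(\<Sum>s\<in>?T. (?b s s)\<^sup>2) \<le> (\<Sum>s\<in>?T. \<Sum>t\<in>?T. (?b s t)\<^sup>2)"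
    by (intro sum_mono member_le_sum) auto
  moreover have "S\<^sup>2 \<le> card ?T * (\<Sum>s\<in>?T. (?b s s)\<^sup>2)"
  proof -
    have "S = (\<Sum>s\<in>?T. ?b s s)"
    proof -
      have i: "integrable (entries d) (\<lambda>y. indicator (norm_ball d \<kappa>) y * (?u s y * ?u s y))" if "s
          \<in> ?T" for s
      proof (rule integrable_on_ball[OF d, where C = "?R * ?R"])
        show "(\<lambda>y. ?u s y * ?u s y) \<in> borel_measurable (entries d)"
          by (intro borel_measurable_times mu that)
        show "\<bar>?u s y * ?u s y\<bar> \<le> ?R * ?R" if "y \<in> norm_ball d \<kappa>" for y
          unfolding abs_mult[of "?u s y"] using R \<open>s \<in> ?T\<close> that by (intro mult_mono u) auto
      qed
      show ?thesis
        unfolding S_def ball_integral_def unit_norm_sq_def power2_eq_square sum_distrib_left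
        by (rule Bochner_Integration.integral_sum) (rule i)
    qed
    moreover have "(\<Sum>s\<in>?T. 1 * ?b s s)\<^sup>2 \<le> (\<Sum>s\<in>?T. 1\<^sup>2) * (\<Sum>s\<in>?T. (?b s s)\<^sup>2)"
      by (rule Cauchy_Schwarz_ineq_sum)
    ultimately show ?thesis by simp
  qed
  ultimately show "S\<^sup>2 \<le> card ?T * (\<integral>z. indicator K2 z * (unit_inner d (fst z) (snd z))\<^sup>2 \<partial>E2)"
    unfolding in2 by (meson mult_left_mono of_nat_0_le_iff order_trans)
qed

lemma ball_second_moment:
  assumes d: "1 \<le> d" and \<kappa>: "0 < \<kappa>" "\<kappa> < 2"
  shows "(real d)\<^sup>2 / 2 * (1 - \<kappa>\<^sup>2 / 4)\<^sup>2 * single_prob \<kappa> d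
    \<le> card (triangle d) * single_prob \<kappa> d - ball_integral d \<kappa> (unit_norm_sq d)"
proof -
  interpret E: prob_space "entries d" by (rule prob_space_entries[OF d])
  let ?c = "(real d)\<^sup>2 / 2 * (1 - \<kappa>\<^sup>2 / 4)\<^sup>2"
  have i1: "integrable (entries d) (\<lambda>y. indicator (norm_ball d \<kappa>) y * (card (triangle d) - ?c))"
    by (rule integrable_on_ball[OF d, where C = "\<bar>card (triangle d) - ?c\<bar>"]) auto
  have i2: "integrable (entries d) (\<lambda>y. indicator (norm_ball d \<kappa>) y * unit_norm_sq d y)"
    using unit_norm_sq_le[OF d] unit_norm_sq_nonneg
    by (intro integrable_on_ball[OF d, where C = "(real d)\<^sup>2 * \<kappa>\<^sup>2 / 2"]) auto
  have "0 \<le> (\<integral>y. (real d * (real d + 1) / 2 - d / 2 * pow_trace d (symm d y) 2 - ?c)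
      * indicator {y. op_norm d (symm d y) \<le> \<kappa>} y \<partial>entries d)"
    by (rule second_moment_bound[OF d \<kappa>])
  also have "\<dots> = (\<integral>y. indicator (norm_ball d \<kappa>) y * (card (triangle d) - ?c) - indicator
      (norm_ball d \<kappa>) y * unit_norm_sq d y \<partial>entries d)"
    by (intro Bochner_Integration.integral_cong refl)
      (simp add: indicator_def norm_ball_def unit_norm_sq_eq[OF d] card_triangle)
  also have "\<dots> = (card (triangle d) - ?c) * single_prob \<kappa> d - ball_integral d \<kappa> (unit_norm_sq d)"
    using i1 i2 unfolding ball_integral_1[symmetric] by (simp add: ball_integral_def)
  finally show ?thesis by (simp add: left_diff_distrib)
qed

text \<open>Let \<open>H\<close> be the integral in \<open>pair_prob_mehler\<close>. Then \<open>n G\<close> is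
\<open>ln H - (N / 2) ln (1 - q^2)\<close> plus a constant, with \<open>N\<close> the number of independent entries. At
\<open>q = 0\<close> the derivative of \<open>H\<close> vanishes by symmetry, and \<open>pair_moments\<close> makes the second
derivative of \<open>n G\<close> at least \<open>(N - S / P)^2 / N\<close>, where \<open>S / P\<close> is the conditional second moment
bounded in \<open>ball_second_moment\<close>.\<close>

lemma G_taylor:
  assumes d: "1 \<le> d" and n: "1 \<le> n" and \<kappa>: "0 < \<kappa>" "\<kappa> < 2"
  shows "\<exists>G1 G2. (\<forall>q\<in>{-(1/2)<..<1/2}. (G \<kappa> d n has_real_derivative G1 q) (at q)
        \<and> (G1 has_real_derivative G2 q) (at q) \<and> 0 < pair_prob \<kappa> d q)
     \<and> G \<kappa> d n 0 = 0 \<and> G1 0 = 0 \<and> (real d) ^ 3 / (2 * (real d + 1) * n) * (1 - \<kappa>\<^sup>2 / 4) ^ 4 \<le> G2 0"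
proof -
  interpret E: prob_space "entries d" by (rule prob_space_entries[OF d])
  interpret EE: pair_prob_space "entries d" "entries d" ..
  let ?S = "{-(1/2)<..<1/2::real}"
  define K where "K = norm_ball d \<kappa> \<times> norm_ball d \<kappa>"
  define M where "M = entries d \<Otimes>\<^sub>M entries d"
  define \<alpha> where "\<alpha> = (\<lambda>z. unit_norm_sq d (fst z) + unit_norm_sq d (snd z))"
  define \<beta> where "\<beta> = (\<lambda>z. unit_inner d (fst z) (snd z))"
  define N where "N = real (card (triangle d))"
  define P where "P = single_prob \<kappa> d"
  define S where "S = ball_integral d \<kappa> (unit_norm_sq d)"
  define R where "R = (real d)\<^sup>2 * \<kappa>\<^sup>2"
  have P: "0 < P" unfolding P_def by (rule single_prob_pos[OF d \<kappa>(1)])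
  have K: "K \<in> sets M" unfolding K_def M_def by measurable
  have ma: "\<alpha> \<in> borel_measurable M"
    unfolding \<alpha>_def M_def by (intro borel_measurable_add pair_measurable_comp unit_norm_sq_measurable)
  have mb: "\<beta> \<in> borel_measurable M"
    unfolding \<beta>_def M_def by (rule unit_inner_measurable)
  have fM: "finite_measure M" unfolding M_def by (rule EE.finite_measure_axioms)
  have R0: "0 \<le> R" by (simp add: R_def)
  have Ra: "\<bar>\<alpha> z\<bar> \<le> R" if "z \<in> K" for z
    using that unit_norm_sq_le[OF d, of "fst z" \<kappa>] unit_norm_sq_le[OF d, of "snd z" \<kappa>]
      unit_norm_sq_nonneg[of d "fst z"] unit_norm_sq_nonneg[of d "snd z"]
    by (auto simp: K_def \<alpha>_def R_def)
  have Rb: "\<bar>\<beta> z\<bar> \<le> R" if "z \<in> K" for z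
    using Ra[OF that] abs_unit_inner_le[of d "fst z" "snd z"] by (simp add: \<beta>_def \<alpha>_def)
  define H where "H = (\<lambda>q. \<integral>\<omega>. indicator K \<omega> * exp (norm_coeff q * \<alpha> \<omega> + inner_coeff q * \<beta> \<omega>) \<partial>M)"
  define H1 where "H1 = (\<lambda>q. \<integral>\<omega>. indicator K \<omega> * ((norm_coeff1 q * \<alpha> \<omega> + inner_coeff1 q * \<beta> \<omega>) *
      exp (norm_coeff q * \<alpha> \<omega> + inner_coeff q * \<beta> \<omega>)) \<partial>M)"
  define H2 where "H2 = (\<lambda>q. \<integral>\<omega>. indicator K \<omega> * ((norm_coeff2 q * \<alpha> \<omega> + inner_coeff2 q * \<beta> \<omega> +
      (norm_coeff1 q * \<alpha> \<omega> + inner_coeff1 q * \<beta> \<omega>)\<^sup>2) * exp (norm_coeff q * \<alpha> \<omega> + inner_coeff q * \<beta>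
      \<omega>)) \<partial>M)"
  have dH: "(H has_real_derivative H1 q) (at q)" and dH1: "(H1 has_real_derivative H2 q) (at q)"
      if "q \<in> ?S" for q
    unfolding H_def H1_def H2_def
    using exp_integral_derivatives[OF fM ma mb K R0 Ra Rb that] by auto
  have Hpos: "0 < H q" if q: "q \<in> ?S" for q
  proof -
    have ex: "exp (- (16 * R)) \<le> exp (norm_coeff q * \<alpha> z + inner_coeff q * \<beta> z)" "exp (norm_coeff
        q * \<alpha> z + inner_coeff q * \<beta> z) \<le> exp (16 * R)" if "z \<in> K" for z
    proof -
      have "\<bar>norm_coeff q * \<alpha> z\<bar> \<le> 8 * R" "\<bar>inner_coeff q * \<beta> z\<bar> \<le> 8 * R"
        unfolding abs_mult using mehler_coeff_bounds[OF q] Ra[OF that] Rb[OF that] by (intro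
            mult_mono; simp)+
      then have "- (16 * R) \<le> norm_coeff q * \<alpha> z + inner_coeff q * \<beta> z" "norm_coeff q * \<alpha> z +
          inner_coeff q * \<beta> z \<le> 16 * R"
        by linarith+
      then show "exp (- (16 * R)) \<le> exp (norm_coeff q * \<alpha> z + inner_coeff q * \<beta> z)" "exp
          (norm_coeff q * \<alpha> z + inner_coeff q * \<beta> z) \<le> exp (16 * R)"
        by (simp_all only: exp_le_cancel_iff)
    qed
    have "0 < P\<^sup>2 * exp (- (16 * R))" using P by simp
    also have "\<dots> = (\<integral>z. indicator K z * exp (- (16 * R)) \<partial>M)"
      using pair_moments(1)[OF d, of \<kappa>] by (simp add: K_def M_def P_def)
    also have "\<dots> \<le> H q"
      unfolding H_def
    proof (rule integral_mono)
      show "integrable M (\<lambda>z. indicator K z * exp (- (16 * R)))"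
        unfolding M_def K_def by (rule integrable_on_ball_pair[OF d, where C = "exp (- (16 * R))"]) auto
      show "integrable M (\<lambda>\<omega>. indicator K \<omega> * exp (norm_coeff q * \<alpha> \<omega> + inner_coeff q * \<beta> \<omega>))"
        unfolding M_def K_def
      proof (rule integrable_on_ball_pair[OF d, where C = "exp (16 * R)"])
        show "(\<lambda>\<omega>. exp (norm_coeff q * \<alpha> \<omega> + inner_coeff q * \<beta> \<omega>)) \<in> borel_measurable (entries d
            \<Otimes>\<^sub>M entries d)"
          using ma mb unfolding M_def by measurable
      qed (use ex(2) in \<open>simp add: K_def\<close>)
      show "indicator K z * exp (- (16 * R)) \<le> indicator K z * exp (norm_coeff q * \<alpha> z +
          inner_coeff q * \<beta> z)" for z
        using ex(1)[of z] by (simp add: indicator_def)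
    qed
    finally show ?thesis .
  qed
  define G1 where "G1 = (\<lambda>q. 1 / n * (H1 q / H q + N * (q / (1 - q\<^sup>2))))"
  define G2 where "G2 = (\<lambda>q. 1 / n * ((H2 q * H q - H1 q * H1 q) / (H q * H q) + N * ((1 + q\<^sup>2) /
      (1 - q\<^sup>2)\<^sup>2)))"
  have q2: "q\<^sup>2 < 1" if "q \<in> ?S" for q :: real
  proof -
    have "\<bar>q\<bar> < 1" using that by auto
    then show ?thesis by (simp add: abs_square_less_1)
  qed
  have G: "G \<kappa> d n q = 1 / n * (ln (H q) - N / 2 * ln (1 - q\<^sup>2) - 2 * ln P)" if q: "q \<in> ?S" for q
  proof -
    have "\<bar>q\<bar> < 1" using q by auto
    then have pp: "pair_prob \<kappa> d q = (1 / sqrt (1 - q\<^sup>2)) ^ card (triangle d) * H q"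
      unfolding pair_prob_mehler[OF d \<open>\<bar>q\<bar> < 1\<close>] H_def K_def M_def \<alpha>_def \<beta>_def norm_coeff_def
          inner_coeff_def by simp
    have s: "0 < sqrt (1 - q\<^sup>2)" using q2[OF q] by simp
    then have "ln (pair_prob \<kappa> d q / P\<^sup>2) = card (triangle d) * ln (1 / sqrt (1 - q\<^sup>2)) + ln (H q) -
        2 * ln P"
      unfolding pp using Hpos[OF q] P by (simp add: ln_mult ln_div ln_realpow)
    also have "ln (1 / sqrt (1 - q\<^sup>2)) = - (1 / 2 * ln (1 - q\<^sup>2))"
      using s q2[OF q] by (simp add: ln_div ln_sqrt)
    finally have e: "ln (pair_prob \<kappa> d q / P\<^sup>2)
        = card (triangle d) * - (1 / 2 * ln (1 - q\<^sup>2)) + ln (H q) - 2 * ln P" .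
    show ?thesis
      unfolding G_eq P_def[symmetric] e N_def by (intro arg_cong[of _ _ "(*) _"]) simp
  qed
  have ppos: "0 < pair_prob \<kappa> d q" if q: "q \<in> ?S" for q
  proof -
    have "\<bar>q\<bar> < 1" using q by auto
    then have "pair_prob \<kappa> d q = (1 / sqrt (1 - q\<^sup>2)) ^ card (triangle d) * H q"
      unfolding pair_prob_mehler[OF d \<open>\<bar>q\<bar> < 1\<close>] H_def K_def M_def \<alpha>_def \<beta>_def norm_coeff_def
          inner_coeff_def by simp
    moreover have "0 < sqrt (1 - q\<^sup>2)" using q2[OF q] by simp
    ultimately show ?thesis using Hpos[OF q] by simp
  qed
  have dG: "(G \<kappa> d n has_real_derivative G1 q) (at q)" if q: "q \<in> ?S" for q
  proof (rule has_field_derivative_transform_within_open[OF _ open_greaterThanLessThan q])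
    show "((\<lambda>q. 1 / n * (ln (H q) - N / 2 * ln (1 - q\<^sup>2) - 2 * ln P)) has_real_derivative G1 q) (at q)"
    proof -
      have a: "((\<lambda>q. ln (H q)) has_real_derivative inverse (H q) * H1 q) (at q)"
        by (rule DERIV_chain2[OF DERIV_ln[OF Hpos[OF q]] dH[OF q]])
      have b: "((\<lambda>q. ln (1 - q\<^sup>2)) has_real_derivative - 2 * q / (1 - q\<^sup>2)) (at q)"
        using q2[OF q] by (auto intro!: derivative_eq_intros)
      have e: "inverse (H q) * H1 q = H1 q / H q" "N / 2 * (- 2 * q / (1 - q\<^sup>2)) = - (N * (q / (1 -
          q\<^sup>2)))"
        by (simp_all add: inverse_eq_divide)
      show ?thesis
        by (rule DERIV_cong[OF DERIV_cmult[OF DERIV_diff[OF DERIV_diff[OF a DERIV_cmult[OF b]]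
            DERIV_const]]])
          (simp only: e G1_def diff_minus_eq_add diff_zero)
    qed
  qed (use G in simp)
  have dG1: "(G1 has_real_derivative G2 q) (at q)" if q: "q \<in> ?S" for q
  proof -
    have "((\<lambda>q. q / (1 - q\<^sup>2)) has_real_derivative (1 + q\<^sup>2) / (1 - q\<^sup>2)\<^sup>2) (at q)"
      using mehler_coeff_deriv(3)[of q] q unfolding inner_coeff_def[abs_def] inner_coeff1_def by auto
    then show ?thesis
      unfolding G1_def G2_def using DERIV_divide[OF dH1[OF q] dH[OF q]] Hpos[OF q]
      by (intro DERIV_cmult DERIV_add) auto
  qed
  have z: "norm_coeff 0 = 0" "norm_coeff1 0 = 0" "norm_coeff2 0 = -1" "inner_coeff 0 = 0"
      "inner_coeff1 0 = 1" "inner_coeff2 0 = 0"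
    by (simp_all add: norm_coeff_def norm_coeff1_def norm_coeff2_def inner_coeff_def
        inner_coeff1_def inner_coeff2_def)
  note pm = pair_moments[OF d, of \<kappa>, folded K_def M_def P_def S_def]
  have H0: "H 0 = P\<^sup>2"
    using pm(1) by (simp add: H_def z)
  have H10: "H1 0 = 0"
    using pm(2) by (simp add: H1_def z \<beta>_def)
  have H20: "H2 0 = (\<integral>z. indicator K z * (\<beta> z)\<^sup>2 \<partial>M) - 2 * P * S"
  proof -
    have ia: "integrable M (\<lambda>z. indicator K z * \<alpha> z)"
      unfolding M_def K_def by (rule integrable_on_ball_pair[OF d, where C = R])
        (use ma Ra in \<open>auto simp: M_def K_def\<close>)
    have ib: "integrable M (\<lambda>z. indicator K z * (\<beta> z)\<^sup>2)"
      unfolding M_def K_def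
    proof (rule integrable_on_ball_pair[OF d, where C = "R\<^sup>2"])
      show "(\<lambda>z. (\<beta> z)\<^sup>2) \<in> borel_measurable (entries d \<Otimes>\<^sub>M entries d)"
        using mb unfolding M_def by measurable
      show "\<bar>(\<beta> z)\<^sup>2\<bar> \<le> R\<^sup>2" if "z \<in> norm_ball d \<kappa> \<times> norm_ball d \<kappa>" for z
        using power_mono[OF Rb[of z] abs_ge_zero, of 2] that by (simp add: K_def)
    qed
    have "H2 0 = (\<integral>z. indicator K z * (\<beta> z)\<^sup>2 - indicator K z * \<alpha> z \<partial>M)"
      unfolding H2_def by (intro Bochner_Integration.integral_cong refl) (simp add: z algebra_simps)
    also have "\<dots> = (\<integral>z. indicator K z * (\<beta> z)\<^sup>2 \<partial>M) - (\<integral>z. indicator K z * \<alpha> z \<partial>M)"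
      by (rule Bochner_Integration.integral_diff[OF ib ia])
    finally show ?thesis
      using pm(3) by (simp add: \<alpha>_def)
  qed
  have N: "N = real d * (real d + 1) / 2" by (simp add: N_def card_triangle)
  have Npos: "0 < N" using d by (simp add: N)
  define c where "c = (real d)\<^sup>2 / 2 * (1 - \<kappa>\<^sup>2 / 4)\<^sup>2"
  have c0: "0 \<le> c" by (simp add: c_def)
  have cb: "c * P \<le> N * P - S"
    using ball_second_moment[OF d \<kappa>] by (simp add: c_def P_def S_def N_def)
  have key: "c\<^sup>2 / N \<le> H2 0 / P\<^sup>2 + N"
  proof -
    have "S\<^sup>2 \<le> N * (\<integral>z. indicator K z * (\<beta> z)\<^sup>2 \<partial>M)"
      using pm(4) by (simp add: N_def \<beta>_def)
    then have "S\<^sup>2 \<le> N * (H2 0 + 2 * P * S)" by (simp add: H20)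
    moreover have "(c * P)\<^sup>2 \<le> (N * P - S)\<^sup>2"
      using cb c0 P by (intro power_mono) auto
    ultimately have "c\<^sup>2 * P\<^sup>2 \<le> N * (H2 0 + N * P\<^sup>2)"
      by (simp add: power2_eq_square algebra_simps)
    then show ?thesis
      using P Npos by (simp add: field_simps)
  qed
  have G20: "G2 0 = 1 / n * (H2 0 / P\<^sup>2 + N)"
  proof -
    have "a * b / (b * b) = a / b" if "b \<noteq> 0" for a b :: real
      using that by simp
    from this[of "P\<^sup>2" "H2 0"] show ?thesis
      using P by (simp add: G2_def H0 H10)
  qed
  have "(real d) ^ 3 / (2 * (real d + 1) * n) * (1 - \<kappa>\<^sup>2 / 4) ^ 4 = 1 / n * (c\<^sup>2 / N)"
  proof -
    have c2: "c\<^sup>2 = (real d) ^ 4 / 4 * (1 - \<kappa>\<^sup>2 / 4) ^ 4"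
      unfolding c_def by (simp add: power_mult_distrib power_divide power_mult[symmetric])
    have frac: "D ^ 3 / (2 * (D + 1) * m) * e = 1 / m * ((D ^ 4 / 4 * e) / (D * (D + 1) / 2))"
      if "0 < D" "0 < m" for D m e :: real
      using that by (simp add: power3_eq_cube power4_eq_xxxx mult.commute mult.left_commute)
    show ?thesis
      unfolding N c2 by (rule frac) (use d n in auto)
  qed
  also have "\<dots> \<le> G2 0"
    unfolding G20 using key by (intro mult_left_mono) auto
  finally have "(real d) ^ 3 / (2 * (real d + 1) * n) * (1 - \<kappa>\<^sup>2 / 4) ^ 4 \<le> G2 0" .
  moreover have "G \<kappa> d n 0 = 0"
    using G[of 0] P by (simp add: H0 ln_realpow)
  moreover have "G1 0 = 0" by (simp add: G1_def H10)
  ultimately show ?thesis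
    using dG dG1 ppos by blast
qed

section \<open>Signed sums of independent GOE matrices\<close>

definition lin_entries :: "nat \<Rightarrow> real \<Rightarrow> real \<Rightarrow> rmat \<Rightarrow> rmat \<Rightarrow> rmat" where
  "lin_entries d a b x y = (\<lambda>t\<in>triangle d. a * x t + b * y t)"

lemma lin_entries_measurable:
  "(\<lambda>z. lin_entries d a b (fst z) (snd z)) \<in> entries d \<Otimes>\<^sub>M entries d \<rightarrow>\<^sub>M entries d"
  unfolding lin_entries_def by (rule triangle_map_measurable)

lemma unit_inner_commute: "unit_inner d x v = unit_inner d v x"
  by (simp add: unit_inner_def mult.commute)

text \<open>The Mehler kernel is symmetric in its two arguments.\<close>

lemma mehler_reversible:
  assumes d: "1 \<le> d" and q: "\<bar>q\<bar> < 1" and F: "F \<in> borel_measurable (entries d \<Otimes>\<^sub>M entries d)"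
  shows "(\<integral>\<^sup>+x. \<integral>\<^sup>+y. F (x, lin_entries d q (sqrt (1 - q\<^sup>2)) x y) \<partial>entries d \<partial>entries d)
    = (\<integral>\<^sup>+x. \<integral>\<^sup>+y. F (lin_entries d q (sqrt (1 - q\<^sup>2)) x y, x) \<partial>entries d \<partial>entries d)"
proof -
  interpret E: prob_space "entries d" by (rule prob_space_entries[OF d])
  interpret EE: pair_prob_space "entries d" "entries d" ..
  let ?k = "\<lambda>x v. (1 / sqrt (1 - q\<^sup>2)) ^ card (triangle d)
      * exp (- (q\<^sup>2 / (2 * (1 - q\<^sup>2))) * (unit_norm_sq d x + unit_norm_sq d v) + q / (1 - q\<^sup>2) *
          unit_inner d x v)"
  have ksym: "?k x v = ?k v x" for x v
    by (simp only: add.commute[of "unit_norm_sq d x"] unit_inner_commute[of d x])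
  note [measurable] = F
  have mk: "(\<lambda>z. ?k (fst z) (snd z)) \<in> borel_measurable (entries d \<Otimes>\<^sub>M entries d)"
    by (intro borel_measurable_times borel_measurable_const borel_measurable_exp[THEN
        measurable_compose[rotated]]
       borel_measurable_add unit_inner_measurable pair_measurable_comp unit_norm_sq_measurable)
  have sw: "(\<lambda>z. (snd z, fst z)) \<in> entries d \<Otimes>\<^sub>M entries d \<rightarrow>\<^sub>M entries d \<Otimes>\<^sub>M entries d"
    by measurable
  have F': "(\<lambda>z. F (snd z, fst z)) \<in> borel_measurable (entries d \<Otimes>\<^sub>M entries d)"
    using measurable_compose[OF sw F] by simp
  have 1: "(\<integral>\<^sup>+x. \<integral>\<^sup>+y. H (x, lin_entries d q (sqrt (1 - q\<^sup>2)) x y) \<partial>entries d \<partial>entries d)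
      = (\<integral>\<^sup>+x. \<integral>\<^sup>+v. H (x, v) * ennreal (?k x v) \<partial>entries d \<partial>entries d)"
    if H: "H \<in> borel_measurable (entries d \<Otimes>\<^sub>M entries d)" for H :: "rmat \<times> rmat \<Rightarrow> ennreal"
  proof (rule nn_integral_cong)
    fix x assume "x \<in> space (entries d)"
    then have "(\<lambda>v. H (x, v)) \<in> borel_measurable (entries d)"
      by (rule measurable_Pair2[OF H])
    from entries_mehler[OF d q this, of x]
    show "(\<integral>\<^sup>+y. H (x, lin_entries d q (sqrt (1 - q\<^sup>2)) x y) \<partial>entries d)
      = (\<integral>\<^sup>+v. H (x, v) * ennreal (?k x v) \<partial>entries d)"
      unfolding prod_mehler[OF d q] lin_entries_def .
  qed
  have "(\<integral>\<^sup>+x. \<integral>\<^sup>+v. F (x, v) * ennreal (?k x v) \<partial>entries d \<partial>entries d)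
     = (\<integral>\<^sup>+v. \<integral>\<^sup>+x. F (x, v) * ennreal (?k x v) \<partial>entries d \<partial>entries d)"
    by (rule EE.Fubini'[symmetric, where f = "\<lambda>x v. F (x, v) * ennreal (?k x v)"])
      (use F mk in \<open>simp add: case_prod_beta\<close>)
  also have "\<dots> = (\<integral>\<^sup>+x. \<integral>\<^sup>+v. F (v, x) * ennreal (?k x v) \<partial>entries d \<partial>entries d)"
    by (intro nn_integral_cong) (simp only: ksym)
  finally show ?thesis
    using 1[OF F] 1[OF F'] by simp
qed

text \<open>Rotation invariance of a pair of Gaussian vectors follows from the exchangeability of \<open>x\<close>
and \<open>u = q x + c y\<close>: the second rotated coordinate is the same function of \<open>(u, x)\<close> as \<open>y\<close> is of
\<open>(x, u)\<close>.\<close>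

lemma entries_rotation:
  assumes d: "1 \<le> d" and q: "\<bar>q\<bar> < 1" and F: "F \<in> borel_measurable (entries d \<Otimes>\<^sub>M entries d)"
  defines "c \<equiv> sqrt (1 - q\<^sup>2)"
  shows "(\<integral>\<^sup>+x. \<integral>\<^sup>+y. F (lin_entries d q c x y, lin_entries d c (- q) x y) \<partial>entries d \<partial>entries d)
    = (\<integral>\<^sup>+x. \<integral>\<^sup>+y. F (x, y) \<partial>entries d \<partial>entries d)"
proof -
  have q2: "q\<^sup>2 < 1" using q by (simp add: abs_square_less_1)
  then have c: "0 < c" by (simp add: c_def)
  have c2: "c * c = 1 - q * q" using q2 by (simp add: c_def power2_eq_square[symmetric])
  \<comment> \<open>The second argument recovers \<open>y\<close> from \<open>x\<close> and \<open>q x + c y\<close>.\<close>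
  define H where "H = (\<lambda>z. F (fst z, lin_entries d (- q / c) (1 / c) (fst z) (snd z)))"
  have "(\<lambda>z. (fst z, lin_entries d (- q / c) (1 / c) (fst z) (snd z))) \<in> entries d \<Otimes>\<^sub>M entries d \<rightarrow>\<^sub>M
      entries d \<Otimes>\<^sub>M entries d"
    by (rule measurable_Pair[OF measurable_fst lin_entries_measurable])
  then have H: "H \<in> borel_measurable (entries d \<Otimes>\<^sub>M entries d)"
    unfolding H_def using F by (rule measurable_compose)
  have e1: "lin_entries d (- q / c) (1 / c) x (lin_entries d q c x y) = y" if "y \<in> space (entries
      d)" for x y
    using that c by (auto simp: lin_entries_def space_entries PiE_iff extensional_def fun_eq_iff
        field_simps)
  have e2: "lin_entries d (- q / c) (1 / c) (lin_entries d q c x y) x = lin_entries d c (- q) x y"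
      for x y
  proof -
    have "- q / c * (q * u + c * v) + 1 / c * u = c * u + - q * v" for u v
    proof -
      have "- q / c * (q * u + c * v) + 1 / c * u = (1 - q * q) * u / c - q * v"
        using c by (simp add: field_simps)
      also have "(1 - q * q) * u / c = c * u"
        unfolding c2[symmetric] using c by simp
      finally show ?thesis by simp
    qed
    then show ?thesis
      by (auto simp: lin_entries_def fun_eq_iff)
  qed
  have "(\<integral>\<^sup>+x. \<integral>\<^sup>+y. H (x, lin_entries d q c x y) \<partial>entries d \<partial>entries d)
      = (\<integral>\<^sup>+x. \<integral>\<^sup>+y. H (lin_entries d q c x y, x) \<partial>entries d \<partial>entries d)"
    unfolding c_def by (rule mehler_reversible[OF d q H])
  also have "\<dots> = (\<integral>\<^sup>+x. \<integral>\<^sup>+y. F (lin_entries d q c x y, lin_entries d c (- q) x y) \<partial>entries d \<partial>entries d)"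
    unfolding H_def fst_conv snd_conv e2 ..
  also have "(\<integral>\<^sup>+x. \<integral>\<^sup>+y. H (x, lin_entries d q c x y) \<partial>entries d \<partial>entries d) = (\<integral>\<^sup>+x. \<integral>\<^sup>+y. F (x, y)
      \<partial>entries d \<partial>entries d)"
    by (intro nn_integral_cong) (simp only: H_def fst_conv snd_conv e1)
  finally show ?thesis ..
qed

abbreviation clip :: "nat \<Rightarrow> rmat \<Rightarrow> rmat" where
  "clip d A \<equiv> restrict A ({..<d} \<times> {..<d})"

lemma signed_sum_measurable:
  assumes "J \<subseteq> I"
  shows "(\<lambda>\<omega>. clip d (\<lambda>ij. \<Sum>i\<in>J. \<epsilon> i * \<omega> i ij)) \<in> PiM I (\<lambda>_. GOE d) \<rightarrow>\<^sub>M mat_space d"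
proof (rule measurable_into_mat_space)
  fix a b assume ab: "a < d" "b < d"
  have "(\<lambda>\<omega>. \<omega> i (a, b)) \<in> borel_measurable (PiM I (\<lambda>_. GOE d))" if "i \<in> J" for i
  proof -
    have "(\<lambda>\<omega>. \<omega> i) \<in> PiM I (\<lambda>_. GOE d) \<rightarrow>\<^sub>M GOE d"
      using that assms by (intro measurable_component_singleton) auto
    then have "(\<lambda>\<omega>. \<omega> i) \<in> PiM I (\<lambda>_. GOE d) \<rightarrow>\<^sub>M mat_space d"
      by (simp cong: measurable_cong_sets)
    from measurable_compose[OF this mat_space_entry[OF ab]] show ?thesis .
  qed
  then show "(\<lambda>\<omega>. \<Sum>i\<in>J. \<epsilon> i * \<omega> i (a, b)) \<in> borel_measurable (PiM I (\<lambda>_. GOE d))"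
    by (intro borel_measurable_sum borel_measurable_times borel_measurable_const)
qed

lemma product_sigma_finite_GOE: "1 \<le> d \<Longrightarrow> product_sigma_finite (\<lambda>_. GOE d)"
  unfolding product_sigma_finite_def
  using prob_space_GOE prob_space_imp_sigma_finite by blast

lemma clip_symm_lin:
  "clip d (\<lambda>ij. a * symm d x ij + b * symm d y ij) = symm d (lin_entries d a b x y)"
  by (auto simp: fun_eq_iff lin_entries_def symm_def min_max_triangle)

lemma lin_comb_functional_measurable:
  assumes g: "g \<in> borel_measurable (mat_space d)"
  shows "(\<lambda>z. g (clip d (\<lambda>ij. a * fst z ij + b * snd z ij))) \<in> borel_measurable (mat_space d \<Otimes>\<^sub>M
      mat_space d)"
  by (rule measurable_compose[OF lin_comb_measurable g])

text \<open>Adding one more matrix to \<open>sqrt m\<close> times a GOE matrix amounts to a rotation followed by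
scaling with \<open>sqrt (m + 1)\<close>; a negative sign is removed by the symmetry of the Gaussian law.\<close>

lemma nn_integral_signed_sum:
  fixes \<epsilon> :: "nat \<Rightarrow> real"
  assumes d: "1 \<le> d" and J: "finite J" and \<epsilon>: "\<And>i. i \<in> J \<Longrightarrow> \<epsilon> i \<in> {-1, 1}"
    and g: "g \<in> borel_measurable (mat_space d)"
  shows "(\<integral>\<^sup>+\<omega>. g (clip d (\<lambda>ij. \<Sum>i\<in>J. \<epsilon> i * \<omega> i ij)) \<partial>PiM J (\<lambda>_. GOE d))
    = (\<integral>\<^sup>+x. g (clip d (\<lambda>ij. sqrt (card J) * symm d x ij)) \<partial>entries d)"
  using J \<epsilon> g
proof (induction J arbitrary: g)
  case empty
  interpret E: prob_space "entries d" by (rule prob_space_entries[OF d])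
  interpret P0: prob_space "PiM {} (\<lambda>_::nat. GOE d)"
    by (rule prob_space_PiM) simp
  show ?case
    by (simp add: E.emeasure_space_1 P0.emeasure_space_1)
next
  case (insert i J)
  interpret E: prob_space "entries d" by (rule prob_space_entries[OF d])
  interpret GO: prob_space "GOE d" by (rule prob_space_GOE[OF d])
  interpret product_sigma_finite "\<lambda>_. GOE d" by (rule product_sigma_finite_GOE[OF d])
  note g = insert.prems(2)
  define m where "m = real (card J)"
  \<comment> \<open>The factors are chosen such that \<open>sqrt m x + y = r (q x + sqrt (1 - q^2) y)\<close>.\<close>
  define r where "r = sqrt (m + 1)"
  define q where "q = sqrt m / r"
  have m0: "0 \<le> m" by (simp add: m_def)
  have r0: "0 < r" using m0 by (simp add: r_def)
  have q0: "\<bar>q\<bar> < 1" using m0 r0 by (simp add: q_def r_def)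
  have qr: "r * q = sqrt m" using r0 by (simp add: q_def)
  have cr: "r * sqrt (1 - q\<^sup>2) = 1"
  proof -
    have "1 - q\<^sup>2 = 1 / (m + 1)"
      using m0 by (simp add: q_def r_def power_divide field_simps)
    then show ?thesis
      using m0 by (simp add: r_def real_sqrt_divide)
  qed
  define g' where "g' = (\<lambda>B. \<integral>\<^sup>+W. g (clip d (\<lambda>ij. 1 * B ij + \<epsilon> i * W ij)) \<partial>GOE d)"
  have g': "g' \<in> borel_measurable (mat_space d)"
  proof -
    have "(\<lambda>z. g (clip d (\<lambda>ij. 1 * fst z ij + \<epsilon> i * snd z ij))) \<in> borel_measurable (mat_space d \<Otimes>\<^sub>M
        GOE d)"
      using lin_comb_functional_measurable[OF g, of 1 "\<epsilon> i"]
      unfolding measurable_cong_sets[OF sets_pair_measure_cong[OF refl sets_GOE] refl] .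
    then show ?thesis
      unfolding g'_def by (intro GO.borel_measurable_nn_integral) (simp add: case_prod_beta)
  qed
  have "(\<integral>\<^sup>+\<omega>. g (clip d (\<lambda>ij. \<Sum>k\<in>insert i J. \<epsilon> k * \<omega> k ij)) \<partial>PiM (insert i J) (\<lambda>_. GOE d))
      = (\<integral>\<^sup>+\<omega>. \<integral>\<^sup>+W. g (clip d (\<lambda>ij. \<Sum>k\<in>insert i J. \<epsilon> k * (fun_upd \<omega> i W) k ij)) \<partial>GOE d \<partial>PiM J (\<lambda>_.
          GOE d))"
    using insert.hyps
    by (intro product_nn_integral_insert measurable_compose[OF signed_sum_measurable g]) auto
  also have "\<dots> = (\<integral>\<^sup>+\<omega>. g' (clip d (\<lambda>ij. \<Sum>k\<in>J. \<epsilon> k * \<omega> k ij)) \<partial>PiM J (\<lambda>_. GOE d))"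
    unfolding g'_def
  proof (intro nn_integral_cong arg_cong[of _ _ g])
    fix \<omega> :: "nat \<Rightarrow> rmat" and W :: rmat
    have "(\<Sum>k\<in>J. \<epsilon> k * (fun_upd \<omega> i W) k ij) = (\<Sum>k\<in>J. \<epsilon> k * \<omega> k ij)" for ij
      using insert.hyps by (intro sum.cong) auto
    then show "clip d (\<lambda>ij. \<Sum>k\<in>insert i J. \<epsilon> k * (fun_upd \<omega> i W) k ij)
        = clip d (\<lambda>ij. 1 * clip d (\<lambda>ij. \<Sum>k\<in>J. \<epsilon> k * \<omega> k ij) ij + \<epsilon> i * W ij)"
      using insert.hyps by (auto simp: fun_eq_iff simp del: fun_upd_apply) (simp add: fun_upd_same)
  qed
  also have "\<dots> = (\<integral>\<^sup>+x. g' (clip d (\<lambda>ij. sqrt (card J) * symm d x ij)) \<partial>entries d)"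
    by (rule insert.IH[OF _ g']) (use insert.prems in auto)
  also have "\<dots> = (\<integral>\<^sup>+x. \<integral>\<^sup>+y. g (symm d (lin_entries d (sqrt m) 1 x y)) \<partial>entries d \<partial>entries d)"
  proof (rule nn_integral_cong)
    fix x
    let ?f = "\<lambda>y. g (symm d (lin_entries d (sqrt m) 1 x y))"
    have meas: "(\<lambda>y. g (symm d (lin_entries d (sqrt m) b x y))) \<in> borel_measurable (entries d)"
      if "x \<in> space (entries d)" for b
      by (rule measurable_compose[OF measurable_compose[OF measurable_Pair2[OF
          lin_entries_measurable that, simplified] symm_measurable] g])
    assume x: "x \<in> space (entries d)"
    have B: "clip d (\<lambda>ij. sqrt m * symm d x ij) \<in> space (mat_space d)"
      by (auto simp: space_mat_space)
    have "g' (clip d (\<lambda>ij. sqrt (card J) * symm d x ij))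
        = (\<integral>\<^sup>+y. g (clip d (\<lambda>ij. 1 * clip d (\<lambda>ij. sqrt m * symm d x ij) ij + \<epsilon> i * symm d y ij))
            \<partial>entries d)"
      unfolding g'_def m_def[symmetric]
      by (rule nn_integral_GOE) (use measurable_Pair2[OF lin_comb_functional_measurable[OF g, of 1
          "\<epsilon> i"] B] in \<open>simp only: fst_conv snd_conv\<close>)
    also have "\<dots> = (\<integral>\<^sup>+y. g (symm d (lin_entries d (sqrt m) (\<epsilon> i) x y)) \<partial>entries d)"
      unfolding clip_symm_lin[symmetric]
      by (intro nn_integral_cong arg_cong[of _ _ g]) (auto simp: fun_eq_iff)
    also have "\<dots> = (\<integral>\<^sup>+y. ?f y \<partial>entries d)"
    proof (cases "\<epsilon> i = 1")
      case False
      then have e: "\<epsilon> i = -1" using insert.prems(1)[of i] by auto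
      have "(\<integral>\<^sup>+y. ?f y \<partial>entries d) = (\<integral>\<^sup>+y. ?f (\<lambda>t\<in>triangle d. - y t) \<partial>entries d)"
        by (rule entries_uminus[OF d meas[OF x], symmetric])
      also have "\<dots> = (\<integral>\<^sup>+y. g (symm d (lin_entries d (sqrt m) (- 1) x y)) \<partial>entries d)"
        by (intro nn_integral_cong arg_cong[of _ _ g] arg_cong[of _ _ "symm d"])
          (auto simp: lin_entries_def fun_eq_iff)
      finally show ?thesis by (simp add: e)
    qed simp
    finally show "g' (clip d (\<lambda>ij. sqrt (card J) * symm d x ij)) = (\<integral>\<^sup>+y. ?f y \<partial>entries d)" .
  qed
  also have "\<dots> = (\<integral>\<^sup>+x. \<integral>\<^sup>+y. g (clip d (\<lambda>ij. r * symm d (lin_entries d q (sqrt (1 - q\<^sup>2)) x y) ij))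
      \<partial>entries d \<partial>entries d)"
  proof (intro nn_integral_cong arg_cong[of _ _ g])
    fix x y
    have "sqrt m * u + 1 * v = r * (q * u + sqrt (1 - q\<^sup>2) * v)" for u v
      unfolding distrib_left mult.assoc[symmetric] qr cr by simp
    then show "symm d (lin_entries d (sqrt m) 1 x y) = clip d (\<lambda>ij. r * symm d (lin_entries d q
        (sqrt (1 - q\<^sup>2)) x y) ij)"
      by (auto simp: fun_eq_iff lin_entries_def symm_def min_max_triangle)
  qed
  also have "\<dots> = (\<integral>\<^sup>+x. \<integral>\<^sup>+y. g (clip d (\<lambda>ij. r * symm d x ij)) \<partial>entries d \<partial>entries d)"
  proof -
    have "(\<lambda>x. clip d (\<lambda>ij. r * symm d x ij)) \<in> entries d \<rightarrow>\<^sub>M mat_space d"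
      by (intro measurable_into_mat_space borel_measurable_times borel_measurable_const
          symm_entry_measurable)
    from measurable_compose[OF measurable_fst measurable_compose[OF this g]]
    have "(\<lambda>z. g (clip d (\<lambda>ij. r * symm d (fst z) ij))) \<in> borel_measurable (entries d \<Otimes>\<^sub>M entries d)" .
    from entries_rotation[OF d q0 this] show ?thesis by simp
  qed
  also have "\<dots> = (\<integral>\<^sup>+x. g (clip d (\<lambda>ij. sqrt (card (insert i J)) * symm d x ij)) \<partial>entries d)"
    using insert.hyps by (simp add: E.emeasure_space_1 r_def m_def add.commute)
  finally show ?case .
qed

lemma op_norm_scaled_le_iff:
  assumes "0 < c"
  shows "op_norm d (\<lambda>ij. c * A ij) \<le> \<kappa> * c \<longleftrightarrow> op_norm d A \<le> \<kappa>"
  unfolding op_norm_scale using assms by (simp add: mult.commute)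

lemma single_sum_prob:
  fixes \<epsilon> :: "nat \<Rightarrow> real"
  assumes d: "1 \<le> d" and n: "1 \<le> n" and \<epsilon>: "\<And>i. i < n \<Longrightarrow> \<epsilon> i \<in> {-1, 1}"
  shows "(\<integral>\<^sup>+\<omega>. indicator {A. op_norm d A \<le> \<kappa> * sqrt n} (\<lambda>ij. \<Sum>i<n. \<epsilon> i * \<omega> i ij) \<partial>PiM {..<n} (\<lambda>_.
      GOE d))
    = ennreal (single_prob \<kappa> d)"
proof -
  interpret E: prob_space "entries d" by (rule prob_space_entries[OF d])
  let ?g = "\<lambda>A. indicator {A. op_norm d A \<le> \<kappa> * sqrt n} A :: ennreal"
  have g: "?g \<in> borel_measurable (mat_space d)"
    unfolding indicator_def by measurable
  have clip: "?g (clip d A) = ?g A" for A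
    by (simp add: indicator_def op_norm_lin_restrict)
  have "(\<integral>\<^sup>+\<omega>. ?g (\<lambda>ij. \<Sum>i<n. \<epsilon> i * \<omega> i ij) \<partial>PiM {..<n} (\<lambda>_. GOE d))
      = (\<integral>\<^sup>+x. ?g (\<lambda>ij. sqrt (card {..<n}) * symm d x ij) \<partial>entries d)"
    using nn_integral_signed_sum[OF d, of "{..<n}" \<epsilon> ?g] \<epsilon> g unfolding clip by auto
  also have "\<dots> = (\<integral>\<^sup>+x. indicator (norm_ball d \<kappa>) x \<partial>entries d)"
    using n op_norm_scaled_le_iff[of "sqrt n" d _ \<kappa>]
    by (intro nn_integral_cong) (simp add: indicator_def norm_ball_def)
  also have "\<dots> = ennreal (single_prob \<kappa> d)"
    unfolding single_prob_eq by (simp add: E.emeasure_eq_measure)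
  finally show ?thesis .
qed

text \<open>Split the sum into the places where the two sign vectors agree and those where they
differ. The two partial sums are independent multiples of GOE matrices \<open>x\<close> and \<open>y\<close>, and after
division by \<open>sqrt n\<close> the two signed sums are \<open>p x + s y\<close> and \<open>p x - s y\<close> with \<open>p^2 = 1 - l / n\<close>
and \<open>s^2 = l / n\<close>. In the rotated coordinates \<open>u = p x + s y\<close>, \<open>v = s x - p y\<close> they read \<open>u\<close> and
\<open>(p^2 - s^2) u + 2 p s v\<close>.\<close>

lemma pair_sum_prob:
  fixes \<epsilon> :: "nat \<Rightarrow> real"
  assumes d: "1 \<le> d" and \<epsilon>: "\<And>i. i < n \<Longrightarrow> \<epsilon> i \<in> {-1, 1}"
    and A: "A \<subseteq> {..<n}" "card A = l" and l: "1 \<le> l"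
  defines "q \<equiv> 1 - 2 * real l / real n"
  shows "(\<integral>\<^sup>+\<omega>. indicator {A. op_norm d A \<le> \<kappa> * sqrt n} (\<lambda>ij. \<Sum>i<n. \<epsilon> i * \<omega> i ij)
        * indicator {A. op_norm d A \<le> \<kappa> * sqrt n} (\<lambda>ij. \<Sum>i<n. (if i \<in> A then - \<epsilon> i else \<epsilon> i) * \<omega> i ij)
        \<partial>PiM {..<n} (\<lambda>_. GOE d))
    = ennreal (pair_prob \<kappa> d q)"
proof -
  interpret E: prob_space "entries d" by (rule prob_space_entries[OF d])
  interpret product_sigma_finite "\<lambda>_. GOE d" by (rule product_sigma_finite_GOE[OF d])
  let ?g = "\<lambda>A. indicator {A. op_norm d A \<le> \<kappa> * sqrt n} A :: ennreal"
  let ?lin = "\<lambda>a b X Y ij. a * X ij + b * Y ij :: real"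
  define B where "B = {..<n} - A"
  have fin: "finite A" "finite B" using A finite_subset by (auto simp: B_def)
  have AB: "B \<inter> A = {}" "B \<union> A = {..<n}" using A by (auto simp: B_def)
  have cB: "card B = n - l" using A fin by (simp add: B_def card_Diff_subset)
  have ln: "l \<le> n" using A card_mono[of "{..<n}" A] by simp
  then have n: "1 \<le> n" using l by simp
  let ?f = "\<lambda>S1 S2. ?g (?lin 1 1 S1 S2) * ?g (?lin 1 (-1) S1 S2)"
  have g: "?g \<in> borel_measurable (mat_space d)"
    unfolding indicator_def by measurable
  have clip: "?g (clip d A) = ?g A" for A
    by (simp add: indicator_def op_norm_lin_restrict)
  have clip2: "?f (clip d S1) S2 = ?f S1 S2" "?f S1 (clip d S2) = ?f S1 S2" for S1 S2
  proof -
    have k: "op_norm d (?lin a b (clip d S1) S2) = op_norm d (?lin a b S1 S2)"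
      "op_norm d (?lin a b S1 (clip d S2)) = op_norm d (?lin a b S1 S2)" for a b
      by (rule op_norm_cong; simp)+
    show "?f (clip d S1) S2 = ?f S1 S2" "?f S1 (clip d S2) = ?f S1 S2"
      by (simp_all only: indicator_def mem_Collect_eq k)
  qed
  have f: "(\<lambda>z. ?f (fst z) (snd z)) \<in> borel_measurable (mat_space d \<Otimes>\<^sub>M mat_space d)"
    using borel_measurable_times_ennreal[OF lin_comb_functional_measurable[OF g, of 1 1]
        lin_comb_functional_measurable[OF g, of 1 "-1"]]
    unfolding clip .
  have f1: "(\<lambda>S2. ?f S1 S2) \<in> borel_measurable (mat_space d)" if "S1 \<in> space (mat_space d)" for S1
    using measurable_Pair2[OF f that] by simp
  have f2: "(\<lambda>S1. \<integral>\<^sup>+y. ?f S1 (\<lambda>ij. c * symm d y ij) \<partial>entries d) \<in> borel_measurable (mat_space d)" for c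
  proof -
    have "(\<lambda>y. clip d (\<lambda>ij. c * symm d y ij)) \<in> entries d \<rightarrow>\<^sub>M mat_space d"
      by (intro measurable_into_mat_space borel_measurable_times borel_measurable_const
          symm_entry_measurable)
    then have "(\<lambda>z. (fst z, clip d (\<lambda>ij. c * symm d (snd z) ij))) \<in> mat_space d \<Otimes>\<^sub>M entries d \<rightarrow>\<^sub>M
        mat_space d \<Otimes>\<^sub>M mat_space d"
      by (intro measurable_Pair measurable_fst measurable_compose[OF measurable_snd])
    from measurable_compose[OF this f]
    have "(\<lambda>z. ?f (fst z) (\<lambda>ij. c * symm d (snd z) ij)) \<in> borel_measurable (mat_space d \<Otimes>\<^sub>M entries d)"
      by (simp only: fst_conv snd_conv clip2)
    then show ?thesis
      by (intro E.borel_measurable_nn_integral) (simp add: case_prod_beta)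
  qed
  let ?S = "\<lambda>J \<omega> ij. \<Sum>i\<in>J. \<epsilon> i * \<omega> i ij"
  let ?h = "\<lambda>\<omega>. ?f (?S B \<omega>) (?S A \<omega>)"
  have split: "(\<Sum>i<n. x i) = (\<Sum>i\<in>B. x i) + (\<Sum>i\<in>A. x i)" for x :: "nat \<Rightarrow> real"
    unfolding AB(2)[symmetric] by (rule sum.union_disjoint[OF fin(2,1) AB(1)])
  have "(\<integral>\<^sup>+\<omega>. ?g (\<lambda>ij. \<Sum>i<n. \<epsilon> i * \<omega> i ij)
        * ?g (\<lambda>ij. \<Sum>i<n. (if i \<in> A then - \<epsilon> i else \<epsilon> i) * \<omega> i ij) \<partial>PiM {..<n} (\<lambda>_. GOE d))
      = (\<integral>\<^sup>+\<omega>. ?h \<omega> \<partial>PiM {..<n} (\<lambda>_. GOE d))"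
  proof (intro nn_integral_cong)
    fix \<omega> :: "nat \<Rightarrow> rmat"
    have "(\<Sum>i\<in>B. (if i \<in> A then - \<epsilon> i else \<epsilon> i) * \<omega> i ij) = ?S B \<omega> ij" for ij
      by (intro sum.cong) (auto simp: B_def)
    moreover have "(\<Sum>i\<in>A. (if i \<in> A then - \<epsilon> i else \<epsilon> i) * \<omega> i ij) = - ?S A \<omega> ij" for ij
      by (simp add: sum_negf)
    ultimately show "?g (\<lambda>ij. \<Sum>i<n. \<epsilon> i * \<omega> i ij)
        * ?g (\<lambda>ij. \<Sum>i<n. (if i \<in> A then - \<epsilon> i else \<epsilon> i) * \<omega> i ij) = ?h \<omega>"
      unfolding split by simp
  qed
  also have "\<dots> = (\<integral>\<^sup>+\<omega>. \<integral>\<^sup>+\<eta>. ?h (merge B A (\<omega>, \<eta>)) \<partial>PiM A (\<lambda>_. GOE d) \<partial>PiM B (\<lambda>_. GOE d))"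
  proof -
    have "(\<lambda>\<omega>. (clip d (?S B \<omega>), clip d (?S A \<omega>))) \<in> PiM {..<n} (\<lambda>_. GOE d) \<rightarrow>\<^sub>M mat_space d \<Otimes>\<^sub>M
        mat_space d"
      using A by (intro measurable_Pair signed_sum_measurable) (auto simp: B_def)
    from measurable_compose[OF this f]
    have "?h \<in> borel_measurable (PiM {..<n} (\<lambda>_. GOE d))"
      by (simp only: fst_conv snd_conv clip2)
    then show ?thesis
      using product_nn_integral_fold[OF AB(1) fin(2,1), of ?h] unfolding AB(2) by simp
  qed
  also have "\<dots> = (\<integral>\<^sup>+\<omega>. \<integral>\<^sup>+\<eta>. ?f (?S B \<omega>) (?S A \<eta>) \<partial>PiM A (\<lambda>_. GOE d) \<partial>PiM B (\<lambda>_. GOE d))"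
  proof (intro nn_integral_cong)
    fix \<omega> \<eta> :: "nat \<Rightarrow> rmat"
    have "?S B (merge B A (\<omega>, \<eta>)) ij = ?S B \<omega> ij" "?S A (merge B A (\<omega>, \<eta>)) ij = ?S A \<eta> ij" for ij
      using AB(1) by (auto simp: merge_def intro!: sum.cong)
    then show "?h (merge B A (\<omega>, \<eta>)) = ?f (?S B \<omega>) (?S A \<eta>)" by (simp only:)
  qed
  also have "\<dots> = (\<integral>\<^sup>+\<omega>. \<integral>\<^sup>+y. ?f (clip d (?S B \<omega>)) (\<lambda>ij. sqrt l * symm d y ij) \<partial>entries d \<partial>PiM B
      (\<lambda>_. GOE d))"
  proof (rule nn_integral_cong)
    fix \<omega> :: "nat \<Rightarrow> rmat"
    have sp: "clip d (?S B \<omega>) \<in> space (mat_space d)" by (auto simp: space_mat_space)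
    show "(\<integral>\<^sup>+\<eta>. ?f (?S B \<omega>) (?S A \<eta>) \<partial>PiM A (\<lambda>_. GOE d)) = (\<integral>\<^sup>+y. ?f (clip d (?S B \<omega>)) (\<lambda>ij. sqrt l
        * symm d y ij) \<partial>entries d)"
      using nn_integral_signed_sum[OF d fin(1) _ f1[OF sp], of \<epsilon>] \<epsilon> A unfolding clip2 by auto
  qed
  also have "\<dots> = (\<integral>\<^sup>+x. \<integral>\<^sup>+y. ?f (\<lambda>ij. sqrt (n - l) * symm d x ij) (\<lambda>ij. sqrt l * symm d y ij)
      \<partial>entries d \<partial>entries d)"
    using nn_integral_signed_sum[OF d fin(2) _ f2, of \<epsilon>] \<epsilon> unfolding clip2 cB by (auto simp: B_def)
  also have "\<dots> = (\<integral>\<^sup>+x. \<integral>\<^sup>+y. indicator {z. op_norm d (fst z) \<le> \<kappa> \<and>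
            op_norm d (\<lambda>ij. q * fst z ij + sqrt (1 - q\<^sup>2) * snd z ij) \<le> \<kappa>}
       (symm d (lin_entries d (sqrt (1 - l / n)) (sqrt (l / n)) x y), symm d (lin_entries d (sqrt
           (l / n)) (- sqrt (1 - l / n)) x y)) \<partial>entries d \<partial>entries d)"
  proof (intro nn_integral_cong)
    fix x y
    define p where "p = sqrt (1 - l / n)"
    define s where "s = sqrt (l / n)"
    have p2: "p * p = 1 - l / n" using ln n by (simp add: p_def)
    have s2: "s * s = l / n" by (simp add: s_def)
    have p0: "0 \<le> p" "0 \<le> s" using ln n by (auto simp: p_def s_def)
    have sn: "0 < sqrt n" using n by simp
    have pn: "sqrt (n - l) = sqrt n * p" "sqrt l = sqrt n * s"
      using ln n by (auto simp: p_def s_def real_sqrt_mult[symmetric] of_nat_diff field_simps)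
    have qps: "q = p * p - s * s" unfolding p2 s2 by (simp add: q_def)
    have "1 - q\<^sup>2 = (2 * p * s)\<^sup>2"
    proof -
      have ps1: "p * p + s * s = 1" by (simp add: p2 s2)
      have "1 - q\<^sup>2 = (p * p + s * s)\<^sup>2 - (p * p - s * s)\<^sup>2" unfolding ps1 qps by simp
      also have "\<dots> = (2 * p * s)\<^sup>2" by (simp add: power2_eq_square algebra_simps)
      finally show ?thesis .
    qed
    then have qs: "sqrt (1 - q\<^sup>2) = 2 * p * s" using p0 by simp
    let ?u = "symm d (lin_entries d p s x y)" and ?v = "symm d (lin_entries d s (- p) x y)"
    have 1: "op_norm d (?lin 1 1 (\<lambda>ij. sqrt (n - l) * symm d x ij) (\<lambda>ij. sqrt l * symm d y ij))
        = op_norm d (\<lambda>ij. sqrt n * ?u ij)"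
      by (rule op_norm_cong) (simp add: pn symm_apply lin_entries_def min_max_triangle algebra_simps)
    have 2: "op_norm d (?lin 1 (-1) (\<lambda>ij. sqrt (n - l) * symm d x ij) (\<lambda>ij. sqrt l * symm d y ij))
        = op_norm d (\<lambda>ij. sqrt n * (q * ?u ij + sqrt (1 - q\<^sup>2) * ?v ij))"
    proof (rule op_norm_cong)
      fix i j assume ij: "i < d" "j < d"
      have "q * (p * a + s * b) + 2 * p * s * (s * a + - p * b) = p * a - s * b" for a b
      proof -
        have "q * (p * a + s * b) + 2 * p * s * (s * a + - p * b) = (p * p + s * s) * (p * a - s * b)"
          unfolding qps by (simp add: algebra_simps)
        then show ?thesis by (simp add: p2 s2)
      qed
      then show "?lin 1 (-1) (\<lambda>ij. sqrt (n - l) * symm d x ij) (\<lambda>ij. sqrt l * symm d y ij) (i, j)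
          = sqrt n * (q * ?u (i, j) + sqrt (1 - q\<^sup>2) * ?v (i, j))"
        unfolding qs using ij by (simp add: pn symm_apply lin_entries_def min_max_triangle
            right_diff_distrib)
    qed
    show "?f (\<lambda>ij. sqrt (n - l) * symm d x ij) (\<lambda>ij. sqrt l * symm d y ij)
      = indicator {z. op_norm d (fst z) \<le> \<kappa> \<and>
            op_norm d (\<lambda>ij. q * fst z ij + sqrt (1 - q\<^sup>2) * snd z ij) \<le> \<kappa>}
       (symm d (lin_entries d (sqrt (1 - l / n)) (sqrt (l / n)) x y), symm d (lin_entries d (sqrt
           (l / n)) (- sqrt (1 - l / n)) x y))"
      unfolding p_def[symmetric] s_def[symmetric]
      by (simp only: indicator_def mem_Collect_eq 1 2 op_norm_scaled_le_iff[OF sn] fst_conv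
          snd_conv) auto
  qed
  also have "\<dots> = (\<integral>\<^sup>+x. \<integral>\<^sup>+y. indicator {z. op_norm d (fst z) \<le> \<kappa> \<and>
            op_norm d (\<lambda>ij. q * fst z ij + sqrt (1 - q\<^sup>2) * snd z ij) \<le> \<kappa>} (symm d x, symm d y)
                \<partial>entries d \<partial>entries d)"
  proof -
    let ?F = "\<lambda>z. indicator {z. op_norm d (fst z) \<le> \<kappa> \<and>
            op_norm d (\<lambda>ij. q * fst z ij + sqrt (1 - q\<^sup>2) * snd z ij) \<le> \<kappa>} (symm d (fst z), symm d
                (snd z)) :: ennreal"
    have "(\<lambda>z. indicator {z. op_norm d (fst z) \<le> \<kappa> \<and>
            op_norm d (\<lambda>ij. q * fst z ij + sqrt (1 - q\<^sup>2) * snd z ij) \<le> \<kappa>} z :: ennreal) \<in>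
                borel_measurable (mat_space d \<Otimes>\<^sub>M mat_space d)"
      unfolding indicator_def by measurable
    from measurable_compose[OF measurable_Pair[OF measurable_compose[OF measurable_fst
        symm_measurable] measurable_compose[OF measurable_snd symm_measurable]] this]
    have F: "?F \<in> borel_measurable (entries d \<Otimes>\<^sub>M entries d)" .
    have q1: "\<bar>sqrt (1 - l / n)\<bar> < 1"
      using l ln n by simp
    have c: "sqrt (1 - (sqrt (1 - l / n))\<^sup>2) = sqrt (l / n)"
      using ln n by simp
    show ?thesis
      using entries_rotation[OF d q1 F] unfolding c by simp
  qed
  also have "\<dots> = ennreal (pair_prob \<kappa> d q)"
    unfolding pair_prob_nn_integral[OF d]
    by (rule nn_integral_GOE_pair[OF d, symmetric]) (unfold indicator_def, measurable)
  finally show ?thesis .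
qed

section \<open>The moments of the number of solutions\<close>

text \<open>The terms of the binomial expansion of \<open>(l + (n - l))^n\<close> increase up to index \<open>l\<close> and
decrease afterwards.\<close>

lemma binomial_term_le_mode:
  assumes l: "0 < l" "l < n" and j: "j \<le> n"
  defines "t \<equiv> \<lambda>j. real (n choose j) * real l ^ j * real (n - l) ^ (n - j)"
  shows "t j \<le> t l"
proof -
  have t0: "0 \<le> t j" for j by (simp add: t_def)
  have pos: "0 < real (j + 1) * real (n - l)" for j using l by simp
  have step: "t (Suc j) * (real (j + 1) * real (n - l)) = t j * (real (n - j) * real l)" if "j <
      n" for j
  proof -
    have absorb: "real (n choose Suc j) * real (Suc j) = real (n choose j) * real (n - j)"
    proof -
      have "(n choose Suc j) * Suc j = (n choose j) * (n - j)"
        using binomial_absorb_comp[of n j] binomial_absorption[of j n] that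
        by (simp add: mult.commute)
      then show ?thesis by (simp only: of_nat_mult[symmetric])
    qed
    have pw: "real (n - l) ^ (n - j) = real (n - l) * real (n - l) ^ (n - Suc j)"
      using that by (simp add: Suc_diff_Suc flip: power_Suc)
    have "t (Suc j) * (real (j + 1) * real (n - l))
        = (real (n choose Suc j) * real (Suc j)) * (real l * real l ^ j * (real (n - l) ^ (n - Suc
            j) * real (n - l)))"
      by (simp add: t_def)
    also have "\<dots> = t j * (real (n - j) * real l)"
      unfolding absorb t_def pw by (simp only: mult_ac)
    finally show ?thesis .
  qed
  have up: "t j \<le> t (Suc j)" if "j < l" for j
  proof -
    have jn: "j < n" using that l by simp
    have "real (j + 1) * real (n - l) \<le> real (n - j) * real l"
    proof -
      have "real n * real (j + 1) \<le> real n * real l"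
        using that by (intro mult_left_mono) auto
      then show ?thesis using jn l by (simp add: of_nat_diff algebra_simps)
    qed
    then have "t j * (real (j + 1) * real (n - l)) \<le> t (Suc j) * (real (j + 1) * real (n - l))"
      unfolding step[OF jn] by (intro mult_left_mono t0)
    then show ?thesis using pos[of j] by (rule mult_right_le_imp_le)
  qed
  have down: "t (Suc j) \<le> t j" if "l \<le> j" "j < n" for j
  proof -
    have "real (n - j) * real l \<le> real (j + 1) * real (n - l)"
    proof -
      have "real n * real l \<le> real n * real j"
        using that by (intro mult_left_mono) auto
      moreover have "real l \<le> real n" using l by simp
      moreover have "real (n - j) * real l = real n * real l - real j * real l"
        "real (j + 1) * real (n - l) = real n * real j + real n - real j * real l - real l"
        using that l by (simp_all add: of_nat_diff algebra_simps)
      ultimately show ?thesis by linarith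
    qed
    then have "t (Suc j) * (real (j + 1) * real (n - l)) \<le> t j * (real (j + 1) * real (n - l))"
      unfolding step[OF that(2)] by (intro mult_left_mono t0)
    then show ?thesis using pos[of j] by (rule mult_right_le_imp_le)
  qed
  show ?thesis
  proof (cases "j \<le> l")
    case True
    then show ?thesis
      by (induction rule: inc_induct) (use up order_trans in blast)+
  next
    case False
    have "l \<le> j" using False by simp
    then show ?thesis
      using j
    proof (induction rule: dec_induct)
      case (step m)
      then show ?case using down[of m] by simp
    qed simp
  qed
qed

text \<open>The large deviation rate function of the mean of independent symmetric random signs.\<close>

definition cramer_rate :: "real \<Rightarrow> real" where
  "cramer_rate q = (1 + q) / 2 * ln (1 + q) + (1 - q) / 2 * ln (1 - q)"

text \<open>The largest of the \<open>n + 1\<close> terms of the binomial expansion of \<open>n^n\<close> is at least their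
average.\<close>

lemma binomial_entropy_bound:
  assumes l: "0 < l" "l < n"
  shows "real n * ln 2 - real n * cramer_rate (1 - 2 * real l / real n) - ln (real n + 1) \<le> ln
      (real (n choose l))"
proof -
  let ?t = "\<lambda>j. real (n choose j) * real l ^ j * real (n - l) ^ (n - j)"
  have n: "0 < n" using l by simp
  have "real n ^ n = (real l + real (n - l)) ^ n" using l by (simp add: of_nat_diff)
  also have "\<dots> = (\<Sum>j\<le>n. ?t j)" by (simp add: binomial_ring)
  also have "\<dots> \<le> (\<Sum>j\<le>n. ?t l)"
    by (intro sum_mono binomial_term_le_mode l) simp
  also have "\<dots> = (real n + 1) * ?t l" by simp
  finally have "ln (real n ^ n) \<le> ln ((real n + 1) * ?t l)"
    using n l by (subst ln_le_cancel_iff) auto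
  then have "n * ln n \<le> ln (real n + 1) + ln (real (n choose l)) + l * ln l + (n - l) * ln (n - l)"
    using l n by (simp add: ln_mult ln_realpow)
  moreover have "real n * ln 2 - real n * cramer_rate (1 - 2 * real l / real n) = n * ln n - l *
      ln l - (n - l) * ln (n - l)"
  proof -
    have a: "1 - (1 - 2 * real l / real n) = 2 * (l / n)" "1 + (1 - 2 * real l / real n) = 2 * ((n
        - l) / n)"
      using l n by (auto simp: of_nat_diff field_simps)
    have ln2: "ln (2 * (x / y)) = ln 2 + ln x - ln y" if "0 < x" "0 < y" for x y :: real
      using that by (simp add: ln_mult ln_div)
    have "ln (2 * (l / n)) = ln 2 + ln l - ln n" "ln (2 * ((n - l) / n)) = ln 2 + ln (n - l) - ln n"
      by (rule ln2; use l n in simp)+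
    moreover have "real n * (2 * (x / n) / 2 * La + 2 * (y / n) / 2 * Lb) = x * La + y * Lb" for x
        y La Lb :: real
      using n by (simp add: field_simps)
    ultimately have "real n * cramer_rate (1 - 2 * real l / real n) = (n - l) * (ln 2 + ln (n - l)
        - ln n) + l * (ln 2 + ln l - ln n)"
      unfolding cramer_rate_def a by (simp only:)
    also have "\<dots> = n * ln 2 - n * ln n + l * ln l + (n - l) * ln (n - l)"
      using l by (simp add: of_nat_diff algebra_simps)
    finally show ?thesis by simp
  qed
  ultimately show ?thesis by simp
qed

lemma cramer_rate_deriv:
  assumes "\<bar>q\<bar> < 1"
  shows "(cramer_rate has_real_derivative (ln (1 + q) - ln (1 - q)) / 2) (at q)"
    "((\<lambda>q. (ln (1 + q) - ln (1 - q)) / 2) has_real_derivative 1 / (1 - q\<^sup>2)) (at q)"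
proof -
  have p: "0 < 1 + q" "0 < 1 - q" using assms by auto
  show "(cramer_rate has_real_derivative (ln (1 + q) - ln (1 - q)) / 2) (at q)"
    unfolding cramer_rate_def[abs_def]
    by (rule derivative_eq_intros refl p | (use p in \<open>simp add: field_simps\<close>; fail))+
  have "1 - q\<^sup>2 = (1 + q) * (1 - q)" by (simp add: power2_eq_square algebra_simps)
  then have "(1 / (1 + q) + 1 / (1 - q)) / 2 = 1 / (1 - q\<^sup>2)"
    using p by (simp add: add_frac_eq)
  moreover have "((\<lambda>q. (ln (1 + q) - ln (1 - q)) / 2) has_real_derivative (1 / (1 + q) + 1 / (1 -
      q)) / 2) (at q)"
    using p by (auto intro!: derivative_eq_intros simp: inverse_eq_divide)
  ultimately show "((\<lambda>q. (ln (1 + q) - ln (1 - q)) / 2) has_real_derivative 1 / (1 - q\<^sup>2)) (at q)"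
    by (simp only:)
qed

lemma second_order_growth:
  fixes f f1 f2 :: "real \<Rightarrow> real"
  assumes "\<And>x. x \<in> {0..b} \<Longrightarrow> (f has_real_derivative f1 x) (at x)"
    and "\<And>x. x \<in> {0..b} \<Longrightarrow> (f1 has_real_derivative f2 x) (at x)"
    and "\<And>x. x \<in> {0..b} \<Longrightarrow> c \<le> f2 x"
    and "f 0 = 0" "f1 0 = 0" and q: "0 \<le> q" "q \<le> b"
  shows "c * q\<^sup>2 / 2 \<le> f q"
proof -
  have f1: "c * x \<le> f1 x" if x: "0 \<le> x" "x \<le> b" for x
  proof -
    have "f1 0 - c * 0 \<le> f1 x - c * x"
    proof (rule DERIV_nonneg_imp_nondecreasing[OF x(1)])
      fix y assume "0 \<le> y" "y \<le> x"
      then have "y \<in> {0..b}" using x by auto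
      then show "\<exists>z. ((\<lambda>x. f1 x - c * x) has_real_derivative z) (at y) \<and> 0 \<le> z"
        using assms(2,3)[of y] by (intro exI[of _ "f2 y - c"]) (auto intro!: derivative_eq_intros)
    qed
    then show ?thesis using assms(5) by simp
  qed
  have "f 0 - c * 0\<^sup>2 / 2 \<le> f q - c * q\<^sup>2 / 2"
  proof (rule DERIV_nonneg_imp_nondecreasing[OF q(1)])
    fix y assume "0 \<le> y" "y \<le> q"
    then have "y \<in> {0..b}" using q by auto
    then show "\<exists>z. ((\<lambda>x. f x - c * x\<^sup>2 / 2) has_real_derivative z) (at y) \<and> 0 \<le> z"
      using assms(1)[of y] f1[of y] by (intro exI[of _ "f1 y - c * y"]) (auto intro!:
          derivative_eq_intros)
  qed
  then show ?thesis using assms(4) by simp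
qed

locale iid_GOE = prob_space M for M :: "'a measure" +
  fixes d n :: nat and W :: "nat \<Rightarrow> 'a \<Rightarrow> rmat"
  assumes d: "1 \<le> d" and n: "1 \<le> n"
    and indep: "indep_vars (\<lambda>_. mat_space d) W {..<n}"
    and law: "\<And>i. i < n \<Longrightarrow> distr M (mat_space d) (W i) = GOE d"
begin

lemma W_measurable: "i < n \<Longrightarrow> W i \<in> M \<rightarrow>\<^sub>M mat_space d"
  using indep by (auto simp: indep_vars_def)

lemma sets_PiM_GOE: "sets (PiM {..<n} (\<lambda>_. GOE d)) = sets (PiM {..<n} (\<lambda>_. mat_space d))"
  by (intro sets_PiM_cong) auto

lemma joint_measurable: "(\<lambda>\<omega>. \<lambda>i\<in>{..<n}. W i \<omega>) \<in> M \<rightarrow>\<^sub>M PiM {..<n} (\<lambda>_. mat_space d)"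
  by (intro measurable_restrict W_measurable) auto

lemma joint_law: "distr M (PiM {..<n} (\<lambda>_. mat_space d)) (\<lambda>\<omega>. \<lambda>i\<in>{..<n}. W i \<omega>) = PiM {..<n} (\<lambda>_.
    GOE d)"
proof -
  have "{..<n} \<noteq> {}" using n by (auto simp: lessThan_empty_iff)
  then have "distr M (PiM {..<n} (\<lambda>_. mat_space d)) (\<lambda>\<omega>. \<lambda>i\<in>{..<n}. W i \<omega>)
      = PiM {..<n} (\<lambda>i. distr M (mat_space d) (W i))"
    using indep_vars_iff_distr_eq_PiM'[of "{..<n}" W "\<lambda>_. mat_space d"] W_measurable indep by simp
  also have "\<dots> = PiM {..<n} (\<lambda>_. GOE d)"
    using law by (intro PiM_cong) auto
  finally show ?thesis .
qed

lemma nn_integral_joint: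
  assumes "f \<in> borel_measurable (PiM {..<n} (\<lambda>_. GOE d))"
  shows "(\<integral>\<^sup>+\<omega>. f (\<lambda>i\<in>{..<n}. W i \<omega>) \<partial>M) = (\<integral>\<^sup>+\<eta>. f \<eta> \<partial>PiM {..<n} (\<lambda>_. GOE d))"
  unfolding joint_law[symmetric]
  by (rule nn_integral_distr[symmetric, OF joint_measurable])
    (use assms in \<open>simp add: measurable_cong_sets[OF sets_PiM_GOE refl]\<close>)

definition sign_vectors :: "(nat \<Rightarrow> real) set" where
  "sign_vectors = {..<n} \<rightarrow>\<^sub>E {-1, 1}"

definition solves :: "real \<Rightarrow> (nat \<Rightarrow> real) \<Rightarrow> (nat \<Rightarrow> rmat) \<Rightarrow> bool" where
  "solves \<kappa> \<epsilon> \<eta> \<longleftrightarrow> op_norm d (\<lambda>ij. \<Sum>i<n. \<epsilon> i * \<eta> i ij) \<le> \<kappa> * sqrt n"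

lemma finite_sign_vectors: "finite sign_vectors"
  by (simp add: sign_vectors_def finite_PiE)

lemma card_sign_vectors: "card sign_vectors = 2 ^ n"
  by (simp add: sign_vectors_def card_PiE numeral_2_eq_2)

lemma solves_measurable: "Measurable.pred (PiM {..<n} (\<lambda>_. GOE d)) (solves \<kappa> \<epsilon>)"
proof -
  have "(\<lambda>\<eta>. op_norm d (clip d (\<lambda>ij. \<Sum>i<n. \<epsilon> i * \<eta> i ij))) \<in> borel_measurable (PiM {..<n} (\<lambda>_. GOE d))"
    by (rule measurable_compose[OF signed_sum_measurable[OF order_refl] op_norm_measurable])
  then have [measurable]: "(\<lambda>\<eta>. op_norm d (\<lambda>ij. \<Sum>i<n. \<epsilon> i * \<eta> i ij)) \<in> borel_measurable (PiM
      {..<n} (\<lambda>_. GOE d))"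
    unfolding op_norm_lin_restrict .
  show ?thesis
    unfolding solves_def[abs_def] by measurable
qed

lemma of_bool_solves_measurable:
  "(\<lambda>\<eta>. of_bool (solves \<kappa> \<epsilon> \<eta>) :: ennreal) \<in> borel_measurable (PiM {..<n} (\<lambda>_. GOE d))"
  by (rule measurable_compose[OF solves_measurable]) simp

lemma solves_W_measurable [measurable]: "Measurable.pred M (\<lambda>\<omega>. solves \<kappa> \<epsilon> (\<lambda>i. W i \<omega>))"
proof -
  have "(\<lambda>\<omega>. \<lambda>i\<in>{..<n}. W i \<omega>) \<in> M \<rightarrow>\<^sub>M PiM {..<n} (\<lambda>_. GOE d)"
    using joint_measurable by (simp add: measurable_cong_sets[OF refl sets_PiM_GOE])
  from measurable_compose[OF this solves_measurable]
  show ?thesis by (simp add: solves_def)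
qed

lemma num_solutions_eq:
  "real (num_solutions \<kappa> d n (\<lambda>i. W i \<omega>)) = (\<Sum>\<epsilon>\<in>sign_vectors. of_bool (solves \<kappa> \<epsilon> (\<lambda>i. W i \<omega>)))"
  unfolding num_solutions_def solves_def sign_vectors_def
  by (simp add: of_bool_def sum.If_cases finite_PiE Int_def)

lemma expectation_solves:
  assumes "\<epsilon> \<in> sign_vectors"
  shows "expectation (\<lambda>\<omega>. of_bool (solves \<kappa> \<epsilon> (\<lambda>i. W i \<omega>))) = single_prob \<kappa> d"
proof -
  have \<epsilon>: "\<And>i. i < n \<Longrightarrow> \<epsilon> i \<in> {-1, 1}" using assms by (auto simp: sign_vectors_def PiE_iff)
  have "(\<integral>\<^sup>+\<omega>. ennreal (of_bool (solves \<kappa> \<epsilon> (\<lambda>i. W i \<omega>))) \<partial>M)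
      = (\<integral>\<^sup>+\<omega>. of_bool (solves \<kappa> \<epsilon> (\<lambda>i\<in>{..<n}. W i \<omega>)) \<partial>M)"
    by (intro nn_integral_cong) (simp add: solves_def)
  also have "\<dots> = (\<integral>\<^sup>+\<eta>. of_bool (solves \<kappa> \<epsilon> \<eta>) \<partial>PiM {..<n} (\<lambda>_. GOE d))"
    by (rule nn_integral_joint[OF of_bool_solves_measurable])
  also have "\<dots> = ennreal (single_prob \<kappa> d)"
    by (rule trans[OF _ single_sum_prob[OF d n \<epsilon>]])
      (auto intro!: nn_integral_cong simp: solves_def indicator_def)
  finally show ?thesis
    by (subst integral_eq_nn_integral) (auto simp: single_prob_def)
qed

lemma expectation_num_solutions:
  "expectation (\<lambda>\<omega>. real (num_solutions \<kappa> d n (\<lambda>i. W i \<omega>))) = 2 ^ n * single_prob \<kappa> d"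
proof -
  have "expectation (\<lambda>\<omega>. real (num_solutions \<kappa> d n (\<lambda>i. W i \<omega>)))
      = (\<Sum>\<epsilon>\<in>sign_vectors. expectation (\<lambda>\<omega>. of_bool (solves \<kappa> \<epsilon> (\<lambda>i. W i \<omega>))))"
    unfolding num_solutions_eq
    by (rule Bochner_Integration.integral_sum) (auto intro!: integrable_const_bound[of _ 1])
  also have "\<dots> = 2 ^ n * single_prob \<kappa> d"
    by (simp add: expectation_solves card_sign_vectors)
  finally show ?thesis .
qed

definition flip :: "(nat \<Rightarrow> real) \<Rightarrow> nat set \<Rightarrow> nat \<Rightarrow> real" where
  "flip \<epsilon> A = (\<lambda>i\<in>{..<n}. if i \<in> A then - \<epsilon> i else \<epsilon> i)"

lemma expectation_solves_pair:
  assumes "\<epsilon> \<in> sign_vectors" and A: "A \<subseteq> {..<n}" "card A = l" "1 \<le> l"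
  shows "expectation (\<lambda>\<omega>. of_bool (solves \<kappa> \<epsilon> (\<lambda>i. W i \<omega>)) * of_bool (solves \<kappa> (flip \<epsilon> A) (\<lambda>i. W i \<omega>)))
    = pair_prob \<kappa> d (1 - 2 * real l / real n)"
proof -
  have \<epsilon>: "\<And>i. i < n \<Longrightarrow> \<epsilon> i \<in> {-1, 1}" using assms by (auto simp: sign_vectors_def PiE_iff)
  have "(\<integral>\<^sup>+\<omega>. ennreal (of_bool (solves \<kappa> \<epsilon> (\<lambda>i. W i \<omega>)) * of_bool (solves \<kappa> (flip \<epsilon> A) (\<lambda>i. W i \<omega>))) \<partial>M)
      = (\<integral>\<^sup>+\<omega>. of_bool (solves \<kappa> \<epsilon> (\<lambda>i\<in>{..<n}. W i \<omega>)) * of_bool (solves \<kappa> (flip \<epsilon> A) (\<lambda>i\<in>{..<n}. W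
          i \<omega>)) \<partial>M)"
    by (intro nn_integral_cong) (simp add: solves_def)
  also have "\<dots> = (\<integral>\<^sup>+\<eta>. of_bool (solves \<kappa> \<epsilon> \<eta>) * of_bool (solves \<kappa> (flip \<epsilon> A) \<eta>) \<partial>PiM {..<n} (\<lambda>_.
      GOE d))"
    by (rule nn_integral_joint[OF borel_measurable_times_ennreal[OF of_bool_solves_measurable
        of_bool_solves_measurable]])
  also have "\<dots> = ennreal (pair_prob \<kappa> d (1 - 2 * real l / real n))"
    by (rule trans[OF _ pair_sum_prob[OF d \<epsilon> A]])
      (auto intro!: nn_integral_cong simp: solves_def indicator_def flip_def)
  finally show ?thesis
    by (subst integral_eq_nn_integral) (auto simp: pair_prob_def)
qed

text \<open>The second moment counts pairs of sign vectors; only those that differ in exactly \<open>l\<close>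
places are kept.\<close>

lemma second_moment_lower_bound:
  assumes l: "1 \<le> l"
  shows "2 ^ n * (real (n choose l) * pair_prob \<kappa> d (1 - 2 * real l / real n))
    \<le> expectation (\<lambda>\<omega>. (real (num_solutions \<kappa> d n (\<lambda>i. W i \<omega>)))\<^sup>2)"
proof -
  let ?X = "\<lambda>\<epsilon> \<omega>. of_bool (solves \<kappa> \<epsilon> (\<lambda>i. W i \<omega>)) :: real"
  let ?A = "{A. A \<subseteq> {..<n} \<and> card A = l}"
  have int: "integrable M (\<lambda>\<omega>. ?X \<epsilon> \<omega> * ?X \<epsilon>' \<omega>)" for \<epsilon> \<epsilon>'
    by (rule integrable_const_bound[of _ 1]) auto
  have inner: "real (n choose l) * pair_prob \<kappa> d (1 - 2 * real l / real n)
      \<le> (\<Sum>\<epsilon>'\<in>sign_vectors. expectation (\<lambda>\<omega>. ?X \<epsilon> \<omega> * ?X \<epsilon>' \<omega>))" if \<epsilon>: "\<epsilon> \<in> sign_vectors" for \<epsilon>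
  proof -
    have ne: "\<epsilon> i \<noteq> 0" "\<epsilon> i \<in> {-1, 1}" if "i < n" for i
      using \<epsilon> that by (force simp: sign_vectors_def PiE_iff)+
    have inj: "inj_on (flip \<epsilon>) ?A"
    proof (rule inj_onI)
      fix A B assume A: "A \<in> ?A" and B: "B \<in> ?A" and eq: "flip \<epsilon> A = flip \<epsilon> B"
      have "i \<in> A \<longleftrightarrow> i \<in> B" if "i < n" for i
        using fun_cong[OF eq, of i] ne(1)[OF that] that by (auto simp: flip_def split: if_splits)
      then show "A = B" using A B by auto
    qed
    have sub: "flip \<epsilon> ` ?A \<subseteq> sign_vectors"
      using ne(2) by (fastforce simp: flip_def sign_vectors_def)
    have "real (n choose l) * pair_prob \<kappa> d (1 - 2 * real l / real n)
        = (\<Sum>A\<in>?A. expectation (\<lambda>\<omega>. ?X \<epsilon> \<omega> * ?X (flip \<epsilon> A) \<omega>))"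
      using n_subsets[of "{..<n}" l] by (simp add: expectation_solves_pair[OF \<epsilon> _ _ l])
    also have "\<dots> = (\<Sum>\<epsilon>'\<in>flip \<epsilon> ` ?A. expectation (\<lambda>\<omega>. ?X \<epsilon> \<omega> * ?X \<epsilon>' \<omega>))"
      by (simp add: sum.reindex[OF inj])
    also have "\<dots> \<le> (\<Sum>\<epsilon>'\<in>sign_vectors. expectation (\<lambda>\<omega>. ?X \<epsilon> \<omega> * ?X \<epsilon>' \<omega>))"
      by (intro sum_mono2 finite_sign_vectors sub) (simp add: integral_nonneg_AE)
    finally show ?thesis .
  qed
  have "2 ^ n * (real (n choose l) * pair_prob \<kappa> d (1 - 2 * real l / real n))
      = (\<Sum>\<epsilon>\<in>sign_vectors. real (n choose l) * pair_prob \<kappa> d (1 - 2 * real l / real n))"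
    by (simp add: card_sign_vectors)
  also have "\<dots> \<le> (\<Sum>\<epsilon>\<in>sign_vectors. \<Sum>\<epsilon>'\<in>sign_vectors. expectation (\<lambda>\<omega>. ?X \<epsilon> \<omega> * ?X \<epsilon>' \<omega>))"
    by (intro sum_mono inner)
  also have "\<dots> = expectation (\<lambda>\<omega>. \<Sum>\<epsilon>\<in>sign_vectors. \<Sum>\<epsilon>'\<in>sign_vectors. ?X \<epsilon> \<omega> * ?X \<epsilon>' \<omega>)"
    by (rule integral_double_sum[symmetric]) (rule int)
  also have "\<dots> = expectation (\<lambda>\<omega>. (real (num_solutions \<kappa> d n (\<lambda>i. W i \<omega>)))\<^sup>2)"
    unfolding num_solutions_eq power2_eq_square sum_product ..
  finally show ?thesis .
qed

lemma log_moment_ratio_lower_bound: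
  assumes \<kappa>: "0 < \<kappa>" and l: "0 < l" "l < n"
  defines "q \<equiv> 1 - 2 * real l / real n"
  assumes pos: "0 < pair_prob \<kappa> d q"
  shows "n * (G \<kappa> d n q - cramer_rate q) - ln (real n + 1)
    \<le> ln (expectation (\<lambda>\<omega>. (real (num_solutions \<kappa> d n (\<lambda>i. W i \<omega>)))\<^sup>2)
        / (expectation (\<lambda>\<omega>. real (num_solutions \<kappa> d n (\<lambda>i. W i \<omega>))))\<^sup>2)"
proof -
  let ?P = "single_prob \<kappa> d"
  let ?E = "expectation (\<lambda>\<omega>. (real (num_solutions \<kappa> d n (\<lambda>i. W i \<omega>)))\<^sup>2)"
  have P: "0 < ?P" by (rule single_prob_pos[OF d \<kappa>])
  have C: "0 < real (n choose l)" using l by simp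
  have "2 ^ n * (real (n choose l) * pair_prob \<kappa> d q) \<le> ?E"
    unfolding q_def by (rule second_moment_lower_bound) (use l in simp)
  then have "2 ^ n * (real (n choose l) * pair_prob \<kappa> d q) / (2 ^ n * ?P)\<^sup>2 \<le> ?E / (2 ^ n * ?P)\<^sup>2"
    by (intro divide_right_mono) auto
  moreover have "0 < 2 ^ n * (real (n choose l) * pair_prob \<kappa> d q) / (2 ^ n * ?P)\<^sup>2"
    using C P pos by simp
  ultimately have "ln (2 ^ n * (real (n choose l) * pair_prob \<kappa> d q) / (2 ^ n * ?P)\<^sup>2) \<le> ln (?E /
      (2 ^ n * ?P)\<^sup>2)"
    by (subst ln_le_cancel_iff) auto
  moreover have "ln (2 ^ n * (real (n choose l) * pair_prob \<kappa> d q) / (2 ^ n * ?P)\<^sup>2)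
      = ln (real (n choose l)) - n * ln 2 + ln (pair_prob \<kappa> d q / ?P\<^sup>2)"
    using C P pos by (simp add: ln_mult ln_div ln_realpow)
  moreover have "n * G \<kappa> d n q = ln (pair_prob \<kappa> d q / ?P\<^sup>2)"
    using l by (simp add: G_eq)
  ultimately show ?thesis
    using binomial_entropy_bound[OF l] unfolding expectation_num_solutions q_def[symmetric]
    by (simp add: right_diff_distrib)
qed

end

section \<open>Exponential growth of the moment ratio\<close>

text \<open>The overlaps \<open>1 - 2 l / n\<close> have spacing \<open>2 / n\<close>.\<close>

lemma overlap_near:
  fixes \<epsilon> :: real
  assumes \<epsilon>: "0 < \<epsilon>" "\<epsilon> < 1" and n: "4 / \<epsilon> \<le> real n"
  obtains l where "0 < l" "l < n" "\<epsilon> / 2 \<le> 1 - 2 * real l / real n" "1 - 2 * real l / real n \<le> \<epsilon>"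
proof -
  have n4: "4 \<le> real n * \<epsilon>" using n \<epsilon> by (simp add: field_simps)
  have n0: "0 < real n" using n \<epsilon> by (smt (verit) divide_pos_pos)
  define l where "l = nat \<lceil>real n * (1 - \<epsilon>) / 2\<rceil>"
  have x0: "0 < real n * (1 - \<epsilon>) / 2" using n0 \<epsilon> by simp
  have lo: "real n * (1 - \<epsilon>) / 2 \<le> real l" unfolding l_def using x0 by linarith
  have hi: "real l \<le> real n * (1 - \<epsilon>) / 2 + 1" unfolding l_def using x0 by linarith
  have l0: "0 < l" using lo x0 by linarith
  have ln: "real l * 2 \<le> real n * (1 - \<epsilon> / 2)"
  proof -
    have e: "real n * (1 - \<epsilon> / 2) = real n * (1 - \<epsilon>) + real n * \<epsilon> / 2"
      by (simp add: algebra_simps)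
    show ?thesis unfolding e using hi n4 by linarith
  qed
  have "real n * (1 - \<epsilon> / 2) < real n * 2" using n0 \<epsilon> by (intro mult_strict_left_mono) auto
  then have "l < n" using ln by linarith
  moreover have "\<epsilon> / 2 \<le> 1 - 2 * real l / real n" using ln n0 by (simp add: field_simps)
  moreover have "1 - 2 * real l / real n \<le> \<epsilon>" using lo n0 by (simp add: field_simps)
  ultimately show thesis using that l0 by blast
qed

lemma curvature_limit:
  assumes n: "filterlim n at_top sequentially" and \<tau>: "0 < \<tau>"
    and lim: "(\<lambda>d. real (n d) / (real d)\<^sup>2) \<longlonglongrightarrow> \<tau>"
  shows "(\<lambda>d. (real d) ^ 3 / (2 * (real d + 1) * n d) * e) \<longlonglongrightarrow> e / (2 * \<tau>)"
proof -
  have "(\<lambda>d. real d / (real d + 1)) \<longlonglongrightarrow> 1" by real_asymp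
  then have "(\<lambda>d. real d / (real d + 1) * (e / 2) / (real (n d) / (real d)\<^sup>2)) \<longlonglongrightarrow> 1 * (e / 2) / \<tau>"
    using \<tau> lim by (intro tendsto_intros) auto
  moreover have "\<forall>\<^sub>F d in sequentially. real d / (real d + 1) * (e / 2) / (real (n d) / (real d)\<^sup>2)
      = (real d) ^ 3 / (2 * (real d + 1) * n d) * e"
    by (intro always_eventually allI) (simp add: power3_eq_cube power2_eq_square mult_ac)
  ultimately show ?thesis
    by (simp add: filterlim_cong)
qed

theorem theorem1p9:
  fixes \<kappa> \<tau> :: real
    and n :: "nat \<Rightarrow> nat"
    and M :: "nat \<Rightarrow> 'a measure"
    and W :: "nat \<Rightarrow> nat \<Rightarrow> 'a \<Rightarrow> rmat"
  assumes "0 < \<kappa>" and "\<kappa> \<le> 2"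
    and "filterlim n at_top sequentially"
    and "0 < \<tau>"
    and "(\<lambda>d. real (n d) / (real d)\<^sup>2) \<longlonglongrightarrow> \<tau>"
    and "\<And>d. d \<ge> 1 \<Longrightarrow> prob_space (M d)"
    and "\<And>d. d \<ge> 1 \<Longrightarrow> prob_space.indep_vars (M d) (\<lambda>_. mat_space d) (W d) {..<n d}"
    and "\<And>d i. d \<ge> 1 \<Longrightarrow> i < n d \<Longrightarrow> distr (M d) (mat_space d) (W d i) = GOE d"
    and "((\<lambda>\<epsilon>::real. limsup (\<lambda>d. SUP q\<in>{- \<epsilon>..\<epsilon>}.
            ereal \<bar>deriv (deriv (G \<kappa> d (n d))) q - deriv (deriv (G \<kappa> d (n d))) 0\<bar>))
          \<longlongrightarrow> 0) (at_right 0)"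
    and "\<tau> < tau_f \<kappa>"
  shows "liminf (\<lambda>d. ereal (1 / (real d)\<^sup>2 *
            ln ((\<integral>\<omega>. (real (num_solutions \<kappa> d (n d) (\<lambda>i. W d i \<omega>)))\<^sup>2 \<partial>M d)
                / (\<integral>\<omega>. real (num_solutions \<kappa> d (n d) (\<lambda>i. W d i \<omega>)) \<partial>M d)\<^sup>2))) > 0"
proof -
  have \<kappa>: "0 < \<kappa>" "\<kappa> < 2"
  proof -
    \<comment> \<open>For \<open>\<kappa> = 2\<close> the threshold \<open>tau_f\<close> is \<open>0\<close> and no positive \<open>\<tau>\<close> lies below it.\<close>
    have "\<kappa> \<noteq> 2" using assms(4,10) by (auto simp: tau_f_def)
    then show "0 < \<kappa>" "\<kappa> < 2" using assms(1,2) by auto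
  qed
  \<comment> \<open>The lower bound for the curvature at \<open>0\<close> tends to \<open>1 + 4 c\<close>. One \<open>c\<close> each is spent on the
      limit in \<open>d\<close>, on the
    oscillation of \<open>G''\<close> and on the growth of the second derivative \<open>1 / (1 - q^2)\<close> of the rate, which
    leaves \<open>c\<close>.\<close>
  define c where "c = (tau_f \<kappa> / \<tau> - 1) / 4"
  have c: "0 < c" using assms(4,10) by (simp add: c_def)
  let ?D2 = "\<lambda>d. deriv (deriv (G \<kappa> d (n d)))"
  have curv: "\<forall>\<^sub>F d in sequentially. 1 + 3 * c < (real d) ^ 3 / (2 * (real d + 1) * n d) * (1 - \<kappa>\<^sup>2
      / 4) ^ 4"
  proof (rule order_tendstoD(1)[OF curvature_limit[OF assms(3,4,5)]])
    have "(\<kappa>\<^sup>2 / 4 - 1) ^ 4 = (1 - \<kappa>\<^sup>2 / 4) ^ 4"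
      using power_minus_even[of 4 "1 - \<kappa>\<^sup>2 / 4"] by simp
    then have "(1 - \<kappa>\<^sup>2 / 4) ^ 4 / (2 * \<tau>) = tau_f \<kappa> / \<tau>"
      by (simp add: tau_f_def)
    also have "\<dots> = 1 + 4 * c"
      by (simp add: c_def diff_divide_distrib)
    finally show "1 + 3 * c < (1 - \<kappa>\<^sup>2 / 4) ^ 4 / (2 * \<tau>)" using c by simp
  qed
  have "\<forall>\<^sub>F \<epsilon>::real in at_right 0. limsup (\<lambda>d. SUP q\<in>{- \<epsilon>..\<epsilon>}. ereal \<bar>?D2 d q - ?D2 d 0\<bar>) < ereal c"
    using order_tendstoD(2)[OF assms(9), of "ereal c"] c by simp
  moreover have "\<forall>\<^sub>F \<epsilon>::real in at_right 0. 1 / (1 - \<epsilon>\<^sup>2) < 1 + c"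
  proof (rule order_tendstoD(2))
    show "((\<lambda>\<epsilon>::real. 1 / (1 - \<epsilon>\<^sup>2)) \<longlongrightarrow> 1 / (1 - 0\<^sup>2)) (at_right 0)"
      by (intro tendsto_intros) auto
  qed (use c in simp)
  moreover have "\<forall>\<^sub>F \<epsilon>::real in at_right 0. 0 < \<epsilon> \<and> \<epsilon> < 1 / 2"
    using eventually_at_right_less[of "0::real"] eventually_at_right_real[of 0 "1/2::real"]
    by (auto elim: eventually_elim2)
  ultimately have "\<forall>\<^sub>F \<epsilon>::real in at_right 0. limsup (\<lambda>d. SUP q\<in>{- \<epsilon>..\<epsilon>}. ereal \<bar>?D2 d q - ?D2 d
      0\<bar>) < ereal c
      \<and> 1 / (1 - \<epsilon>\<^sup>2) < 1 + c \<and> 0 < \<epsilon> \<and> \<epsilon> < 1 / 2"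
    by eventually_elim auto
  then obtain \<epsilon> :: real where \<epsilon>: "limsup (\<lambda>d. SUP q\<in>{- \<epsilon>..\<epsilon>}. ereal \<bar>?D2 d q - ?D2 d 0\<bar>) < ereal c"
      "1 / (1 - \<epsilon>\<^sup>2) < 1 + c" "0 < \<epsilon>" "\<epsilon> < 1 / 2"
    using eventually_happens'[OF trivial_limit_at_right_real] by blast
  have osc: "\<forall>\<^sub>F d in sequentially. (SUP q\<in>{- \<epsilon>..\<epsilon>}. ereal \<bar>?D2 d q - ?D2 d 0\<bar>) < ereal c"
    using Limsup_lessD[OF \<epsilon>(1)] .
  let ?r = "\<lambda>d. 1 / (real d)\<^sup>2 *
            ln ((\<integral>\<omega>. (real (num_solutions \<kappa> d (n d) (\<lambda>i. W d i \<omega>)))\<^sup>2 \<partial>M d)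
                / (\<integral>\<omega>. real (num_solutions \<kappa> d (n d) (\<lambda>i. W d i \<omega>)) \<partial>M d)\<^sup>2)"
  let ?b = "\<lambda>d. real (n d) / (real d)\<^sup>2 * (c * \<epsilon>\<^sup>2 / 8 - ln (real (n d) + 1) / real (n d))"
  have n_large: "\<forall>\<^sub>F d in sequentially. 4 / \<epsilon> \<le> real (n d)"
    using filterlim_compose[OF filterlim_real_sequentially assms(3)] by (simp add: filterlim_at_top)
  have lower: "\<forall>\<^sub>F d in sequentially. ?b d \<le> ?r d"
    using curv osc n_large eventually_ge_at_top[of 1]
  proof eventually_elim
    case (elim d)
    have d: "1 \<le> d" by fact
    have "0 < 4 / \<epsilon>" using \<epsilon> by simp
    then have n: "1 \<le> n d" using elim(3) by linarith
    obtain G1 G2 where G: "\<And>q. q \<in> {-(1/2)<..<1/2} \<Longrightarrow> (G \<kappa> d (n d) has_real_derivative G1 q) (at q)"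
        "\<And>q. q \<in> {-(1/2)<..<1/2} \<Longrightarrow> (G1 has_real_derivative G2 q) (at q)"
        "\<And>q. q \<in> {-(1/2)<..<1/2} \<Longrightarrow> 0 < pair_prob \<kappa> d q"
      and G0: "G \<kappa> d (n d) 0 = 0" "G1 0 = 0"
        "(real d) ^ 3 / (2 * (real d + 1) * n d) * (1 - \<kappa>\<^sup>2 / 4) ^ 4 \<le> G2 0"
      using G_taylor[OF d n \<kappa>] by blast
    have D2: "?D2 d q = G2 q" if q: "q \<in> {-(1/2)<..<1/2}" for q
    proof -
      \<comment> \<open>The second \<open>deriv\<close> sees \<open>deriv G\<close> on a neighbourhood, where it agrees with \<open>G1\<close>.\<close>
      have "\<forall>\<^sub>F p in nhds q. p \<in> {-(1/2)<..<1/2::real}"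
        by (rule eventually_nhds_in_open[OF open_greaterThanLessThan q])
      then have "\<forall>\<^sub>F p in nhds q. deriv (G \<kappa> d (n d)) p = G1 p"
        by eventually_elim (auto intro!: DERIV_imp_deriv G(1))
      then have "?D2 d q = deriv G1 q" by (rule deriv_cong_ev) simp
      also have "\<dots> = G2 q" by (rule DERIV_imp_deriv[OF G(2)[OF q]])
      finally show ?thesis .
    qed
    obtain l where l: "0 < l" "l < n d" and q: "\<epsilon> / 2 \<le> 1 - 2 * real l / real (n d)" "1 - 2 * real
        l / real (n d) \<le> \<epsilon>"
      using overlap_near[OF \<epsilon>(3) _ elim(3)] \<epsilon>(4) by auto
    define q where "q = 1 - 2 * real l / real (n d)"
    have qS: "x \<in> {-(1/2)<..<1/2}" "\<bar>x\<bar> < 1" if "x \<in> {0..\<epsilon>}" for x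
      using that \<epsilon> by auto
    have growth: "c * q\<^sup>2 / 2 \<le> G \<kappa> d (n d) q - cramer_rate q"
    proof (rule second_order_growth[where f = "\<lambda>x. G \<kappa> d (n d) x - cramer_rate x" and b = \<epsilon>
          and ?f1.0 = "\<lambda>x. G1 x - (ln (1 + x) - ln (1 - x)) / 2" and ?f2.0 = "\<lambda>x. G2 x - 1 / (1 - x\<^sup>2)"])
      fix x assume x: "x \<in> {0..\<epsilon>}"
      show "((\<lambda>x. G \<kappa> d (n d) x - cramer_rate x) has_real_derivative G1 x - (ln (1 + x) - ln (1 -
          x)) / 2) (at x)"
        by (intro DERIV_diff G(1) cramer_rate_deriv(1) qS x)
      show "((\<lambda>x. G1 x - (ln (1 + x) - ln (1 - x)) / 2) has_real_derivative G2 x - 1 / (1 - x\<^sup>2)) (at x)"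
        by (intro DERIV_diff G(2) cramer_rate_deriv(2) qS x)
      have "ereal \<bar>?D2 d x - ?D2 d 0\<bar> \<le> (SUP q\<in>{- \<epsilon>..\<epsilon>}. ereal \<bar>?D2 d q - ?D2 d 0\<bar>)"
        using x by (intro SUP_upper) auto
      also have "\<dots> < ereal c" by (rule elim(2))
      finally have "\<bar>G2 x - G2 0\<bar> < c"
        using D2[OF qS(1)[OF x]] D2[of 0] by simp
      moreover have "1 / (1 - x\<^sup>2) \<le> 1 / (1 - \<epsilon>\<^sup>2)"
      proof (rule divide_left_mono)
        have "x\<^sup>2 \<le> \<epsilon>\<^sup>2" using x by (intro power_mono) auto
        moreover have "\<epsilon>\<^sup>2 < 1" using \<epsilon> by (simp add: abs_square_less_1)
        ultimately show "1 - \<epsilon>\<^sup>2 \<le> 1 - x\<^sup>2" "0 < (1 - x\<^sup>2) * (1 - \<epsilon>\<^sup>2)" by auto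
      qed simp
      ultimately show "c \<le> G2 x - 1 / (1 - x\<^sup>2)"
        using \<epsilon>(2) G0(3) elim(1) by linarith
    qed (use G0 q \<epsilon> in \<open>auto simp: cramer_rate_def q_def\<close>)
    have "(\<epsilon> / 2)\<^sup>2 \<le> q\<^sup>2" using q \<epsilon> by (intro power_mono) (auto simp: q_def)
    then have "c * (\<epsilon> / 2)\<^sup>2 \<le> c * q\<^sup>2" using c by (intro mult_left_mono) auto
    then have "c * \<epsilon>\<^sup>2 / 8 \<le> c * q\<^sup>2 / 2" by (simp add: power_divide)
    then have main: "c * \<epsilon>\<^sup>2 / 8 \<le> G \<kappa> d (n d) q - cramer_rate q" using growth by linarith
    interpret I: iid_GOE "M d" d "n d" "W d"
      unfolding iid_GOE_def iid_GOE_axioms_def using assms(6,7,8)[OF d] d n by auto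
    have "q \<in> {0..\<epsilon>}" using q \<epsilon> by (auto simp: q_def)
    then have pp: "0 < pair_prob \<kappa> d q" by (rule G(3)[OF qS(1)])
    have "n d * (c * \<epsilon>\<^sup>2 / 8) - ln (real (n d) + 1) \<le> n d * (G \<kappa> d (n d) q - cramer_rate q) - ln
        (real (n d) + 1)"
      using main by (intro diff_right_mono mult_left_mono) auto
    also have "\<dots> \<le> ln ((\<integral>\<omega>. (real (num_solutions \<kappa> d (n d) (\<lambda>i. W d i \<omega>)))\<^sup>2 \<partial>M d)
                / (\<integral>\<omega>. real (num_solutions \<kappa> d (n d) (\<lambda>i. W d i \<omega>)) \<partial>M d)\<^sup>2)"
      using I.log_moment_ratio_lower_bound[OF \<kappa>(1) l] pp unfolding q_def by simp
    finally have "1 / (real d)\<^sup>2 * (n d * (c * \<epsilon>\<^sup>2 / 8) - ln (real (n d) + 1)) \<le> ?r d"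
      by (intro mult_left_mono) auto
    moreover have "1 / (real d)\<^sup>2 * (n d * (c * \<epsilon>\<^sup>2 / 8) - ln (real (n d) + 1)) = ?b d"
      using n by (simp add: right_diff_distrib)
    ultimately show ?case by (simp only:)
  qed
  have "?b \<longlonglongrightarrow> \<tau> * (c * \<epsilon>\<^sup>2 / 8 - 0)"
  proof (intro tendsto_mult tendsto_diff tendsto_const assms(5))
    have "(\<lambda>m. ln (real m + 1) / real m) \<longlonglongrightarrow> 0" by real_asymp
    then show "(\<lambda>d. ln (real (n d) + 1) / real (n d)) \<longlonglongrightarrow> 0"
      by (rule filterlim_compose[OF _ assms(3)])
  qed
  moreover have pos: "0 < \<tau> * (c * \<epsilon>\<^sup>2 / 8)" using assms(4) c \<epsilon>(3) by simp
  ultimately have "\<forall>\<^sub>F d in sequentially. \<tau> * (c * \<epsilon>\<^sup>2 / 8) / 2 < ?b d"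
    by (intro order_tendstoD(1)) auto
  with lower have "\<forall>\<^sub>F d in sequentially. ereal (\<tau> * (c * \<epsilon>\<^sup>2 / 8) / 2) \<le> ereal (?r d)"
  proof eventually_elim
    case (elim d)
    show ?case
      unfolding ereal_less_eq by (rule order_trans[OF less_imp_le[OF elim(2)] elim(1)])
  qed
  then have "ereal (\<tau> * (c * \<epsilon>\<^sup>2 / 8) / 2) \<le> liminf (\<lambda>d. ereal (?r d))"
    by (rule Liminf_bounded)
  moreover have "0 < ereal (\<tau> * (c * \<epsilon>\<^sup>2 / 8) / 2)" using pos by simp
  ultimately show ?thesis by (rule less_le_trans[rotated])
qed

end
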